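(* Let $\pi:M\to\mathbb{R}$ be a smooth fibred manifold with $\dim M=n+1$, let $S$ be a semispray on $J^1\pi$ with induced horizontal projector $h$, and let $\theta$ be a semi-basic $1$-form on $J^1\pi$ that is $d_J$-closed, i.e. $d_J\theta=0$. Then the following conditions are equivalent: (i) $\mathcal{L}_S\theta$ is closed; (ii) $\mathcal{L}_S\theta$ is exact; (iii) $\mathcal{L}_S\theta=d\,i_S\theta$; (iv) $d_h\theta=0$.
   Context: Everything is $C^\infty$. $\pi:M\to\mathbb{R}$ is a fibred manifold (surjective submersion) with $\dim M=n+1$, $J^1\pi$ is the first jet bundle of local sections of $\pi$, and $\pi_{10}:J^1\pi\to M$. Fibred coordinates $(t,x^i)$ on $M$ ($t$ the global coordinate of $\mathbb{R}$) induce coordinates $(t,x^i,y^i)$ on $J^1\pi$. Put $\delta x^i=dx^i-y^i\,dt$. Vertical vectors are those in $\operatorname{Ker}D\pi_{10}$, spanned by $\partial/\partial y^i$. The vertical endomorphism is $J=\frac{\partial}{\partial y^i}\otimes\delta x^i$. A semispray is a globally defined vector field $S$ on $J^1\pi$ with $J(S)=0$ and $dt(S)=1$. A $1$-form is semi-basic if it vanishes on vertical vectors. The semispray induces the horizontal projector $h=\frac12\left(\operatorname{Id}-\mathcal{L}_SJ+S\otimes dt\right)$, where $(\mathcal{L}_SJ)(X)=[S,JX]-J[S,X]$ and $(S\otimes dt)(X)=dt(X)S$. For a $(1,1)$-tensor field $A$ and a $k$-form $\omega$: $i_A\omega(X_1,\dots,X_k)=\sum_{j}\omega(X_1,\dots,AX_j,\dots,X_k)$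 (and $i_A\omega=0$ if $k=0$), and $d_A\omega=i_Ad\omega-d\,i_A\omega$. *)

theory Defs
  imports "HOL-Analysis.Analysis"
begin

section \<open>Smooth maps between Euclidean spaces\<close>

(* Only meant for open S; "v" ranges over all directions, so "Ck_on k S f" says that all iterated
   directional derivatives of order at most k exist, the last ones being continuous. *)
primrec Ck_on ::
  "nat \<Rightarrow> 'a::real_normed_vector set \<Rightarrow> ('a \<Rightarrow> 'b::real_normed_vector) \<Rightarrow> bool"
where
  "Ck_on 0 S f \<longleftrightarrow> continuous_on S f"
| "Ck_on (Suc k) S f \<longleftrightarrow>
     (\<forall>x\<in>S. f differentiable (at x)) \<and>
     (\<forall>v. Ck_on k S (\<lambda>x. frechet_derivative f (at x) v))"

definition smooth_on ::
  "'a::real_normed_vector set \<Rightarrow> ('a \<Rightarrow> 'b::real_normed_vector) \<Rightarrow> bool" where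
  "smooth_on S f \<longleftrightarrow> (\<forall>k. Ck_on k S f)"

(* A numbering e_0, e_1, ..., e_(d-1) of the orthonormal basis of a Euclidean space of dimension d,
   which makes it R^d with coordinates numbered from 0. *)
definition basis_vec :: "nat \<Rightarrow> 'e::euclidean_space" where
  "basis_vec = from_nat_into Basis"

definition coord :: "nat \<Rightarrow> 'e::euclidean_space \<Rightarrow> real" where
  "coord i x = x \<bullet> basis_vec i"


section \<open>Smooth manifolds\<close>

(* Manifolds are given by an atlas. A chart is a pair of its domain and the coordinate map, whose
   values off the domain are irrelevant. The points of the manifold are those in the domain of some
   chart, and its topology is the one for which all charts are homeomorphisms. *)

type_synonym ('p, 'e) chart = "'p set \<times> ('p \<Rightarrow> 'e)"
type_synonym ('p, 'e) atlas = "('p, 'e) chart set"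

definition points :: "('p, 'e::euclidean_space) atlas \<Rightarrow> 'p set" where
  "points A = (\<Union>(U, \<phi>)\<in>A. U)"

definition smooth_atlas :: "('p, 'e::euclidean_space) atlas \<Rightarrow> bool" where
  "smooth_atlas A \<longleftrightarrow>
     (\<forall>(U, \<phi>)\<in>A. inj_on \<phi> U \<and> open (\<phi> ` U)) \<and>
     (\<forall>(U, \<phi>)\<in>A. \<forall>(V, \<psi>)\<in>A.
        open (\<phi> ` (U \<inter> V)) \<and> smooth_on (\<phi> ` (U \<inter> V)) (\<psi> \<circ> inv_into U \<phi>))"

definition atlas_open :: "('p, 'e::euclidean_space) atlas \<Rightarrow> 'p set \<Rightarrow> bool" where
  "atlas_open A W \<longleftrightarrow> W \<subseteq> points A \<and> (\<forall>(U, \<phi>)\<in>A. open (\<phi> ` (W \<inter> U)))"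

definition atlas_topology :: "('p, 'e::euclidean_space) atlas \<Rightarrow> 'p topology" where
  "atlas_topology A = topology (atlas_open A)"

lemma openin_atlas_topology:
  assumes "smooth_atlas A"
  shows "openin (atlas_topology A) = atlas_open A"
proof -
  have inj: "inj_on \<phi> U" if "(U, \<phi>) \<in> A" for U \<phi>
    using assms that by (auto simp: smooth_atlas_def)
  have "istopology (atlas_open A)"
    unfolding istopology_def
  proof (intro conjI allI impI)
    fix S T assume S: "atlas_open A S" and T: "atlas_open A T"
    have "open (\<phi> ` (S \<inter> T \<inter> U))" if c: "(U, \<phi>) \<in> A" for U \<phi>
    proof -
      have "\<phi> ` (S \<inter> T \<inter> U) = \<phi> ` ((S \<inter> U) \<inter> (T \<inter> U))"
        by (rule arg_cong[where f = "(`) \<phi>"]) blast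
      also have "\<dots> = \<phi> ` (S \<inter> U) \<inter> \<phi> ` (T \<inter> U)"
        by (rule inj_on_image_Int[OF inj[OF c]]) auto
      finally have *: "\<phi> ` (S \<inter> T \<inter> U) = \<phi> ` (S \<inter> U) \<inter> \<phi> ` (T \<inter> U)" .
      have "open (\<phi> ` (S \<inter> U))" "open (\<phi> ` (T \<inter> U))"
        using S T c by (auto simp: atlas_open_def)
      then show ?thesis by (simp add: * open_Int)
    qed
    then show "atlas_open A (S \<inter> T)"
      using S by (auto simp: atlas_open_def)
  next
    fix \<K> assume K: "\<forall>K\<in>\<K>. atlas_open A K"
    have "open (\<phi> ` (\<Union>\<K> \<inter> U))" if "(U, \<phi>) \<in> A" for U \<phi>
    proof -
      have "\<phi> ` (\<Union>\<K> \<inter> U) = (\<Union>K\<in>\<K>. \<phi> ` (K \<inter> U))" by blast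
      moreover have "open (\<phi> ` (K \<inter> U))" if "K \<in> \<K>" for K
        using K that \<open>(U, \<phi>) \<in> A\<close> by (auto simp: atlas_open_def)
      ultimately show ?thesis by (simp add: open_UN)
    qed
    then show "atlas_open A (\<Union>\<K>)"
      using K by (auto simp: atlas_open_def)
  qed
  then show ?thesis by (simp add: atlas_topology_def)
qed

definition smooth_manifold :: "('p, 'e::euclidean_space) atlas \<Rightarrow> bool" where
  "smooth_manifold A \<longleftrightarrow>
     smooth_atlas A \<and> Hausdorff_space (atlas_topology A) \<and> second_countable (atlas_topology A)"

definition maximal_atlas :: "('p, 'e::euclidean_space) atlas \<Rightarrow> ('p, 'e) atlas" where
  "maximal_atlas A = {(U, \<phi>). U \<subseteq> points A \<and> smooth_atlas (insert (U, \<phi>) A)}"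


section \<open>Functions, tangent vectors and vector fields\<close>

(* f is smooth on some neighbourhood of p; elsewhere f is arbitrary. *)
definition smooth_at :: "('p, 'e::euclidean_space) atlas \<Rightarrow> 'p \<Rightarrow> ('p \<Rightarrow> real) \<Rightarrow> bool" where
  "smooth_at A p f \<longleftrightarrow>
     (\<exists>(U, \<phi>)\<in>A. p \<in> U \<and>
        (\<exists>W. open W \<and> \<phi> p \<in> W \<and> W \<subseteq> \<phi> ` U \<and> smooth_on W (f \<circ> inv_into U \<phi>)))"

(* Functions on a manifold are normalised to vanish off its set of points, so that equality of
   functions on the manifold is equality in HOL. Vector fields and forms are treated alike. *)
definition smooth_functions :: "('p, 'e::euclidean_space) atlas \<Rightarrow> ('p \<Rightarrow> real) set" where
  "smooth_functions A = {f. (\<forall>p\<in>points A. smooth_at A p f) \<and> (\<forall>p. p \<notin> points A \<longrightarrow> f p = 0)}"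

(* Tangent vectors at p act on the functions that are smooth near p (they give 0 on all others). *)
type_synonym 'p tvec = "('p \<Rightarrow> real) \<Rightarrow> real"

definition dir_deriv ::
  "('p, 'e::euclidean_space) atlas \<Rightarrow> ('p, 'e) chart \<Rightarrow> 'p \<Rightarrow> 'e \<Rightarrow> 'p tvec" where
  "dir_deriv A c p w = (\<lambda>f.
     if smooth_at A p f
     then frechet_derivative (f \<circ> inv_into (fst c) (snd c)) (at (snd c p)) w
     else 0)"

definition tangent_space :: "('p, 'e::euclidean_space) atlas \<Rightarrow> 'p \<Rightarrow> 'p tvec set" where
  "tangent_space A p = {dir_deriv A c p w | c w. c \<in> A \<and> p \<in> fst c}"

type_synonym 'p vfield = "'p \<Rightarrow> 'p tvec"

definition vector_fields :: "('p, 'e::euclidean_space) atlas \<Rightarrow> 'p vfield set" where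
  "vector_fields A = {X.
     (\<forall>p\<in>points A. X p \<in> tangent_space A p) \<and>
     (\<forall>p. p \<notin> points A \<longrightarrow> X p = (\<lambda>f. 0)) \<and>
     (\<forall>p\<in>points A. \<forall>f. smooth_at A p f \<longrightarrow> smooth_at A p (\<lambda>q. X q f))}"

definition lie_bracket ::
  "('p, 'e::euclidean_space) atlas \<Rightarrow> 'p vfield \<Rightarrow> 'p vfield \<Rightarrow> 'p vfield" where
  "lie_bracket A X Y = (\<lambda>p f.
     if smooth_at A p f then X p (\<lambda>q. Y q f) - Y p (\<lambda>q. X q f) else 0)"


section \<open>Differential forms\<close>

(* A k-form is an alternating, multilinear map over the ring of smooth functions, from k-tuples of
   vector fields to smooth functions. Tuples are lists, and a k-form vanishes on lists that are not
   k-tuples of vector fields; its degree need therefore not be passed to the operators below.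
   A 0-form is its value on the empty list. *)
type_synonym 'p form = "'p vfield list \<Rightarrow> 'p \<Rightarrow> real"

definition is_form :: "('p, 'e::euclidean_space) atlas \<Rightarrow> nat \<Rightarrow> 'p form \<Rightarrow> bool" where
  "is_form A k \<omega> \<longleftrightarrow>
     (\<forall>Xs. length Xs = k \<and> set Xs \<subseteq> vector_fields A \<longrightarrow> \<omega> Xs \<in> smooth_functions A) \<and>
     (\<forall>Xs. \<not> (length Xs = k \<and> set Xs \<subseteq> vector_fields A) \<longrightarrow> \<omega> Xs = (\<lambda>p. 0)) \<and>
     (\<forall>Xs i. length Xs = k \<and> set Xs \<subseteq> vector_fields A \<and> i < k \<longrightarrow>
        (\<forall>X\<in>vector_fields A. \<forall>Y\<in>vector_fields A.
           \<omega> (Xs[i := (\<lambda>p f. X p f + Y p f)]) = (\<lambda>p. \<omega> (Xs[i := X]) p + \<omega> (Xs[i := Y]) p)) \<and>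
        (\<forall>g\<in>smooth_functions A. \<forall>X\<in>vector_fields A.
           \<omega> (Xs[i := (\<lambda>p f. g p * X p f)]) = (\<lambda>p. g p * \<omega> (Xs[i := X]) p))) \<and>
     (\<forall>Xs i j. length Xs = k \<and> set Xs \<subseteq> vector_fields A \<and> i < j \<and> j < k \<and> Xs ! i = Xs ! j \<longrightarrow>
        \<omega> Xs = (\<lambda>p. 0))"

definition on_fields :: "('p, 'e::euclidean_space) atlas \<Rightarrow> 'p form \<Rightarrow> 'p form" where
  "on_fields A \<omega> = (\<lambda>Xs p. if set Xs \<subseteq> vector_fields A then \<omega> Xs p else 0)"

definition zero_form :: "'p form" where
  "zero_form = (\<lambda>Xs p. 0)"

(* The invariant formula for the exterior derivative; "nths Xs (- I)" is Xs with the entries at the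
   positions in I left out. *)
definition ext_d :: "('p, 'e::euclidean_space) atlas \<Rightarrow> 'p form \<Rightarrow> 'p form" where
  "ext_d A \<omega> = on_fields A (\<lambda>Xs p.
     (\<Sum>i<length Xs. (-1) ^ i * (Xs ! i) p (\<omega> (nths Xs (- {i})))) +
     (\<Sum>j<length Xs. \<Sum>i<j. (-1) ^ (i + j) *
        \<omega> (lie_bracket A (Xs ! i) (Xs ! j) # nths Xs (- {i, j})) p))"

definition int_prod :: "('p, 'e::euclidean_space) atlas \<Rightarrow> 'p vfield \<Rightarrow> 'p form \<Rightarrow> 'p form" where
  "int_prod A X \<omega> = on_fields A (\<lambda>Xs. \<omega> (X # Xs))"

definition lie_form :: "('p, 'e::euclidean_space) atlas \<Rightarrow> 'p vfield \<Rightarrow> 'p form \<Rightarrow> 'p form" where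
  "lie_form A X \<omega> = on_fields A (\<lambda>Xs p.
     X p (\<omega> Xs) - (\<Sum>j<length Xs. \<omega> (Xs[j := lie_bracket A X (Xs ! j)]) p))"

(* (1,1)-tensor fields T are given by their action on vector fields. *)
definition int_tensor ::
  "('p, 'e::euclidean_space) atlas \<Rightarrow> ('p vfield \<Rightarrow> 'p vfield) \<Rightarrow> 'p form \<Rightarrow> 'p form" where
  "int_tensor A T \<omega> = on_fields A (\<lambda>Xs p. \<Sum>j<length Xs. \<omega> (Xs[j := T (Xs ! j)]) p)"

definition d_tensor ::
  "('p, 'e::euclidean_space) atlas \<Rightarrow> ('p vfield \<Rightarrow> 'p vfield) \<Rightarrow> 'p form \<Rightarrow> 'p form" where
  "d_tensor A T \<omega> = (\<lambda>Xs p. int_tensor A T (ext_d A \<omega>) Xs p - ext_d A (int_tensor A T \<omega>) Xs p)"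

definition closed_form :: "('p, 'e::euclidean_space) atlas \<Rightarrow> 'p form \<Rightarrow> bool" where
  "closed_form A \<omega> \<longleftrightarrow> ext_d A \<omega> = zero_form"

definition exact_1form :: "('p, 'e::euclidean_space) atlas \<Rightarrow> 'p form \<Rightarrow> bool" where
  "exact_1form A \<omega> \<longleftrightarrow> (\<exists>\<eta>. is_form A 0 \<eta> \<and> \<omega> = ext_d A \<eta>)"

(* The Lie derivative of a (1,1)-tensor field. *)
definition lie_tensor ::
  "('p, 'e::euclidean_space) atlas \<Rightarrow> 'p vfield \<Rightarrow> ('p vfield \<Rightarrow> 'p vfield) \<Rightarrow> ('p vfield \<Rightarrow> 'p vfield)"
where
  "lie_tensor A S T = (\<lambda>X p f. lie_bracket A S (T X) p f - T (lie_bracket A S X) p f)"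


section \<open>Fibred manifolds over the real line and their first jet bundle\<close>

definition fibred_manifold :: "('m, 'e::euclidean_space) atlas \<Rightarrow> ('m \<Rightarrow> real) \<Rightarrow> bool" where
  "fibred_manifold A \<pi> \<longleftrightarrow>
     smooth_manifold A \<and>
     (\<forall>p\<in>points A. smooth_at A p \<pi>) \<and>
     \<pi> ` points A = UNIV \<and>
     (\<forall>p\<in>points A. \<exists>v\<in>tangent_space A p. v \<pi> \<noteq> 0)"

(* Coordinate 0 is t, and coordinates 1, ..., n are x^1, ..., x^n. *)
definition fibred_charts ::
  "('m, 'e::euclidean_space) atlas \<Rightarrow> ('m \<Rightarrow> real) \<Rightarrow> ('m, 'e) atlas" where
  "fibred_charts A \<pi> = {(U, \<phi>)\<in>maximal_atlas A. \<forall>p\<in>U. coord 0 (\<phi> p) = \<pi> p}"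

(* \<sigma> is a smooth section of \<pi> near t; away from t it is arbitrary. *)
definition local_section ::
  "('m, 'e::euclidean_space) atlas \<Rightarrow> ('m \<Rightarrow> real) \<Rightarrow> real \<Rightarrow> (real \<Rightarrow> 'm) \<Rightarrow> bool" where
  "local_section A \<pi> t \<sigma> \<longleftrightarrow>
     (\<exists>(U, \<phi>)\<in>A. \<exists>I. open I \<and> t \<in> I \<and> \<sigma> ` I \<subseteq> U \<and> smooth_on I (\<phi> \<circ> \<sigma>) \<and> (\<forall>s\<in>I. \<pi> (\<sigma> s) = s))"

(* A 1-jet: its source t together with the class of all local sections near t that agree to first
   order at t. *)
type_synonym 'm jet = "real \<times> (real \<Rightarrow> 'm) set"

definition same_jet ::
  "('m, 'e::euclidean_space) atlas \<Rightarrow> real \<Rightarrow> (real \<Rightarrow> 'm) \<Rightarrow> (real \<Rightarrow> 'm) \<Rightarrow> bool" where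
  "same_jet A t \<sigma> \<tau> \<longleftrightarrow>
     \<sigma> t = \<tau> t \<and>
     (\<forall>(U, \<phi>)\<in>A. \<sigma> t \<in> U \<longrightarrow>
        vector_derivative (\<phi> \<circ> \<sigma>) (at t) = vector_derivative (\<phi> \<circ> \<tau>) (at t))"

definition jet1 ::
  "('m, 'e::euclidean_space) atlas \<Rightarrow> ('m \<Rightarrow> real) \<Rightarrow> real \<Rightarrow> (real \<Rightarrow> 'm) \<Rightarrow> 'm jet" where
  "jet1 A \<pi> t \<sigma> = (t, {\<tau>. local_section A \<pi> t \<tau> \<and> same_jet A t \<sigma> \<tau>})"

definition jets :: "('m, 'e::euclidean_space) atlas \<Rightarrow> ('m \<Rightarrow> real) \<Rightarrow> 'm jet set" where
  "jets A \<pi> = {jet1 A \<pi> t \<sigma> | t \<sigma>. local_section A \<pi> t \<sigma>}"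

definition jet_rep :: "'m jet \<Rightarrow> real \<Rightarrow> 'm" where
  "jet_rep z = (SOME \<sigma>. \<sigma> \<in> snd z)"

definition pi10 :: "'m jet \<Rightarrow> 'm" where
  "pi10 z = jet_rep z (fst z)"

(* The coordinates (t, x^1, ..., x^n, y^1, ..., y^n) of a jet, numbered from 0 to 2n, that are
   induced by the coordinate map \<phi>. *)
definition jet_coords ::
  "nat \<Rightarrow> ('m \<Rightarrow> 'e::euclidean_space) \<Rightarrow> 'm jet \<Rightarrow> 'j::euclidean_space" where
  "jet_coords n \<phi> z =
     (\<Sum>i=0..n. coord i (\<phi> (pi10 z)) *\<^sub>R basis_vec i) +
     (\<Sum>i=1..n. coord i (vector_derivative (\<phi> \<circ> jet_rep z) (at (fst z))) *\<^sub>R basis_vec (n + i))"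

(* Every point of M has a fibred chart around it because \<pi> is a submersion, so the points of this
   atlas are all 1-jets. 'j has to have dimension 2n + 1. *)
definition jet_atlas ::
  "nat \<Rightarrow> ('m, 'e::euclidean_space) atlas \<Rightarrow> ('m \<Rightarrow> real) \<Rightarrow> ('m jet, 'j::euclidean_space) atlas" where
  "jet_atlas n A \<pi> =
     {({z \<in> jets A \<pi>. pi10 z \<in> U}, jet_coords n \<phi>) | U \<phi>. (U, \<phi>) \<in> fibred_charts A \<pi>}"

definition vertical :: "('m, 'e::euclidean_space) atlas \<Rightarrow> 'm jet \<Rightarrow> 'm jet tvec \<Rightarrow> bool" where
  "vertical A z v \<longleftrightarrow> (\<forall>g. smooth_at A (pi10 z) g \<longrightarrow> v (g \<circ> pi10) = 0)"

definition semibasic ::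
  "('m, 'e::euclidean_space) atlas \<Rightarrow> ('m jet, 'j::euclidean_space) atlas \<Rightarrow> 'm jet form \<Rightarrow> bool" where
  "semibasic A N \<theta> \<longleftrightarrow>
     (\<forall>X\<in>vector_fields N. \<forall>z\<in>points N. vertical A z (X z) \<longrightarrow> \<theta> [X] z = 0)"

(* dt(X) = X(t), where t is the source of a jet. *)
definition dt :: "'m jet vfield \<Rightarrow> 'm jet \<Rightarrow> real" where
  "dt X z = X z fst"

(* In what follows N is to be jet_atlas n A \<pi>. This is dx^i - y^i dt in the chart c. *)
definition contact_form ::
  "nat \<Rightarrow> ('m jet, 'j::euclidean_space) chart \<Rightarrow> nat \<Rightarrow> 'm jet \<Rightarrow> 'm jet tvec \<Rightarrow> real" where
  "contact_form n c i z v =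
     v (\<lambda>q. coord i (snd c q)) - coord (n + i) (snd c z) * v (\<lambda>q. coord 0 (snd c q))"

(* The value that the coordinate expression of J has in all induced charts around z; it is a
   classical fact that these values agree. *)
definition vert_endo ::
  "nat \<Rightarrow> ('m jet, 'j::euclidean_space) atlas \<Rightarrow> 'm jet vfield \<Rightarrow> 'm jet vfield" where
  "vert_endo n N X z =
     (if z \<in> points N
      then THE u. \<forall>c\<in>N. z \<in> fst c \<longrightarrow>
        u = (\<lambda>f. \<Sum>i=1..n. contact_form n c i z (X z) * dir_deriv N c z (basis_vec (n + i)) f)
      else (\<lambda>f. 0))"

definition semispray :: "nat \<Rightarrow> ('m jet, 'j::euclidean_space) atlas \<Rightarrow> 'm jet vfield \<Rightarrow> bool" where
  "semispray n N S \<longleftrightarrow>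
     S \<in> vector_fields N \<and>
     vert_endo n N S = (\<lambda>z f. 0) \<and>
     (\<forall>z\<in>points N. dt S z = 1)"

definition horiz_proj ::
  "nat \<Rightarrow> ('m jet, 'j::euclidean_space) atlas \<Rightarrow> 'm jet vfield \<Rightarrow> 'm jet vfield \<Rightarrow> 'm jet vfield" where
  "horiz_proj n N S = (\<lambda>X z f.
     (X z f - lie_tensor N S (vert_endo n N) X z f + dt X z * S z f) / 2)"

end

(* Write V = X - h X for the vertical part of X. Since theta is semi-basic, d_J-closedness says
   d theta(J X, Y) + d theta(X, J Y) = 0. Together with J [S, V] = - V and J S = 0 this gives
   d theta(S, V) = - d theta(S, J [S, V]) = d theta(J S, [S, V]) = 0 for every vertical V, so no
   local extension of vertical vectors is needed. As (L_S J) X = - X + 2 V + dt(X) S, it follows that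
   d theta(S, (L_S J) X) = - d theta(S, X). If L_S theta is closed, then applying L_S to
   i_J d theta = 0 yields d theta((L_S J) X, Y) + d theta(X, (L_S J) Y) = 0, and X = S gives
   i_S d theta = 0 because (L_S J) S = 0; by Cartan's formula this is (iii). Finally,
   2 d_h theta(X, Y) = dt(X) d theta(S, Y) + dt(Y) d theta(X, S)
     - d theta((L_S J) X, Y) - d theta(X, (L_S J) Y),
   which links (iii) and (iv) in the same way. *)
theory Submission
  imports Defs
begin

section \<open>Calculus of smooth maps\<close>

text \<open>Forms are evaluated on global vector fields only, and no field with a prescribed value
  at a point is ever constructed. Pointwise facts are obtained by letting tangent vectors act on
  germs: coordinate functions, and functions \<open>g\<close> pulled back from \<open>M\<close>. The
  relation \<open>J [S, V] = - V\<close> is a coordinate fact: \<open>S\<close> is d/dt + y d/dx up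
  to a vertical term, so \<open>S x = y\<close>, while \<open>V x = 0\<close> near every point;
  hence \<open>[S, V] x = - V y\<close>. That \<open>X - h X\<close> is vertical has the same
  source: \<open>S g\<close> is affine in y, so \<open>J X (S g) = X g - dt(X) S g\<close>, and as
  vertical fields kill \<open>g\<close>, the field \<open>(L_S J) X\<close> acts on \<open>g\<close>
  as \<open>dt(X) S - X\<close>. The factor 1/2 in \<open>h\<close> then makes \<open>h X\<close>
  act on \<open>g\<close> as \<open>X\<close> does. All this needs \<open>J\<close> to be
  independent of the chart, being defined by a \<open>THE\<close>. Changes of jet coordinates are
  affine along the fibres, with the derivative of the base change as linear part, which gives the
  invariance. Symmetry of second derivatives enters through the bracket: it makes the bracket a
  vector field, and the Jacobi identity then lets \<open>L_S\<close> commute with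
  \<open>d\<close>.\<close>

abbreviation Dd :: "('a::real_normed_vector \<Rightarrow> 'b::real_normed_vector) \<Rightarrow> 'a \<Rightarrow> 'a \<Rightarrow> 'b" where
  "Dd f x \<equiv> frechet_derivative f (at x)"

lemma Dd_works: "f differentiable at x \<Longrightarrow> (f has_derivative Dd f x) (at x)"
  by (simp add: frechet_derivative_works)

lemma Dd_unique: "(f has_derivative f') (at x) \<Longrightarrow> Dd f x = f'"
  by (metis frechet_derivative_at)

lemma Dd_cong_open:
  assumes "open S" "x \<in> S" "\<And>y. y \<in> S \<Longrightarrow> f y = g y" "f differentiable at x"
  shows "Dd f x = Dd g x" "g differentiable at x"
proof -
  show "Dd f x = Dd g x"
    using assms by (intro frechet_derivative_transform_within_open[of f x S g]) auto
  show "g differentiable at x"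
    using assms Dd_works[OF assms(4)] has_derivative_transform_within_open[of f "Dd f x" x UNIV S g]
    by (auto simp: differentiable_def)
qed

lemma has_derivative_cong_nhds:
  assumes "eventually (\<lambda>y. f y = g y) (nhds x)"
  shows "(f has_derivative f') (at x) \<longleftrightarrow> (g has_derivative f') (at x)"
proof -
  have *: "f x = g x" "eventually (\<lambda>y. f y = g y) (at x)"
    using assms by (simp_all add: eventually_nhds_conv_at)
  then have "eventually (\<lambda>y. g y = f y) (at x)" by (auto elim: eventually_mono)
  with * show ?thesis
    using has_derivative_transform_eventually[of f f' x UNIV g]
      has_derivative_transform_eventually[of g f' x UNIV f] by auto
qed

section \<open>Closure properties of \<open>Ck_on\<close>\<close>

lemma Ck_on_cong:
  assumes "open S" "Ck_on k S f" "\<And>x. x \<in> S \<Longrightarrow> f x = g x"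
  shows "Ck_on k S g"
  using assms(2,3)
proof (induction k arbitrary: f g)
  case 0
  then show ?case by (auto cong: continuous_on_cong)
next
  case (Suc k)
  have d: "f differentiable at x" if "x \<in> S" for x using Suc.prems that by simp
  have eq: "Dd f x = Dd g x" "g differentiable at x" if "x \<in> S" for x
    using Dd_cong_open[OF assms(1) that Suc.prems(2) d[OF that]] by auto
  have "Ck_on k S (\<lambda>x. Dd g x v)" for v
    using Suc.IH[of "\<lambda>x. Dd f x v" "\<lambda>x. Dd g x v"] Suc.prems eq by simp
  then show ?case using eq by simp
qed

lemma Ck_on_subset: "Ck_on k S f \<Longrightarrow> T \<subseteq> S \<Longrightarrow> Ck_on k T f"
  by (induction k arbitrary: f) (auto intro: continuous_on_subset)

lemma Ck_on_SucD: "Ck_on (Suc k) S f \<Longrightarrow> Ck_on k S f"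
proof (induction k arbitrary: f)
  case 0
  then show ?case
    by (auto intro!: differentiable_imp_continuous_on differentiable_at_imp_differentiable_on)
next
  case (Suc k)
  then show ?case by (metis Ck_on.simps(2))
qed

lemma Ck_on_local:
  assumes "\<And>x. x \<in> S \<Longrightarrow> \<exists>W. open W \<and> x \<in> W \<and> Ck_on k W f"
  shows "Ck_on k S f"
  using assms
proof (induction k arbitrary: f)
  case 0
  show ?case unfolding Ck_on.simps continuous_on_eq_continuous_within
  proof
    fix x assume "x \<in> S"
    then obtain W where "open W" "x \<in> W" "continuous_on W f" using 0 by auto
    then have "isCont f x" by (simp add: continuous_on_eq_continuous_at)
    then show "continuous (at x within S) f" using continuous_at_imp_continuous_at_within by blast
  qed
next
  case (Suc k)
  have "f differentiable at x" if "x \<in> S" for x using Suc.prems[OF that] by auto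
  moreover have "Ck_on k S (\<lambda>x. Dd f x v)" for v
  proof (rule Suc.IH)
    fix x assume "x \<in> S"
    then show "\<exists>W. open W \<and> x \<in> W \<and> Ck_on k W (\<lambda>x. Dd f x v)" using Suc.prems by fastforce
  qed
  ultimately show ?case by simp
qed

lemma Ck_on_const: "Ck_on k S (\<lambda>x. c)"
  by (induction k arbitrary: c) (auto simp: differentiable_const)

lemma Ck_on_linear:
  assumes "bounded_linear f"
  shows "Ck_on k S f"
proof (cases k)
  case 0
  then show ?thesis using assms by (simp add: linear_continuous_on)
next
  case (Suc m)
  have "Dd f x = f" for x by (rule Dd_unique) (rule bounded_linear_imp_has_derivative[OF assms])
  then show ?thesis using Suc assms by (auto simp: Ck_on_const bounded_linear_imp_differentiable)
qed

lemma Ck_on_add: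
  assumes "open S" "Ck_on k S f" "Ck_on k S g"
  shows "Ck_on k S (\<lambda>x. f x + g x)"
  using assms(2,3)
proof (induction k arbitrary: f g)
  case 0
  then show ?case by (auto intro: continuous_intros)
next
  case (Suc k)
  have *: "((\<lambda>x. f x + g x) has_derivative (\<lambda>v. Dd f x v + Dd g x v)) (at x)" if "x \<in> S" for x
    using Suc.prems that by (auto intro!: has_derivative_add Dd_works)
  have "Ck_on k S (\<lambda>x. Dd (\<lambda>x. f x + g x) x v)" for v
    by (rule Ck_on_cong[OF assms(1) Suc.IH[of "\<lambda>x. Dd f x v" "\<lambda>x. Dd g x v"]])
       (use Suc.prems Dd_unique[OF *] in auto)
  then show ?case using * by (auto simp: differentiable_def)
qed

text \<open>One product rule serves multiplication, scaling and the inner product alike. The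
  derivative is again a sum of two terms of the form \<open>b _ _\<close>, so the induction
  closes.\<close>

lemma Ck_on_bilinear:
  assumes "bounded_bilinear b" "open S" "Ck_on k S f" "Ck_on k S g"
  shows "Ck_on k S (\<lambda>x. b (f x) (g x))"
  using assms(3,4)
proof (induction k arbitrary: f g)
  case 0
  then show ?case by (auto intro: bounded_bilinear.continuous_on[OF assms(1)])
next
  case (Suc k)
  have *: "((\<lambda>x. b (f x) (g x)) has_derivative (\<lambda>v. b (f x) (Dd g x v) + b (Dd f x v) (g x))) (at x)"
    if "x \<in> S" for x
    using Suc.prems that by (intro bounded_bilinear.FDERIV[OF assms(1)]) (auto intro!: Dd_works)
  have "Ck_on k S (\<lambda>x. Dd (\<lambda>x. b (f x) (g x)) x v)" for v
    by (rule Ck_on_cong[OF assms(2) Ck_on_add[OF assms(2) Suc.IH[of f "\<lambda>x. Dd g x v"]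
          Suc.IH[of "\<lambda>x. Dd f x v" g]]])
       (use Suc.prems Dd_unique[OF *] Ck_on_SucD in auto)
  then show ?case using * by (auto simp: differentiable_def)
qed

lemma Ck_on_sum:
  assumes "open S" "\<And>i. i \<in> I \<Longrightarrow> Ck_on k S (f i)"
  shows "Ck_on k S (\<lambda>x. \<Sum>i\<in>I. f i x)"
  using assms(2)
  by (induction I rule: infinite_finite_induct) (auto intro!: Ck_on_const Ck_on_add assms(1))

lemma linear_Basis_expand:
  fixes f :: "'a::euclidean_space \<Rightarrow> 'b::real_vector"
  assumes "linear f"
  shows "f v = (\<Sum>b\<in>Basis. (v \<bullet> b) *\<^sub>R f b)"
proof -
  have "f v = f (\<Sum>b\<in>Basis. (v \<bullet> b) *\<^sub>R b)" by (simp add: euclidean_representation)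
  also have "\<dots> = (\<Sum>b\<in>Basis. (v \<bullet> b) *\<^sub>R f b)"
    by (simp add: linear_sum[OF assms] linear_scale[OF assms])
  finally show ?thesis .
qed

lemma Ck_on_inner: "open S \<Longrightarrow> Ck_on k S f \<Longrightarrow> Ck_on k S (\<lambda>x. f x \<bullet> c)"
  by (rule Ck_on_bilinear[OF bounded_bilinear_inner _ _ Ck_on_const])

text \<open>The chain rule yields \<open>Dd g (f x) (Dd f x v)\<close>, whose direction varies with
  \<open>x\<close>, whereas \<open>Ck_on\<close> speaks of fixed directions. Expanding the direction
  in the basis turns it into a sum of products to which the induction hypothesis applies; this is
  why the middle space is Euclidean.\<close>

lemma Ck_on_compose:
  fixes f :: "'a::real_normed_vector \<Rightarrow> 'b::euclidean_space" and g :: "'b \<Rightarrow> 'c::real_normed_vector"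
  assumes "open S" "open T" "f ` S \<subseteq> T" "Ck_on k S f" "Ck_on k T g"
  shows "Ck_on k S (\<lambda>x. g (f x))"
  using assms(4,5)
proof (induction k arbitrary: g)
  case 0
  then show ?case using assms(3) by (auto intro: continuous_on_compose2)
next
  case (Suc k)
  have *: "((\<lambda>x. g (f x)) has_derivative (\<lambda>v. Dd g (f x) (Dd f x v))) (at x)" if "x \<in> S" for x
    using Suc.prems that assms(3)
    by (intro has_derivative_compose[of f _ x UNIV g]) (auto intro!: Dd_works)
  have lin: "Dd g (f x) w = (\<Sum>b\<in>Basis. (w \<bullet> b) *\<^sub>R Dd g (f x) b)" if "x \<in> S" for x w
    by (rule linear_Basis_expand) (use Suc.prems that assms(3) in \<open>auto intro!: linear_frechet_derivative\<close>)
  have "Ck_on k S (\<lambda>x. Dd (\<lambda>x. g (f x)) x v)" for v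
  proof (rule Ck_on_cong[OF assms(1)])
    show "Ck_on k S (\<lambda>x. \<Sum>b\<in>Basis. (Dd f x v \<bullet> b) *\<^sub>R Dd g (f x) b)"
    proof (intro Ck_on_sum assms(1) Ck_on_bilinear[OF bounded_bilinear_scaleR] Ck_on_inner)
      show "Ck_on k S (\<lambda>x. Dd f x v)" using Suc.prems by simp
      show "Ck_on k S (\<lambda>x. Dd g (f x) b)" for b
        by (rule Suc.IH[of "\<lambda>y. Dd g y b"]) (use Suc.prems Ck_on_SucD in auto)
    qed
  qed (use Dd_unique[OF *] lin in auto)
  then show ?case using * by (auto simp: differentiable_def)
qed

text \<open>Smoothness of a germ. The neighbourhood stays hidden, so that sums, products and
  composites can be formed without tracking domains.\<close>

definition smooth_near :: "('a::real_normed_vector \<Rightarrow> 'b::real_normed_vector) \<Rightarrow> 'a \<Rightarrow> bool" where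
  "smooth_near f x \<longleftrightarrow> (\<exists>W. open W \<and> x \<in> W \<and> smooth_on W f)"

lemma smooth_on_imp_near: "smooth_on S f \<Longrightarrow> open S \<Longrightarrow> x \<in> S \<Longrightarrow> smooth_near f x"
  by (auto simp: smooth_near_def)

lemma smooth_on_local: "(\<And>x. x \<in> S \<Longrightarrow> smooth_near f x) \<Longrightarrow> smooth_on S f"
  unfolding smooth_on_def smooth_near_def by (metis Ck_on_local)

lemma smooth_on_subset: "smooth_on S f \<Longrightarrow> T \<subseteq> S \<Longrightarrow> smooth_on T f"
  unfolding smooth_on_def by (metis Ck_on_subset)

lemma smooth_near_eventually: "smooth_near f x \<Longrightarrow> eventually (smooth_near f) (nhds x)"
  unfolding smooth_near_def eventually_nhds by auto

lemma smooth_near_differentiable: "smooth_near f x \<Longrightarrow> f differentiable at x"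
  unfolding smooth_near_def smooth_on_def by (metis Ck_on.simps(2))

lemma smooth_near_has_derivative: "smooth_near f x \<Longrightarrow> (f has_derivative Dd f x) (at x)"
  by (simp add: Dd_works smooth_near_differentiable)

lemma smooth_near_isCont: "smooth_near f x \<Longrightarrow> isCont f x"
  by (metis differentiable_imp_continuous_within smooth_near_differentiable)

lemma smooth_near_filterlim: "smooth_near f x \<Longrightarrow> filterlim f (nhds (f x)) (nhds x)"
  using smooth_near_isCont isCont_def tendsto_at_iff_tendsto_nhds by blast

lemma smooth_near_cong:
  assumes "eventually (\<lambda>y. f y = g y) (nhds x)" "smooth_near f x"
  shows "smooth_near g x"
proof -
  obtain V where V: "open V" "x \<in> V" "\<And>y. y \<in> V \<Longrightarrow> f y = g y"
    using assms(1) by (auto simp: eventually_nhds)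
  obtain W where W: "open W" "x \<in> W" "smooth_on W f" using assms(2) by (auto simp: smooth_near_def)
  have "smooth_on (W \<inter> V) g"
    unfolding smooth_on_def using W V
    by (auto intro!: Ck_on_cong[of "W \<inter> V" _ f g] simp: smooth_on_def intro: Ck_on_subset)
  then show ?thesis using V W unfolding smooth_near_def by (metis IntI open_Int)
qed

text \<open>Differentiability is not assumed: \<open>frechet_derivative\<close> is a choice among
  all derivatives, and equal germs have the same derivatives, possibly none.\<close>

lemma Dd_cong:
  assumes "eventually (\<lambda>y. f y = g y) (nhds x)"
  shows "Dd f x = Dd g x"
proof -
  have "(f has_derivative f') (at x) \<longleftrightarrow> (g has_derivative f') (at x)" for f'
    by (rule has_derivative_cong_nhds[OF assms])
  then show ?thesis by (simp add: frechet_derivative_def)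
qed

lemma smooth_near_binary:
  assumes "smooth_near f x" "smooth_near g x"
    and "\<And>k W. open W \<Longrightarrow> Ck_on k W f \<Longrightarrow> Ck_on k W g \<Longrightarrow> Ck_on k W h"
  shows "smooth_near h x"
proof -
  obtain V W where "open V" "x \<in> V" "smooth_on V f" "open W" "x \<in> W" "smooth_on W g"
    using assms(1,2) by (auto simp: smooth_near_def)
  moreover from this have "Ck_on k (V \<inter> W) h" for k
    by (intro assms(3) open_Int) (auto simp: smooth_on_def intro: Ck_on_subset[OF _ Int_lower1]
        Ck_on_subset[OF _ Int_lower2])
  ultimately show ?thesis unfolding smooth_near_def smooth_on_def by (metis IntI open_Int)
qed

lemma smooth_near_const [simp, intro]: "smooth_near (\<lambda>x. c) x"
  unfolding smooth_near_def smooth_on_def using Ck_on_const open_UNIV by blast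

lemma smooth_near_linear: "bounded_linear f \<Longrightarrow> smooth_near f x"
  unfolding smooth_near_def smooth_on_def using Ck_on_linear open_UNIV by blast

lemma smooth_near_add: "smooth_near f x \<Longrightarrow> smooth_near g x \<Longrightarrow> smooth_near (\<lambda>x. f x + g x) x"
  by (erule (1) smooth_near_binary) (rule Ck_on_add)

lemma smooth_near_bilinear:
  "bounded_bilinear b \<Longrightarrow> smooth_near f x \<Longrightarrow> smooth_near g x \<Longrightarrow> smooth_near (\<lambda>x. b (f x) (g x)) x"
  by (erule (1) smooth_near_binary) (rule Ck_on_bilinear)

lemmas smooth_near_mult = smooth_near_bilinear[OF bounded_bilinear_mult]
lemmas smooth_near_scaleR = smooth_near_bilinear[OF bounded_bilinear_scaleR]
lemmas smooth_near_inner = smooth_near_bilinear[OF bounded_bilinear_inner]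

lemma smooth_near_sum:
  "(\<And>i. i \<in> I \<Longrightarrow> smooth_near (f i) x) \<Longrightarrow> smooth_near (\<lambda>x. \<Sum>i\<in>I. f i x) x"
  by (induction I rule: infinite_finite_induct) (auto intro: smooth_near_add)

lemma smooth_near_compose:
  fixes f :: "'a::real_normed_vector \<Rightarrow> 'b::euclidean_space" and g :: "'b \<Rightarrow> 'c::real_normed_vector"
  assumes "smooth_near f x" "smooth_near g (f x)"
  shows "smooth_near (\<lambda>x. g (f x)) x"
proof -
  obtain V W where VW: "open V" "x \<in> V" "smooth_on V f" "open W" "f x \<in> W" "smooth_on W g"
    using assms by (auto simp: smooth_near_def)
  have "continuous_on V f" using VW(3) by (metis Ck_on.simps(1) smooth_on_def)
  then have o: "open (V \<inter> f -` W)" using VW by (intro continuous_open_preimage)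
  have "Ck_on k (V \<inter> f -` W) (\<lambda>x. g (f x))" for k
  proof (rule Ck_on_compose[OF o VW(4)])
    show "Ck_on k (V \<inter> f -` W) f"
      using VW(3) unfolding smooth_on_def by (blast intro: Ck_on_subset)
    show "Ck_on k W g" using VW(6) by (simp add: smooth_on_def)
  qed auto
  moreover have "x \<in> V \<inter> f -` W" using VW by simp
  ultimately show ?thesis using o unfolding smooth_near_def smooth_on_def by blast
qed

lemma smooth_near_Dd: "smooth_near f x \<Longrightarrow> smooth_near (\<lambda>y. Dd f y v) x"
  unfolding smooth_near_def smooth_on_def by (metis Ck_on.simps(2))

lemma Dd_linear: "smooth_near f x \<Longrightarrow> linear (Dd f x)"
  by (simp add: linear_frechet_derivative smooth_near_differentiable)

lemma Dd_compose:
  assumes "smooth_near f x" "smooth_near g (f x)"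
  shows "Dd (\<lambda>x. g (f x)) x v = Dd g (f x) (Dd f x v)"
  using Dd_unique[OF has_derivative_compose[OF smooth_near_has_derivative[OF assms(1)]
        smooth_near_has_derivative[OF assms(2)]]] by simp

text \<open>A derivative in a direction that moves with the point. The basis expansion is valid only
  where \<open>g\<close> is smooth, hence the comparison of germs. It gives the smoothness of
  changes of velocity coordinates and of \<open>S g\<close> for \<open>g\<close> pulled back from
  the base.\<close>

lemma smooth_near_Dd_compose:
  fixes f :: "'a::real_normed_vector \<Rightarrow> 'b::euclidean_space" and w :: "'a \<Rightarrow> 'b"
  assumes "smooth_near f x" "smooth_near g (f x)" "smooth_near w x"
  shows "smooth_near (\<lambda>x. Dd g (f x) (w x)) x"
proof (rule smooth_near_cong)
  have "eventually (\<lambda>y. smooth_near g (f y)) (nhds x)"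
    using smooth_near_filterlim[OF assms(1)] smooth_near_eventually[OF assms(2)]
    by (simp add: filterlim_iff)
  then show "eventually (\<lambda>y. (\<Sum>b\<in>Basis. (w y \<bullet> b) *\<^sub>R Dd g (f y) b) = Dd g (f y) (w y)) (nhds x)"
    by (rule eventually_mono) (metis linear_Basis_expand Dd_linear)
  show "smooth_near (\<lambda>y. \<Sum>b\<in>Basis. (w y \<bullet> b) *\<^sub>R Dd g (f y) b) x"
    using assms
    by (intro smooth_near_sum smooth_near_scaleR smooth_near_inner smooth_near_const
        smooth_near_compose[of f x "\<lambda>y. Dd g y _"] smooth_near_Dd)
qed

text \<open>Both sides are derivatives at 0 of the same curve, and derivatives are unique. With
  this, maps of the form \<open>Dd F (P u) (Q u)\<close> can be differentiated along the fibres,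
  where they are affine, without computing second derivatives of \<open>F\<close>.\<close>

lemma Dd_affine_line:
  assumes "f differentiable at x" "eventually (\<lambda>s. f (x + s *\<^sub>R v) = a + s *\<^sub>R c) (nhds (0::real))"
  shows "Dd f x v = c"
proof -
  have "((\<lambda>s. x + s *\<^sub>R v) has_derivative (\<lambda>s. s *\<^sub>R v)) (at 0)"
    by (auto intro!: derivative_eq_intros)
  then have "((\<lambda>s. f (x + s *\<^sub>R v)) has_derivative (\<lambda>s. Dd f x (s *\<^sub>R v))) (at (0::real))"
    using has_derivative_compose[where g = f and g' = "Dd f x"] Dd_works[OF assms(1)] by fastforce
  moreover have "((\<lambda>s. a + s *\<^sub>R c) has_derivative (\<lambda>s. s *\<^sub>R c)) (at (0::real))"
    by (auto intro!: derivative_eq_intros)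
  then have "((\<lambda>s. f (x + s *\<^sub>R v)) has_derivative (\<lambda>s. s *\<^sub>R c)) (at (0::real))"
    by (simp add: has_derivative_cong_nhds[OF assms(2)])
  ultimately have "(\<lambda>s. Dd f x (s *\<^sub>R v)) = (\<lambda>s. s *\<^sub>R c)" by (rule has_derivative_unique)
  then show ?thesis by (metis scaleR_one)
qed

section \<open>Symmetry of second derivatives\<close>

lemma has_real_derivative_along_line:
  fixes f :: "'a::real_normed_vector \<Rightarrow> real"
  assumes "smooth_near f (a + t *\<^sub>R u)"
  shows "((\<lambda>t. f (a + t *\<^sub>R u)) has_real_derivative Dd f (a + t *\<^sub>R u) u) (at t)"
proof -
  have "((\<lambda>s. a + s *\<^sub>R u) has_derivative (\<lambda>s. s *\<^sub>R u)) (at t)"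
    by (auto intro!: derivative_eq_intros)
  from has_derivative_compose[OF this smooth_near_has_derivative[OF assms]]
  show ?thesis
    by (simp add: has_field_derivative_def linear_scale[OF Dd_linear[OF assms]] mult_commute_abs)
qed

text \<open>The mean value theorem is used twice: in direction \<open>u\<close> for the difference
  of \<open>f\<close> along two parallel sides, then in direction \<open>v\<close> for the
  derivative \<open>Dd f _ u\<close>.\<close>

lemma second_difference_mvt:
  fixes f :: "'a::euclidean_space \<Rightarrow> real"
  assumes smooth: "\<And>y. y \<in> cball x (s * (norm u + norm v)) \<Longrightarrow> smooth_near f y" and "s > 0"
  shows "\<exists>y\<in>cball x (s * (norm u + norm v)).
    f (x + s *\<^sub>R u + s *\<^sub>R v) - f (x + s *\<^sub>R u) - f (x + s *\<^sub>R v) + f x =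
      s * s * Dd (\<lambda>y. Dd f y u) y v"
proof -
  \<comment> \<open>The whole parallelogram spanned by \<open>s u\<close> and \<open>s v\<close>
    lies in the ball, so \<open>f\<close> is smooth wherever the mean value theorem is
    applied.\<close>
  have mem: "x + a *\<^sub>R u + b *\<^sub>R v \<in> cball x (s * (norm u + norm v))"
    if "0 \<le> a" "a \<le> s" "0 \<le> b" "b \<le> s" for a b
  proof -
    have "norm (a *\<^sub>R u + b *\<^sub>R v) \<le> a * norm u + b * norm v"
      using norm_triangle_ineq[of "a *\<^sub>R u" "b *\<^sub>R v"] that by simp
    also have "\<dots> \<le> s * norm u + s * norm v" using that by (intro add_mono mult_right_mono) auto
    finally show ?thesis by (simp add: dist_norm algebra_simps norm_minus_commute)
  qed
  have memu: "x + a *\<^sub>R u \<in> cball x (s * (norm u + norm v))" if "0 \<le> a" "a \<le> s" for a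
    using mem[of a 0] that by simp
  have comm: "x + a *\<^sub>R u + b *\<^sub>R v = (x + b *\<^sub>R v) + a *\<^sub>R u" for a b by simp
  have "\<exists>\<sigma>>0. \<sigma> < s \<and>
      (f (x + s *\<^sub>R u + s *\<^sub>R v) - f (x + s *\<^sub>R u)) - (f (x + 0 *\<^sub>R u + s *\<^sub>R v) - f (x + 0 *\<^sub>R u)) =
      (s - 0) * (Dd f (x + \<sigma> *\<^sub>R u + s *\<^sub>R v) u - Dd f (x + \<sigma> *\<^sub>R u) u)"
  proof (rule MVT2[OF \<open>s > 0\<close>])
    fix t :: real assume t: "0 \<le> t" "t \<le> s"
    show "((\<lambda>t. f (x + t *\<^sub>R u + s *\<^sub>R v) - f (x + t *\<^sub>R u)) has_real_derivative
        Dd f (x + t *\<^sub>R u + s *\<^sub>R v) u - Dd f (x + t *\<^sub>R u) u) (at t)"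
      unfolding comm using mem[of t s] memu[of t] t \<open>s > 0\<close>
      by (intro DERIV_diff has_real_derivative_along_line smooth) (simp_all add: comm)
  qed
  then obtain \<sigma> where \<sigma>: "0 < \<sigma>" "\<sigma> < s"
    "f (x + s *\<^sub>R u + s *\<^sub>R v) - f (x + s *\<^sub>R u) - f (x + s *\<^sub>R v) + f x =
      s * (Dd f (x + \<sigma> *\<^sub>R u + s *\<^sub>R v) u - Dd f (x + \<sigma> *\<^sub>R u) u)" by auto
  have "\<exists>\<tau>>0. \<tau> < s \<and>
      Dd f (x + \<sigma> *\<^sub>R u + s *\<^sub>R v) u - Dd f (x + \<sigma> *\<^sub>R u + 0 *\<^sub>R v) u =
      (s - 0) * Dd (\<lambda>y. Dd f y u) (x + \<sigma> *\<^sub>R u + \<tau> *\<^sub>R v) v"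
    using \<sigma> mem
    by (intro MVT2[OF \<open>s > 0\<close>] has_real_derivative_along_line smooth_near_Dd smooth) auto
  then obtain \<tau> where \<tau>: "0 < \<tau>" "\<tau> < s" "Dd f (x + \<sigma> *\<^sub>R u + s *\<^sub>R v) u - Dd f (x + \<sigma> *\<^sub>R u) u =
      s * Dd (\<lambda>y. Dd f y u) (x + \<sigma> *\<^sub>R u + \<tau> *\<^sub>R v) v" by auto
  show ?thesis
    using \<sigma> \<tau> mem[of \<sigma> \<tau>] by (intro bexI[of _ "x + \<sigma> *\<^sub>R u + \<tau> *\<^sub>R v"]) auto
qed

text \<open>The second difference is symmetric in \<open>u\<close> and \<open>v\<close>, so it
  equals \<open>s * s\<close> times either mixed derivative at some point nearby. Continuity of the
  mixed derivatives excludes different values at \<open>x\<close>.\<close>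

lemma Dd_symmetric:
  fixes f :: "'a::euclidean_space \<Rightarrow> real"
  assumes "smooth_near f x"
  shows "Dd (\<lambda>y. Dd f y u) x v = Dd (\<lambda>y. Dd f y v) x u"
proof (rule ccontr)
  let ?A = "\<lambda>y. Dd (\<lambda>y. Dd f y u) y v" and ?B = "\<lambda>y. Dd (\<lambda>y. Dd f y v) y u"
  assume ne: "?A x \<noteq> ?B x"
  \<comment> \<open>Half the gap: a number within distance less than \<open>e\<close> of both values
    cannot exist.\<close>
  define e where "e = \<bar>?A x - ?B x\<bar> / 2"
  have "e > 0" using ne by (simp add: e_def)
  have "(?A \<longlongrightarrow> ?A x) (nhds x)" "(?B \<longlongrightarrow> ?B x) (nhds x)"
    by (intro smooth_near_filterlim smooth_near_Dd assms)+
  then have "eventually (\<lambda>y. dist (?A y) (?A x) < e) (nhds x)" "eventually (\<lambda>y. dist (?B y) (?B x) < e) (nhds x)"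
    using \<open>e > 0\<close> by (auto dest: tendstoD)
  from eventually_conj[OF eventually_conj[OF this] smooth_near_eventually[OF assms]]
  obtain r where r: "r > 0" "\<And>y. dist y x < r \<Longrightarrow> \<bar>?A y - ?A x\<bar> < e"
    "\<And>y. dist y x < r \<Longrightarrow> \<bar>?B y - ?B x\<bar> < e" "\<And>y. dist y x < r \<Longrightarrow> smooth_near f y"
    by (auto simp: eventually_nhds_metric dist_real_def)
  \<comment> \<open>The summand 1 keeps the denominator positive when \<open>u\<close> and
    \<open>v\<close> are both 0, and makes the parallelogram fit strictly inside the ball of radius
    \<open>r\<close>.\<close>
  define s where "s = r / (norm u + norm v + 1)"
  have pos: "norm u + norm v + 1 > 0" by (smt (verit) norm_ge_zero)
  have s: "s > 0" using r pos by (simp add: s_def)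
  have "s * (norm u + norm v) < r"
    using r(1) pos by (simp add: s_def divide_less_eq algebra_simps)
  then have *: "dist y x < r" if "y \<in> cball x (s * (norm u + norm v))" for y
    using that by (simp add: dist_commute)
  have **: "dist y x < r" if "y \<in> cball x (s * (norm v + norm u))" for y
    using *[of y] that by (simp add: add.commute)
  obtain y where y: "dist y x < r"
    "f (x + s *\<^sub>R u + s *\<^sub>R v) - f (x + s *\<^sub>R u) - f (x + s *\<^sub>R v) + f x = s * s * ?A y"
    using second_difference_mvt[OF r(4)[OF *] s] * by blast
  obtain z where z: "dist z x < r"
    "f (x + s *\<^sub>R v + s *\<^sub>R u) - f (x + s *\<^sub>R v) - f (x + s *\<^sub>R u) + f x = s * s * ?B z"
    using second_difference_mvt[OF r(4)[OF **] s] ** by blast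
  have "x + s *\<^sub>R v + s *\<^sub>R u = x + s *\<^sub>R u + s *\<^sub>R v" by simp
  then have "s * s * ?A y = s * s * ?B z" using y(2) z(2) by (simp only:)
  then have "?A y = ?B z" using s by simp
  then show False using r(2)[OF y(1)] r(3)[OF z(1)] by (simp add: e_def abs_if split: if_splits)
qed

section \<open>Germs and tangent vectors on a manifold\<close>

abbreviation chart_inv :: "('p, 'e) chart \<Rightarrow> 'e \<Rightarrow> 'p" where
  "chart_inv c \<equiv> inv_into (fst c) (snd c)"

text \<open>The coordinate functions are junk off the chart domain, which is harmless: a tangent
  vector at a point of the domain depends on germs only.\<close>

definition components :: "('p, 'e::euclidean_space) chart \<Rightarrow> 'p tvec \<Rightarrow> 'e" where
  "components c v = (\<Sum>b\<in>Basis. v (\<lambda>q. snd c q \<bullet> b) *\<^sub>R b)"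

lemma components_inner: "b \<in> Basis \<Longrightarrow> components c v \<bullet> b = v (\<lambda>q. snd c q \<bullet> b)"
  by (simp add: components_def)

locale atlas =
  fixes B :: "('p, 'e::euclidean_space) atlas"
  assumes smooth_atlas: "smooth_atlas B"
begin

lemma inj_on_chart: "c \<in> B \<Longrightarrow> inj_on (snd c) (fst c)"
  using smooth_atlas by (auto simp: smooth_atlas_def split_beta)

lemma chart_inv_chart: "c \<in> B \<Longrightarrow> p \<in> fst c \<Longrightarrow> chart_inv c (snd c p) = p"
  using inj_on_chart by (metis inv_into_f_f)

lemma open_chart_Int: "c \<in> B \<Longrightarrow> c' \<in> B \<Longrightarrow> open (snd c ` (fst c \<inter> fst c'))"
  using smooth_atlas unfolding smooth_atlas_def split_beta by blast

lemma smooth_transition: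
  assumes "c \<in> B" "c' \<in> B" "p \<in> fst c" "p \<in> fst c'"
  shows "smooth_near (\<lambda>x. snd c' (chart_inv c x)) (snd c p)"
proof -
  have "smooth_on (snd c ` (fst c \<inter> fst c')) (snd c' \<circ> chart_inv c)"
    using smooth_atlas assms unfolding smooth_atlas_def split_beta by blast
  from smooth_on_imp_near[OF this open_chart_Int] assms show ?thesis by (simp add: o_def)
qed

lemma eventually_chart:
  assumes "c \<in> B" "c' \<in> B" "p \<in> fst c" "p \<in> fst c'"
  shows "eventually (\<lambda>x. chart_inv c x \<in> fst c \<and> chart_inv c x \<in> fst c' \<and>
    snd c (chart_inv c x) = x) (nhds (snd c p))"
  unfolding eventually_nhds
  using assms open_chart_Int[OF assms(1,2)]
  by (intro exI[of _ "snd c ` (fst c \<inter> fst c')"]) (auto simp: chart_inv_chart)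

text \<open>Neighbourhoods are those of the atlas topology, so a function vanishing near a point in this
  sense is killed by all tangent vectors there. At points outside all charts the filter is junk.\<close>
definition nhds_pt :: "'p \<Rightarrow> 'p filter" where
  "nhds_pt p = (let c = (SOME c. c \<in> B \<and> p \<in> fst c) in filtermap (chart_inv c) (nhds (snd c p)))"

text \<open>The transition map is continuous at the point. One inequality is enough: exchanging the
  charts gives the other, so the chart chosen in \<open>nhds_pt\<close> does not matter.\<close>

lemma filtermap_chart_le:
  assumes "c \<in> B" "c' \<in> B" "p \<in> fst c" "p \<in> fst c'"
  shows "filtermap (chart_inv c) (nhds (snd c p)) \<le> filtermap (chart_inv c') (nhds (snd c' p))"
proof (rule filter_leI)
  fix P assume "eventually P (filtermap (chart_inv c') (nhds (snd c' p)))"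
  then have "eventually (\<lambda>y. P (chart_inv c' y)) (nhds (snd c' (chart_inv c (snd c p))))"
    using assms by (simp add: eventually_filtermap chart_inv_chart)
  then have "eventually (\<lambda>x. P (chart_inv c' (snd c' (chart_inv c x)))) (nhds (snd c p))"
    by (rule eventually_compose_filterlim[OF _ smooth_near_filterlim[OF smooth_transition[OF assms]]])
  then have "eventually (\<lambda>x. P (chart_inv c x)) (nhds (snd c p))"
    using eventually_chart[OF assms]
    by eventually_elim (use chart_inv_chart[OF assms(2)] in auto)
  then show "eventually P (filtermap (chart_inv c) (nhds (snd c p)))"
    by (simp add: eventually_filtermap)
qed

lemma nhds_pt_eq:
  assumes "c \<in> B" "p \<in> fst c"
  shows "nhds_pt p = filtermap (chart_inv c) (nhds (snd c p))"
proof -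
  have "(SOME c. c \<in> B \<and> p \<in> fst c) \<in> B \<and> p \<in> fst (SOME c. c \<in> B \<and> p \<in> fst c)"
    using assms by (intro someI[of "\<lambda>c. c \<in> B \<and> p \<in> fst c"]) auto
  then show ?thesis
    unfolding nhds_pt_def Let_def using assms by (intro antisym filtermap_chart_le) auto
qed

lemma eventually_nhds_pt:
  "c \<in> B \<Longrightarrow> p \<in> fst c \<Longrightarrow> eventually P (nhds_pt p) \<longleftrightarrow> eventually (\<lambda>x. P (chart_inv c x)) (nhds (snd c p))"
  by (simp add: nhds_pt_eq eventually_filtermap)

lemma pointsE:
  assumes "p \<in> points B" obtains c where "c \<in> B" "p \<in> fst c"
  using assms by (auto simp: points_def)

lemma pointsI: "c \<in> B \<Longrightarrow> p \<in> fst c \<Longrightarrow> p \<in> points B"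
  by (auto simp: points_def split_beta)

lemma eventually_in_chart: "c \<in> B \<Longrightarrow> p \<in> fst c \<Longrightarrow> eventually (\<lambda>q. q \<in> fst c) (nhds_pt p)"
  unfolding eventually_nhds_pt using eventually_chart[of c c p] by (auto elim: eventually_mono)

lemma eventually_points: "p \<in> points B \<Longrightarrow> eventually (\<lambda>q. q \<in> points B) (nhds_pt p)"
  by (erule pointsE) (auto intro: eventually_mono[OF eventually_in_chart] pointsI)

lemma smooth_at_in_points: "smooth_at B p f \<Longrightarrow> p \<in> points B"
  by (auto simp: smooth_at_def points_def)

text \<open>Passing from the one chart that \<open>smooth_at\<close> provides to an arbitrary chart
  is composition with a smooth transition map, followed by a comparison of germs.\<close>

lemma smooth_at_iff:
  assumes "c \<in> B" "p \<in> fst c"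
  shows "smooth_at B p f \<longleftrightarrow> smooth_near (\<lambda>x. f (chart_inv c x)) (snd c p)"
proof
  assume "smooth_at B p f"
  then obtain c' where c': "c' \<in> B" "p \<in> fst c'" "smooth_near (\<lambda>x. f (chart_inv c' x)) (snd c' p)"
    unfolding smooth_at_def smooth_near_def split_beta o_def by blast
  have "smooth_near (\<lambda>x. f (chart_inv c' (snd c' (chart_inv c x)))) (snd c p)"
    using smooth_near_compose[OF smooth_transition[OF assms(1) c'(1) assms(2) c'(2)],
        of "\<lambda>x. f (chart_inv c' x)"] c' assms by (simp add: chart_inv_chart)
  moreover have "eventually (\<lambda>x. f (chart_inv c' (snd c' (chart_inv c x))) = f (chart_inv c x)) (nhds (snd c p))"
    using eventually_chart[OF assms(1) c'(1) assms(2) c'(2)]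
    by eventually_elim (simp add: chart_inv_chart c')
  ultimately show "smooth_near (\<lambda>x. f (chart_inv c x)) (snd c p)" by (rule smooth_near_cong[rotated])
next
  assume "smooth_near (\<lambda>x. f (chart_inv c x)) (snd c p)"
  then obtain W where W: "open W" "snd c p \<in> W" "smooth_on W (\<lambda>x. f (chart_inv c x))"
    by (auto simp: smooth_near_def)
  \<comment> \<open>\<open>smooth_at\<close> wants a neighbourhood inside the image of the chart,
    and the one hidden in \<open>smooth_near\<close> may be larger.\<close>
  let ?V = "W \<inter> snd c ` fst c"
  have "open ?V" using W open_chart_Int[OF assms(1) assms(1)] by auto
  moreover have "snd c p \<in> ?V" using W assms by auto
  moreover have "smooth_on ?V (f \<circ> chart_inv c)"
    unfolding o_def by (rule smooth_on_subset[OF W(3)]) auto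
  ultimately show "smooth_at B p f" unfolding smooth_at_def split_beta using assms by blast
qed

lemma smooth_at_cong:
  assumes "eventually (\<lambda>q. f q = g q) (nhds_pt p)" "smooth_at B p f"
  shows "smooth_at B p g"
proof -
  obtain c where c: "c \<in> B" "p \<in> fst c" using smooth_at_in_points[OF assms(2)] by (rule pointsE)
  then show ?thesis
    using assms by (auto simp: smooth_at_iff eventually_nhds_pt intro: smooth_near_cong)
qed

lemma smooth_at_eventually:
  assumes "smooth_at B p f"
  shows "eventually (\<lambda>q. smooth_at B q f) (nhds_pt p)"
proof -
  obtain c where c: "c \<in> B" "p \<in> fst c" using smooth_at_in_points[OF assms] by (rule pointsE)
  have "eventually (smooth_near (\<lambda>x. f (chart_inv c x))) (nhds (snd c p))"
    using assms c by (intro smooth_near_eventually) (simp add: smooth_at_iff)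
  then have "eventually (\<lambda>x. smooth_at B (chart_inv c x) f) (nhds (snd c p))"
    using eventually_chart[OF c(1) c(1) c(2) c(2)]
    by eventually_elim (auto simp: smooth_at_iff[OF c(1)])
  then show ?thesis using c by (simp add: eventually_nhds_pt)
qed

lemma smooth_at_const [intro]: "p \<in> points B \<Longrightarrow> smooth_at B p (\<lambda>q. a)"
  by (erule pointsE) (simp add: smooth_at_iff)

lemma smooth_at_add: "smooth_at B p f \<Longrightarrow> smooth_at B p g \<Longrightarrow> smooth_at B p (\<lambda>q. f q + g q)"
  using smooth_at_in_points[of p f] by (auto elim!: pointsE simp: smooth_at_iff intro: smooth_near_add)

lemma smooth_at_mult: "smooth_at B p f \<Longrightarrow> smooth_at B p g \<Longrightarrow> smooth_at B p (\<lambda>q. f q * g q)"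
  using smooth_at_in_points[of p f] by (auto elim!: pointsE simp: smooth_at_iff intro: smooth_near_mult)

lemma smooth_at_diff:
  assumes "smooth_at B p f" "smooth_at B p g"
  shows "smooth_at B p (\<lambda>q. f q - g q)"
  using smooth_at_add[OF assms(1) smooth_at_mult[OF smooth_at_const[of p "-1"] assms(2)]]
    smooth_at_in_points[OF assms(1)] by simp

lemma smooth_at_sum:
  "p \<in> points B \<Longrightarrow> (\<And>i. i \<in> I \<Longrightarrow> smooth_at B p (f i)) \<Longrightarrow> smooth_at B p (\<lambda>q. \<Sum>i\<in>I. f i q)"
  by (induction I rule: infinite_finite_induct) (auto intro: smooth_at_add)

lemma smooth_at_chart:
  assumes "c \<in> B" "p \<in> fst c" "smooth_near g (snd c p)"
  shows "smooth_at B p (\<lambda>q. g (snd c q))"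
  unfolding smooth_at_iff[OF assms(1,2)]
  using eventually_chart[OF assms(1,1,2,2)]
  by (intro smooth_near_cong[OF _ assms(3)]) (auto elim: eventually_mono)

lemma smooth_at_coordinate:
  "c \<in> B \<Longrightarrow> p \<in> fst c \<Longrightarrow> smooth_at B p (\<lambda>q. snd c q \<bullet> b)"
  by (rule smooth_at_chart[where g = "\<lambda>x. x \<bullet> b"])
     (auto intro: smooth_near_linear bounded_linear_inner_left)

section \<open>Tangent vectors as directional derivatives in a chart\<close>

lemma dir_deriv_smooth:
  "smooth_at B p f \<Longrightarrow> dir_deriv B c p w f = Dd (\<lambda>x. f (chart_inv c x)) (snd c p) w"
  by (simp add: dir_deriv_def o_def)

lemma dir_deriv_not_smooth: "\<not> smooth_at B p f \<Longrightarrow> dir_deriv B c p w f = 0"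
  by (simp add: dir_deriv_def)

lemma dir_deriv_chart:
  assumes "c \<in> B" "p \<in> fst c" "smooth_near g (snd c p)"
  shows "dir_deriv B c p w (\<lambda>q. g (snd c q)) = Dd g (snd c p) w"
proof -
  have "Dd (\<lambda>x. g (snd c (chart_inv c x))) (snd c p) = Dd g (snd c p)"
    using eventually_chart[OF assms(1,1,2,2)] by (intro Dd_cong) (auto elim: eventually_mono)
  then show ?thesis by (simp add: dir_deriv_smooth smooth_at_chart[OF assms])
qed

lemma components_dir_deriv:
  assumes "c \<in> B" "p \<in> fst c"
  shows "components c (dir_deriv B c p w) = w"
proof -
  have "Dd (\<lambda>x. x \<bullet> b) (snd c p) w = w \<bullet> b" for b
    by (metis Dd_unique bounded_linear_imp_has_derivative bounded_linear_inner_left)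
  then show ?thesis
    by (simp add: components_def dir_deriv_chart[OF assms smooth_near_linear[OF bounded_linear_inner_left]]
        euclidean_representation)
qed

lemma dir_deriv_linear:
  assumes "c \<in> B" "p \<in> fst c"
  shows "linear (\<lambda>w. dir_deriv B c p w f)"
proof (cases "smooth_at B p f")
  case True
  then show ?thesis using Dd_linear assms by (simp add: dir_deriv_smooth smooth_at_iff)
qed (simp add: dir_deriv_not_smooth linear_zero)

text \<open>The chain rule on germs: near \<open>p\<close> the expression of \<open>f\<close> in
  \<open>c\<close> is its expression in \<open>c'\<close> after the transition map. On functions
  that are not smooth at \<open>p\<close> both sides have the default value 0.\<close>

lemma dir_deriv_transition:
  assumes "c \<in> B" "c' \<in> B" "p \<in> fst c" "p \<in> fst c'"
  shows "dir_deriv B c p w = dir_deriv B c' p (Dd (\<lambda>x. snd c' (chart_inv c x)) (snd c p) w)"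
proof
  fix f
  show "dir_deriv B c p w f = dir_deriv B c' p (Dd (\<lambda>x. snd c' (chart_inv c x)) (snd c p) w) f"
  proof (cases "smooth_at B p f")
    case True
    have "Dd (\<lambda>x. f (chart_inv c x)) (snd c p) =
      Dd (\<lambda>x. f (chart_inv c' (snd c' (chart_inv c x)))) (snd c p)"
      using eventually_chart[OF assms]
      by (intro Dd_cong, eventually_elim) (simp add: chart_inv_chart assms)
    moreover have "smooth_near (\<lambda>x. f (chart_inv c' x)) (snd c' (chart_inv c (snd c p)))"
      using True assms by (simp add: chart_inv_chart flip: smooth_at_iff)
    then have "Dd (\<lambda>x. f (chart_inv c' (snd c' (chart_inv c x)))) (snd c p) w =
       Dd (\<lambda>x. f (chart_inv c' x)) (snd c' p) (Dd (\<lambda>x. snd c' (chart_inv c x)) (snd c p) w)"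
      using Dd_compose[OF smooth_transition[OF assms], of "\<lambda>x. f (chart_inv c' x)" w] assms
      by (simp add: chart_inv_chart)
    ultimately show ?thesis using True by (simp add: dir_deriv_smooth)
  qed (simp add: dir_deriv_not_smooth)
qed

lemma tangent_space_eq:
  assumes "c \<in> B" "p \<in> fst c"
  shows "tangent_space B p = range (dir_deriv B c p)"
proof
  show "tangent_space B p \<subseteq> range (dir_deriv B c p)"
  proof
    fix v assume "v \<in> tangent_space B p"
    then obtain c' w where "v = dir_deriv B c' p w" "c' \<in> B" "p \<in> fst c'"
      unfolding tangent_space_def by blast
    then show "v \<in> range (dir_deriv B c p)" using dir_deriv_transition[of c' c p] assms by blast
  qed
  show "range (dir_deriv B c p) \<subseteq> tangent_space B p"
    using assms unfolding tangent_space_def by blast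
qed

lemma dir_deriv_components:
  assumes "v \<in> tangent_space B p" "c \<in> B" "p \<in> fst c"
  shows "dir_deriv B c p (components c v) = v"
  using assms tangent_space_eq[OF assms(2,3)] by (auto simp: components_dir_deriv)

lemma tangent_vector_in_points: "v \<in> tangent_space B p \<Longrightarrow> p \<in> points B"
  by (auto simp: tangent_space_def intro: pointsI)

lemma tangent_vector_smooth:
  assumes "v \<in> tangent_space B p" "c \<in> B" "p \<in> fst c" "smooth_at B p f"
  shows "v f = Dd (\<lambda>x. f (chart_inv c x)) (snd c p) (components c v)"
  using dir_deriv_components[OF assms(1-3)] dir_deriv_smooth[OF assms(4)] by metis

lemma tangent_vector_chart:
  assumes "v \<in> tangent_space B p" "c \<in> B" "p \<in> fst c" "smooth_near g (snd c p)"
  shows "v (\<lambda>q. g (snd c q)) = Dd g (snd c p) (components c v)"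
  using dir_deriv_components[OF assms(1-3)] dir_deriv_chart[OF assms(2-4)] by metis

lemma tangent_vector_expand:
  assumes "v \<in> tangent_space B p" "c \<in> B" "p \<in> fst c"
  shows "v f = (\<Sum>b\<in>Basis. v (\<lambda>q. snd c q \<bullet> b) * dir_deriv B c p b f)"
proof -
  have "v f = dir_deriv B c p (components c v) f" using dir_deriv_components[OF assms] by simp
  also have "\<dots> = (\<Sum>b\<in>Basis. (components c v \<bullet> b) * dir_deriv B c p b f)"
    by (subst linear_Basis_expand[OF dir_deriv_linear[OF assms(2,3)]]) simp
  finally show ?thesis by (simp add: components_inner)
qed

lemma tangent_vector_not_smooth: "v \<in> tangent_space B p \<Longrightarrow> \<not> smooth_at B p f \<Longrightarrow> v f = 0"
  by (auto simp: tangent_space_def dir_deriv_def)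

text \<open>No smoothness is assumed, because smoothness at \<open>p\<close> is itself a property of
  the germ and tangent vectors send all other functions to 0.\<close>

lemma tangent_vector_cong:
  assumes "v \<in> tangent_space B p" "eventually (\<lambda>q. f q = g q) (nhds_pt p)"
  shows "v f = v g"
proof -
  obtain c where c: "c \<in> B" "p \<in> fst c" using tangent_vector_in_points[OF assms(1)] by (rule pointsE)
  have e: "eventually (\<lambda>q. g q = f q) (nhds_pt p)" using assms(2) by (auto elim: eventually_mono)
  have "Dd (\<lambda>x. f (chart_inv c x)) (snd c p) = Dd (\<lambda>x. g (chart_inv c x)) (snd c p)"
    using assms(2) c by (intro Dd_cong) (simp add: eventually_nhds_pt)
  then show ?thesis
    using smooth_at_cong[OF assms(2)] smooth_at_cong[OF e] tangent_vector_smooth[OF assms(1) c]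
      tangent_vector_not_smooth[OF assms(1)] by metis
qed

lemma tangent_vector_add:
  assumes "v \<in> tangent_space B p" "smooth_at B p f" "smooth_at B p g"
  shows "v (\<lambda>q. f q + g q) = v f + v g"
proof -
  obtain c where c: "c \<in> B" "p \<in> fst c" using tangent_vector_in_points[OF assms(1)] by (rule pointsE)
  have "((\<lambda>x. f (chart_inv c x) + g (chart_inv c x)) has_derivative
    (\<lambda>w. Dd (\<lambda>x. f (chart_inv c x)) (snd c p) w + Dd (\<lambda>x. g (chart_inv c x)) (snd c p) w)) (at (snd c p))"
    using assms(2,3) c by (intro has_derivative_add smooth_near_has_derivative) (simp_all add: smooth_at_iff)
  from Dd_unique[OF this] show ?thesis
    using tangent_vector_smooth[OF assms(1) c] assms smooth_at_add by simp
qed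

lemma tangent_vector_mult:
  assumes "v \<in> tangent_space B p" "smooth_at B p f" "smooth_at B p g"
  shows "v (\<lambda>q. f q * g q) = f p * v g + v f * g p"
proof -
  obtain c where c: "c \<in> B" "p \<in> fst c" using tangent_vector_in_points[OF assms(1)] by (rule pointsE)
  have "((\<lambda>x. f (chart_inv c x) * g (chart_inv c x)) has_derivative
    (\<lambda>w. f (chart_inv c (snd c p)) * Dd (\<lambda>x. g (chart_inv c x)) (snd c p) w +
       Dd (\<lambda>x. f (chart_inv c x)) (snd c p) w * g (chart_inv c (snd c p)))) (at (snd c p))"
    using assms(2,3) c by (intro has_derivative_mult smooth_near_has_derivative) (simp_all add: smooth_at_iff)
  from Dd_unique[OF this] show ?thesis
    using tangent_vector_smooth[OF assms(1) c] assms smooth_at_mult c by (simp add: chart_inv_chart)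
qed

lemma tangent_vector_const: "v \<in> tangent_space B p \<Longrightarrow> v (\<lambda>q. a) = 0"
  by (auto simp: tangent_space_def dir_deriv_def o_def)

lemma tangent_vector_cmult:
  assumes "v \<in> tangent_space B p" "smooth_at B p f"
  shows "v (\<lambda>q. a * f q) = a * v f"
  using tangent_vector_mult[OF assms(1) smooth_at_const assms(2)] tangent_vector_const[OF assms(1)]
    tangent_vector_in_points[OF assms(1)] by simp

lemma tangent_vector_diff:
  assumes "v \<in> tangent_space B p" "smooth_at B p f" "smooth_at B p g"
  shows "v (\<lambda>q. f q - g q) = v f - v g"
  using tangent_vector_add[OF assms(1,2) smooth_at_mult[OF smooth_at_const assms(3)], of "-1"]
    tangent_vector_cmult[OF assms(1,3), of "-1"] tangent_vector_in_points[OF assms(1)] by simp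

lemma tangent_vector_sum:
  assumes "v \<in> tangent_space B p" "\<And>i. i \<in> I \<Longrightarrow> smooth_at B p (f i)"
  shows "v (\<lambda>q. \<Sum>i\<in>I. f i q) = (\<Sum>i\<in>I. v (f i))"
  using assms(2)
proof (induction I rule: infinite_finite_induct)
  case (insert i I)
  then have "v (\<lambda>q. f i q + (\<Sum>i\<in>I. f i q)) = v (f i) + v (\<lambda>q. \<Sum>i\<in>I. f i q)"
    using tangent_vector_in_points[OF assms(1)]
    by (intro tangent_vector_add[OF assms(1)] smooth_at_sum) auto
  with insert show ?case by simp
qed (simp_all add: tangent_vector_const[OF assms(1)])

lemma tangent_space_lincomb:
  assumes "u \<in> tangent_space B p" "v \<in> tangent_space B p"
  shows "(\<lambda>f. a * u f + b * v f) \<in> tangent_space B p"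
proof -
  obtain c where c: "c \<in> B" "p \<in> fst c" using tangent_vector_in_points[OF assms(1)] by (rule pointsE)
  obtain x y where "u = dir_deriv B c p x" "v = dir_deriv B c p y"
    using assms tangent_space_eq[OF c] by auto
  then have "(\<lambda>f. a * u f + b * v f) = dir_deriv B c p (a *\<^sub>R x + b *\<^sub>R y)"
    by (simp add: fun_eq_iff linear_add[OF dir_deriv_linear[OF c]] linear_scale[OF dir_deriv_linear[OF c]])
  then show ?thesis using tangent_space_eq[OF c] by simp
qed

end

section \<open>Vector fields\<close>

abbreviation vf_add :: "'p vfield \<Rightarrow> 'p vfield \<Rightarrow> 'p vfield" where
  "vf_add X Y \<equiv> (\<lambda>p f. X p f + Y p f)"

abbreviation vf_scale :: "('p \<Rightarrow> real) \<Rightarrow> 'p vfield \<Rightarrow> 'p vfield" where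
  "vf_scale g X \<equiv> (\<lambda>p f. g p * X p f)"

context atlas begin

abbreviation bracket :: "'p vfield \<Rightarrow> 'p vfield \<Rightarrow> 'p vfield" where
  "bracket \<equiv> lie_bracket B"

lemma vector_field_tangent: "X \<in> vector_fields B \<Longrightarrow> p \<in> points B \<Longrightarrow> X p \<in> tangent_space B p"
  by (simp add: vector_fields_def)

lemma vector_field_off: "X \<in> vector_fields B \<Longrightarrow> p \<notin> points B \<Longrightarrow> X p = (\<lambda>f. 0)"
  by (simp add: vector_fields_def)

lemma vector_field_smooth: "X \<in> vector_fields B \<Longrightarrow> smooth_at B p f \<Longrightarrow> smooth_at B p (\<lambda>q. X q f)"
  using smooth_at_in_points by (auto simp: vector_fields_def)

lemma vector_field_not_smooth: "X \<in> vector_fields B \<Longrightarrow> \<not> smooth_at B p f \<Longrightarrow> X p f = 0"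
  using vector_field_tangent vector_field_off tangent_vector_not_smooth by metis

lemma vector_field_eqI:
  assumes "X \<in> vector_fields B" "Y \<in> vector_fields B" "\<And>p f. smooth_at B p f \<Longrightarrow> X p f = Y p f"
  shows "X = Y"
  using vector_field_not_smooth[OF assms(1)] vector_field_not_smooth[OF assms(2)] assms(3)
  by (intro ext) metis

lemma vector_field_add:
  assumes "X \<in> vector_fields B" "Y \<in> vector_fields B"
  shows "vf_add X Y \<in> vector_fields B"
  unfolding vector_fields_def mem_Collect_eq
proof (intro conjI ballI allI impI)
  show "vf_add X Y p \<in> tangent_space B p" if "p \<in> points B" for p
    using tangent_space_lincomb[of "X p" p "Y p" 1 1] that assms vector_field_tangent by simp
  show "smooth_at B p (\<lambda>q. vf_add X Y q f)" if "smooth_at B p f" for p f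
    by (intro smooth_at_add vector_field_smooth[OF assms(1)] vector_field_smooth[OF assms(2)] that)
  show "vf_add X Y p = (\<lambda>f. 0)" if "p \<notin> points B" for p
    using that vector_field_off[OF assms(1)] vector_field_off[OF assms(2)] by simp
qed

lemma vector_field_scale:
  assumes "g \<in> smooth_functions B" "X \<in> vector_fields B"
  shows "vf_scale g X \<in> vector_fields B"
  unfolding vector_fields_def mem_Collect_eq
proof (intro conjI ballI allI impI)
  show "vf_scale g X p \<in> tangent_space B p" if "p \<in> points B" for p
    using tangent_space_lincomb[of "X p" p "X p" "g p" 0] that assms vector_field_tangent by simp
  show "smooth_at B p (\<lambda>q. vf_scale g X q f)" if "p \<in> points B" "smooth_at B p f" for p f
    using that assms(1)
    by (intro smooth_at_mult vector_field_smooth[OF assms(2)]) (auto simp: smooth_functions_def)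
  show "vf_scale g X p = (\<lambda>f. 0)" if "p \<notin> points B" for p
    using that vector_field_off[OF assms(2)] by simp
qed

lemma smooth_function_at: "g \<in> smooth_functions B \<Longrightarrow> p \<in> points B \<Longrightarrow> smooth_at B p g"
  by (simp add: smooth_functions_def)

lemma vector_field_cong:
  "X \<in> vector_fields B \<Longrightarrow> p \<in> points B \<Longrightarrow> eventually (\<lambda>q. f q = g q) (nhds_pt p) \<Longrightarrow> X p f = X p g"
  using tangent_vector_cong vector_field_tangent by metis

text \<open>A commutator is a priori a second-order operator, while tangent vectors are directional
  derivatives. Once the second-order terms have cancelled, what remains is the classical formula
  with components \<open>X (Y x) - Y (X x)\<close>.\<close>

lemma lie_bracket_tangent:
  assumes X: "X \<in> vector_fields B" and Y: "Y \<in> vector_fields B" and p: "p \<in> points B"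
  shows "bracket X Y p \<in> tangent_space B p"
proof -
  obtain c where c: "c \<in> B" "p \<in> fst c" using p by (rule pointsE)
  define x where "x b = (\<lambda>q. snd c q \<bullet> b)" for b
  have smx: "smooth_at B p (x b)" for b unfolding x_def by (rule smooth_at_coordinate[OF c])
  \<comment> \<open>The last sum is symmetric in X and Y because second derivatives commute.\<close>
  have nested: "X p (\<lambda>q. Y q f) = (\<Sum>b\<in>Basis. X p (\<lambda>q. Y q (x b)) * dir_deriv B c p b f) +
      (\<Sum>b\<in>Basis. \<Sum>a\<in>Basis. Y p (x b) * X p (x a) * Dd (\<lambda>y. Dd (\<lambda>x. f (chart_inv c x)) y b) (snd c p) a)"
    if f: "smooth_at B p f" and X: "X \<in> vector_fields B" and Y: "Y \<in> vector_fields B" for f X Y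
  proof -
    let ?F = "\<lambda>x. f (chart_inv c x)"
    let ?h = "\<lambda>b q. Dd ?F (snd c q) b"
    have smF: "smooth_near (\<lambda>y. Dd ?F y b) (snd c p)" for b
      using f smooth_at_iff[OF c] by (intro smooth_near_Dd) simp
    have smh: "smooth_at B p (?h b)" for b by (rule smooth_at_chart[OF c smF])
    have tX: "X p \<in> tangent_space B p" using X p by (rule vector_field_tangent)
    \<comment> \<open>The coordinate expression of \<open>Y q f\<close> is needed near
      \<open>p\<close> and not only at \<open>p\<close>, since \<open>X p\<close> differentiates
      it.\<close>
    have "eventually (\<lambda>q. Y q f = (\<Sum>b\<in>Basis. Y q (x b) * ?h b q)) (nhds_pt p)"
      using smooth_at_eventually[OF f] eventually_in_chart[OF c]
    proof eventually_elim
      case (elim q)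
      have "Y q f = (\<Sum>b\<in>Basis. Y q (x b) * dir_deriv B c q b f)"
        unfolding x_def using elim Y c vector_field_tangent smooth_at_in_points
        by (intro tangent_vector_expand) auto
      then show ?case using elim by (simp add: dir_deriv_smooth)
    qed
    then have "X p (\<lambda>q. Y q f) = X p (\<lambda>q. \<Sum>b\<in>Basis. Y q (x b) * ?h b q)"
      by (rule tangent_vector_cong[OF tX])
    also have "\<dots> = (\<Sum>b\<in>Basis. X p (\<lambda>q. Y q (x b) * ?h b q))"
      by (intro tangent_vector_sum[OF tX] smooth_at_mult vector_field_smooth[OF Y] smx smh)
    also have "\<dots> = (\<Sum>b\<in>Basis. Y p (x b) * X p (?h b) + X p (\<lambda>q. Y q (x b)) * ?h b p)"
      by (intro sum.cong refl tangent_vector_mult[OF tX] vector_field_smooth[OF Y] smx smh)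
    also have "\<dots> = (\<Sum>b\<in>Basis. X p (\<lambda>q. Y q (x b)) * dir_deriv B c p b f) +
        (\<Sum>b\<in>Basis. Y p (x b) * X p (?h b))"
      using f by (simp add: sum.distrib dir_deriv_smooth)
    also have "(\<lambda>b. X p (?h b)) = (\<lambda>b. \<Sum>a\<in>Basis. X p (x a) * Dd (\<lambda>y. Dd ?F y b) (snd c p) a)"
    proof
      show "X p (?h b) = (\<Sum>a\<in>Basis. X p (x a) * Dd (\<lambda>y. Dd ?F y b) (snd c p) a)" for b
        using tangent_vector_expand[OF tX c, of "?h b"] by (simp only: x_def dir_deriv_chart[OF c smF])
    qed
    finally show ?thesis by (simp add: sum_distrib_left mult.assoc)
  qed
  have "bracket X Y p f =
      dir_deriv B c p (\<Sum>b\<in>Basis. (X p (\<lambda>q. Y q (x b)) - Y p (\<lambda>q. X q (x b))) *\<^sub>R b) f" (is "_ = ?R") for f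
  proof (cases "smooth_at B p f")
    case True
    have "Dd (\<lambda>y. Dd (\<lambda>x. f (chart_inv c x)) y b) (snd c p) a =
        Dd (\<lambda>y. Dd (\<lambda>x. f (chart_inv c x)) y a) (snd c p) b" for a b
      using True smooth_at_iff[OF c] by (intro Dd_symmetric) simp
    then have "(\<Sum>b\<in>Basis. \<Sum>a\<in>Basis. Y p (x b) * X p (x a) *
          Dd (\<lambda>y. Dd (\<lambda>x. f (chart_inv c x)) y b) (snd c p) a) =
        (\<Sum>b\<in>Basis. \<Sum>a\<in>Basis. X p (x b) * Y p (x a) *
          Dd (\<lambda>y. Dd (\<lambda>x. f (chart_inv c x)) y b) (snd c p) a)"
      by (subst sum.swap) (simp add: mult.commute)
    then have "bracket X Y p f = (\<Sum>b\<in>Basis. X p (\<lambda>q. Y q (x b)) * dir_deriv B c p b f) -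
        (\<Sum>b\<in>Basis. Y p (\<lambda>q. X q (x b)) * dir_deriv B c p b f)"
      using True nested[OF True X Y] nested[OF True Y X] by (simp add: lie_bracket_def)
    also have "\<dots> = ?R"
      by (simp add: linear_sum[OF dir_deriv_linear[OF c]] linear_scale[OF dir_deriv_linear[OF c]]
          sum_subtractf left_diff_distrib)
    finally show ?thesis .
  qed (simp add: lie_bracket_def dir_deriv_not_smooth)
  then have "bracket X Y p = dir_deriv B c p (\<Sum>b\<in>Basis. (X p (\<lambda>q. Y q (x b)) - Y p (\<lambda>q. X q (x b))) *\<^sub>R b)"
    by (rule ext)
  then show ?thesis using tangent_space_eq[OF c] by simp
qed

lemma lie_bracket_smooth_eq: "smooth_at B p f \<Longrightarrow> bracket X Y p f = X p (\<lambda>q. Y q f) - Y p (\<lambda>q. X q f)"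
  by (simp add: lie_bracket_def)

lemma vector_field_lie_bracket:
  assumes X: "X \<in> vector_fields B" and Y: "Y \<in> vector_fields B"
  shows "bracket X Y \<in> vector_fields B"
  unfolding vector_fields_def mem_Collect_eq
proof (intro conjI ballI allI impI)
  show "bracket X Y p \<in> tangent_space B p" if "p \<in> points B" for p
    using lie_bracket_tangent[OF X Y that] .
  show "bracket X Y p = (\<lambda>f. 0)" if "p \<notin> points B" for p
    by (intro ext) (use that smooth_at_in_points in \<open>auto simp: lie_bracket_def\<close>)
  show "smooth_at B p (\<lambda>q. bracket X Y q f)" if f: "smooth_at B p f" for p f
  proof (rule smooth_at_cong)
    show "eventually (\<lambda>q. X q (\<lambda>q. Y q f) - Y q (\<lambda>q. X q f) = bracket X Y q f) (nhds_pt p)"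
      using smooth_at_eventually[OF f] by eventually_elim (simp add: lie_bracket_smooth_eq)
    show "smooth_at B p (\<lambda>q. X q (\<lambda>q. Y q f) - Y q (\<lambda>q. X q f))"
      by (intro smooth_at_diff vector_field_smooth[OF X] vector_field_smooth[OF Y] f)
  qed
qed

text \<open>Elements of \<^const>\<open>smooth_functions\<close> vanish off the manifold, so genuine constants are not among them.\<close>
definition const_fun :: "real \<Rightarrow> 'p \<Rightarrow> real" where
  "const_fun a p = (if p \<in> points B then a else 0)"

lemma const_fun_smooth: "const_fun a \<in> smooth_functions B"
proof -
  have "smooth_at B p (const_fun a)" if "p \<in> points B" for p
    by (rule smooth_at_cong[OF _ smooth_at_const[OF that, of a]])
       (use eventually_points[OF that] in eventually_elim, simp add: const_fun_def)
  then show ?thesis by (simp add: smooth_functions_def const_fun_def)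
qed

lemma vf_scale_const: "X \<in> vector_fields B \<Longrightarrow> vf_scale (const_fun a) X = (\<lambda>p f. a * X p f)"
  by (intro ext) (simp add: const_fun_def vector_field_off)

lemma vector_field_cmult: "X \<in> vector_fields B \<Longrightarrow> (\<lambda>p f. a * X p f) \<in> vector_fields B"
  using vector_field_scale[OF const_fun_smooth[of a], of X] by (simp add: vf_scale_const)

lemma vector_field_diff:
  "X \<in> vector_fields B \<Longrightarrow> Y \<in> vector_fields B \<Longrightarrow> (\<lambda>p f. X p f - Y p f) \<in> vector_fields B"
  using vector_field_add[OF _ vector_field_cmult, of X Y "-1"] by simp

lemma smooth_function_derivative:
  assumes "X \<in> vector_fields B" "g \<in> smooth_functions B"
  shows "(\<lambda>p. X p g) \<in> smooth_functions B"
  using vector_field_smooth[OF assms(1)] vector_field_off[OF assms(1)] assms(2)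
  by (auto simp: smooth_functions_def)

lemma lie_bracket_swap:
  "bracket Y X = (\<lambda>p f. - 1 * bracket X Y p f)"
  by (auto simp: lie_bracket_def fun_eq_iff)

lemma lie_bracket_self: "bracket X X = (\<lambda>p f. 0)"
  by (auto simp: lie_bracket_def fun_eq_iff)

lemma lie_bracket_add:
  assumes "X \<in> vector_fields B" "Y \<in> vector_fields B" "Z \<in> vector_fields B"
  shows "bracket (vf_add X Y) Z = vf_add (bracket X Z) (bracket Y Z)"
proof (rule vector_field_eqI)
  fix p f assume f: "smooth_at B p f"
  have "Z p (\<lambda>q. X q f + Y q f) = Z p (\<lambda>q. X q f) + Z p (\<lambda>q. Y q f)"
    using vector_field_tangent[OF assms(3) smooth_at_in_points[OF f]]
    by (rule tangent_vector_add) (rule vector_field_smooth[OF _ f], rule assms)+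
  then show "bracket (vf_add X Y) Z p f = vf_add (bracket X Z) (bracket Y Z) p f"
    using f by (simp add: lie_bracket_smooth_eq)
qed (intro vector_field_add vector_field_lie_bracket assms)+

text \<open>The product rule, applied where \<open>Y\<close> differentiates \<open>g\<close>. The
  correction term is written with the factor \<open>- 1\<close> so that \<open>form_cmult\<close>
  and \<open>vector_field_cmult\<close> apply to it.\<close>

lemma lie_bracket_scale:
  assumes "X \<in> vector_fields B" "Y \<in> vector_fields B" and g: "g \<in> smooth_functions B"
  shows "bracket (vf_scale g X) Y = vf_add (vf_scale g (bracket X Y)) (\<lambda>p f. - 1 * (Y p g * X p f))"
proof (rule vector_field_eqI)
  fix p f assume f: "smooth_at B p f"
  have "Y p (\<lambda>q. g q * X q f) = g p * Y p (\<lambda>q. X q f) + Y p g * X p f"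
    using vector_field_tangent[OF assms(2) smooth_at_in_points[OF f]]
    by (rule tangent_vector_mult)
       (intro vector_field_smooth[OF assms(1) f] smooth_function_at[OF g] smooth_at_in_points[OF f])+
  then show "bracket (vf_scale g X) Y p f = vf_add (vf_scale g (bracket X Y)) (\<lambda>p f. - 1 * (Y p g * X p f)) p f"
    using f by (simp add: lie_bracket_smooth_eq algebra_simps)
qed (intro vector_field_add vector_field_lie_bracket vector_field_cmult
      vector_field_scale[OF smooth_function_derivative] vector_field_scale assms)+

text \<open>Stated as the Leibniz rule for \<open>bracket Z\<close>, the shape in which it lets the
  Lie derivative commute with the exterior derivative.\<close>

lemma lie_bracket_jacobi:
  assumes "X \<in> vector_fields B" "Y \<in> vector_fields B" and Z: "Z \<in> vector_fields B"
  shows "bracket Z (bracket X Y) = vf_add (bracket (bracket Z X) Y) (bracket X (bracket Z Y))"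
proof (rule vector_field_eqI)
  fix p f assume f: "smooth_at B p f"
  note p = smooth_at_in_points[OF f]
  \<comment> \<open>A bracket unfolds to a commutator only where \<open>f\<close> is smooth, so its
    derivative is computed through equality of germs.\<close>
  have expand: "U p (\<lambda>q. bracket V W q f) = U p (\<lambda>q. V q (\<lambda>q. W q f)) - U p (\<lambda>q. W q (\<lambda>q. V q f))"
    if "U \<in> vector_fields B" "V \<in> vector_fields B" "W \<in> vector_fields B" for U V W
  proof -
    have "eventually (\<lambda>q. bracket V W q f = V q (\<lambda>q. W q f) - W q (\<lambda>q. V q f)) (nhds_pt p)"
      using smooth_at_eventually[OF f] by eventually_elim (simp add: lie_bracket_smooth_eq)
    then have "U p (\<lambda>q. bracket V W q f) = U p (\<lambda>q. V q (\<lambda>q. W q f) - W q (\<lambda>q. V q f))"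
      by (rule vector_field_cong[OF that(1) p])
    also have "\<dots> = U p (\<lambda>q. V q (\<lambda>q. W q f)) - U p (\<lambda>q. W q (\<lambda>q. V q f))"
      using vector_field_tangent[OF that(1) p]
      by (rule tangent_vector_diff)
         (intro vector_field_smooth[OF that(2) vector_field_smooth[OF that(3) f]]
           vector_field_smooth[OF that(3) vector_field_smooth[OF that(2) f]])+
    finally show ?thesis .
  qed
  show "bracket Z (bracket X Y) p f = vf_add (bracket (bracket Z X) Y) (bracket X (bracket Z Y)) p f"
    using f by (simp add: lie_bracket_smooth_eq expand assms vector_field_smooth)
qed (intro vector_field_add vector_field_lie_bracket assms)+

end

section \<open>Cartan calculus for one-forms\<close>

lemma length_2E:
  assumes "length Xs = 2" obtains X Y where "Xs = [X, Y]"
proof -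
  from assms obtain X Zs where "Xs = X # Zs" "length Zs = 1" by (cases Xs) auto
  moreover from this obtain Y where "Zs = [Y]" by (cases Zs) auto
  ultimately show ?thesis using that by simp
qed

text \<open>It serves to count degrees: terms of \<open>ext_d\<close> on lists of the wrong length
  vanish because the shortened lists have the wrong length too.\<close>

lemma length_nths_minus:
  assumes "I \<subseteq> {..<length xs}"
  shows "length (nths xs (- I)) = length xs - card I"
proof -
  have "length (nths xs (- I)) = card ({..<length xs} - I)"
    unfolding length_nths by (rule arg_cong[where f = card]) auto
  then show ?thesis using assms by (simp add: card_Diff_subset finite_subset)
qed

context atlas begin

lemma vector_field_zero_fun: "X \<in> vector_fields B \<Longrightarrow> X p (\<lambda>q. 0) = 0"
  using vector_field_tangent[of X p] tangent_vector_const[of "X p" p 0] vector_field_off[of X p]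
  by (cases "p \<in> points B") auto

text \<open>\<open>d1 \<omega> X Y\<close> is the value of the exterior derivative of a one-form on the pair \<open>X\<close>, \<open>Y\<close>.\<close>
definition d1 :: "'p form \<Rightarrow> 'p vfield \<Rightarrow> 'p vfield \<Rightarrow> 'p \<Rightarrow> real" where
  "d1 \<omega> X Y = (\<lambda>p. X p (\<omega> [Y]) - Y p (\<omega> [X]) - \<omega> [bracket X Y] p)"

lemma ext_d_degree0:
  assumes "\<And>Xs. length Xs \<noteq> 0 \<Longrightarrow> \<eta> Xs = (\<lambda>p. 0)"
  shows "ext_d B \<eta> Xs p =
    (if length Xs = 1 \<and> set Xs \<subseteq> vector_fields B then (Xs ! 0) p (\<eta> []) else 0)"
proof (cases "set Xs \<subseteq> vector_fields B")
  case True
  have 1: "(Xs ! i) p (\<eta> (nths Xs (- {i}))) = 0" if "i < length Xs" "length Xs \<noteq> 1" for i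
  proof -
    have "length (nths Xs (- {i})) \<noteq> 0" using that length_nths_minus[of "{i}" Xs] by simp
    then show ?thesis using assms[of "nths Xs (- {i})"] True that vector_field_zero_fun by (simp add: subset_iff)
  qed
  have "ext_d B \<eta> Xs p = (\<Sum>i<length Xs. (-1) ^ i * (Xs ! i) p (\<eta> (nths Xs (- {i}))))"
    using True assms by (simp add: ext_d_def on_fields_def)
  also have "\<dots> = (if length Xs = 1 then (Xs ! 0) p (\<eta> []) else 0)"
  proof (cases "length Xs = 1")
    case True
    then obtain X where "Xs = [X]" by (cases Xs) auto
    then show ?thesis by (simp add: nths_Cons)
  qed (auto intro!: sum.neutral simp: 1)
  finally show ?thesis using True by simp
qed (simp add: ext_d_def on_fields_def)

text \<open>Vanishing on lists of the wrong length is the sole assumption. The formula thus also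
  covers \<open>lie_form B S \<theta>\<close> and \<open>int_tensor B T \<theta>\<close> without a
  proof that these are forms.\<close>

lemma ext_d_degree1:
  assumes "\<And>Xs. length Xs \<noteq> 1 \<Longrightarrow> \<omega> Xs = (\<lambda>p. 0)"
  shows "ext_d B \<omega> Xs p =
    (if length Xs = 2 \<and> set Xs \<subseteq> vector_fields B then d1 \<omega> (Xs ! 0) (Xs ! 1) p else 0)"
proof (cases "set Xs \<subseteq> vector_fields B")
  case True
  show ?thesis
  proof (cases "length Xs = 2")
    case 2: True
    then obtain X Y where "Xs = [X, Y]" by (rule length_2E)
    then show ?thesis using True
      by (simp add: ext_d_def on_fields_def d1_def nths_Cons lessThan_Suc numeral_2_eq_2 lessThan_nat_numeral)
  next
    case False
    have "(Xs ! i) p (\<omega> (nths Xs (- {i}))) = 0" if "i < length Xs" for i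
    proof -
      have "length (nths Xs (- {i})) \<noteq> 1" using that False length_nths_minus[of "{i}" Xs] by simp
      then show ?thesis using assms[of "nths Xs (- {i})"] True that vector_field_zero_fun by (simp add: subset_iff)
    qed
    \<comment> \<open>The bracket together with a list that has lost two entries has length 1 only
      if there were exactly two entries.\<close>
    moreover have "\<omega> (bracket (Xs ! i) (Xs ! j) # nths Xs (- {i, j})) p = 0"
      if "j < length Xs" "i < j" for i j
    proof -
      have "length (nths Xs (- {i, j})) \<noteq> 0" using that False length_nths_minus[of "{i, j}" Xs] by simp
      then show ?thesis using assms[of "bracket (Xs ! i) (Xs ! j) # nths Xs (- {i, j})"] by simp
    qed
    ultimately show ?thesis using False by (simp add: ext_d_def on_fields_def)
  qed
qed (simp add: ext_d_def on_fields_def)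

lemma int_tensor_degree1:
  assumes "\<And>Xs. length Xs \<noteq> 1 \<Longrightarrow> \<omega> Xs = (\<lambda>p. 0)"
  shows "int_tensor B T \<omega> Xs = (\<lambda>p. if length Xs = 1 \<and> set Xs \<subseteq> vector_fields B then \<omega> [T (Xs ! 0)] p else 0)"
proof (cases "length Xs = 1")
  case True
  then obtain X where "Xs = [X]" by (cases Xs) auto
  then show ?thesis by (auto simp: int_tensor_def on_fields_def)
next
  case False
  have "\<omega> (Xs[j := Y]) = (\<lambda>p. 0)" for j Y using assms[of "Xs[j := Y]"] False by simp
  then show ?thesis using False by (intro ext) (simp add: int_tensor_def on_fields_def)
qed

lemma d_tensor_degree1:
  assumes \<omega>: "\<And>Xs. length Xs \<noteq> 1 \<Longrightarrow> \<omega> Xs = (\<lambda>p. 0)"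
    and T: "\<And>X. X \<in> vector_fields B \<Longrightarrow> T X \<in> vector_fields B"
  shows "d_tensor B T \<omega> Xs p = (if length Xs = 2 \<and> set Xs \<subseteq> vector_fields B
    then d1 \<omega> (T (Xs ! 0)) (Xs ! 1) p + d1 \<omega> (Xs ! 0) (T (Xs ! 1)) p - d1 (int_tensor B T \<omega>) (Xs ! 0) (Xs ! 1) p
    else 0)"
proof -
  have *: "ext_d B (int_tensor B T \<omega>) Xs p = (if length Xs = 2 \<and> set Xs \<subseteq> vector_fields B
      then d1 (int_tensor B T \<omega>) (Xs ! 0) (Xs ! 1) p else 0)"
    by (rule ext_d_degree1) (simp add: int_tensor_degree1[OF \<omega>])
  show ?thesis
  proof (cases "length Xs = 2 \<and> set Xs \<subseteq> vector_fields B")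
    case True
    then obtain X Y where "Xs = [X, Y]" using length_2E by metis
    have "int_tensor B T (ext_d B \<omega>) [X, Y] p = d1 \<omega> (T X) Y p + d1 \<omega> X (T Y) p"
      using True T \<open>Xs = [X, Y]\<close>
      by (simp add: int_tensor_def on_fields_def ext_d_degree1[OF \<omega>] lessThan_Suc)
    then show ?thesis using True * \<open>Xs = [X, Y]\<close> by (simp add: d_tensor_def)
  next
    case False
    then have "int_tensor B T (ext_d B \<omega>) Xs p = 0"
      by (auto simp: int_tensor_def on_fields_def ext_d_degree1[OF \<omega>])
    then show ?thesis using False * by (auto simp: d_tensor_def)
  qed
qed

end

section \<open>The exterior derivative of a one-form as an alternating tensor\<close>

locale one_form = atlas +
  fixes \<theta> :: "'a form"
  assumes form: "is_form B 1 \<theta>"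
begin

lemma form_degree: "length Xs \<noteq> 1 \<Longrightarrow> \<theta> Xs = (\<lambda>p. 0)"
  using form by (auto simp: is_form_def)

lemma form_smooth: "X \<in> vector_fields B \<Longrightarrow> \<theta> [X] \<in> smooth_functions B"
  using form by (auto simp: is_form_def)

lemma form_add:
  assumes "X \<in> vector_fields B" "Y \<in> vector_fields B"
  shows "\<theta> [vf_add X Y] = (\<lambda>p. \<theta> [X] p + \<theta> [Y] p)"
proof -
  have "\<forall>Xs i. length Xs = 1 \<and> set Xs \<subseteq> vector_fields B \<and> i < 1 \<longrightarrow>
        (\<forall>X\<in>vector_fields B. \<forall>Y\<in>vector_fields B.
           \<theta> (Xs[i := (\<lambda>p f. X p f + Y p f)]) = (\<lambda>p. \<theta> (Xs[i := X]) p + \<theta> (Xs[i := Y]) p))"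
    using form unfolding is_form_def by blast
  from this[rule_format, of "[X]" 0 X Y] assms show ?thesis by simp
qed

lemma form_scale:
  assumes "X \<in> vector_fields B" "g \<in> smooth_functions B"
  shows "\<theta> [vf_scale g X] = (\<lambda>p. g p * \<theta> [X] p)"
proof -
  have "\<forall>Xs i. length Xs = 1 \<and> set Xs \<subseteq> vector_fields B \<and> i < 1 \<longrightarrow>
        (\<forall>g\<in>smooth_functions B. \<forall>X\<in>vector_fields B.
           \<theta> (Xs[i := (\<lambda>p f. g p * X p f)]) = (\<lambda>p. g p * \<theta> (Xs[i := X]) p))"
    using form unfolding is_form_def by blast
  from this[rule_format, of "[X]" 0 g X] assms show ?thesis by simp
qed

lemma form_cmult:
  assumes "X \<in> vector_fields B"
  shows "\<theta> [(\<lambda>p f. a * X p f)] = (\<lambda>p. a * \<theta> [X] p)"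
proof -
  have "\<theta> [(\<lambda>p f. a * X p f)] = (\<lambda>p. const_fun a p * \<theta> [X] p)"
    using form_scale[OF assms const_fun_smooth[of a]] by (simp only: vf_scale_const[OF assms])
  then show ?thesis
    using form_smooth[OF assms] by (auto simp: fun_eq_iff const_fun_def smooth_functions_def)
qed

lemma form_smooth_at: "X \<in> vector_fields B \<Longrightarrow> p \<in> points B \<Longrightarrow> smooth_at B p (\<theta> [X])"
  by (intro smooth_function_at form_smooth)

lemma form_off: "X \<in> vector_fields B \<Longrightarrow> p \<notin> points B \<Longrightarrow> \<theta> [X] p = 0"
  using form_smooth by (auto simp: smooth_functions_def)

lemma d1_off:
  "X \<in> vector_fields B \<Longrightarrow> Y \<in> vector_fields B \<Longrightarrow> p \<notin> points B \<Longrightarrow> d1 \<theta> X Y p = 0"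
  by (simp add: d1_def vector_field_off form_off vector_field_lie_bracket)

lemma d1_smooth_at:
  assumes "X \<in> vector_fields B" "Y \<in> vector_fields B" "p \<in> points B"
  shows "smooth_at B p (d1 \<theta> X Y)"
  unfolding d1_def using assms
  by (intro smooth_at_diff vector_field_smooth[OF assms(1)] vector_field_smooth[OF assms(2)]
      form_smooth_at vector_field_lie_bracket)

lemma d1_swap:
  assumes "X \<in> vector_fields B" "Y \<in> vector_fields B"
  shows "d1 \<theta> Y X p = - d1 \<theta> X Y p"
proof -
  have "\<theta> [bracket Y X] = (\<lambda>p. - 1 * \<theta> [bracket X Y] p)"
    unfolding lie_bracket_swap[of Y X] by (intro form_cmult vector_field_lie_bracket assms)
  then show ?thesis by (simp add: d1_def)
qed

lemma d1_self: "X \<in> vector_fields B \<Longrightarrow> d1 \<theta> X X p = 0"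
  using d1_swap[of X X p] by simp

lemma d1_add_left:
  assumes X: "X \<in> vector_fields B" and Y: "Y \<in> vector_fields B" and Z: "Z \<in> vector_fields B"
  shows "d1 \<theta> (vf_add X Y) Z p = d1 \<theta> X Z p + d1 \<theta> Y Z p"
proof (cases "p \<in> points B")
  case True
  have "Z p (\<lambda>q. \<theta> [X] q + \<theta> [Y] q) = Z p (\<theta> [X]) + Z p (\<theta> [Y])"
    by (intro tangent_vector_add[OF vector_field_tangent[OF Z True]] form_smooth_at X Y True)
  then show ?thesis
    by (simp add: d1_def form_add lie_bracket_add vector_field_lie_bracket X Y Z)
qed (simp add: d1_off vector_field_add X Y Z)

text \<open>The term \<open>Y p g * \<theta> [X] p\<close> arises twice with opposite signs, from
  the product rule and from \<open>lie_bracket_scale\<close>, and cancels.\<close>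

lemma d1_scale_left:
  assumes X: "X \<in> vector_fields B" and Y: "Y \<in> vector_fields B" and g: "g \<in> smooth_functions B"
  shows "d1 \<theta> (vf_scale g X) Y p = g p * d1 \<theta> X Y p"
proof (cases "p \<in> points B")
  case True
  note Yg = smooth_function_derivative[OF Y g]
  have "Y p (\<lambda>q. g q * \<theta> [X] q) = g p * Y p (\<theta> [X]) + Y p g * \<theta> [X] p"
    by (intro tangent_vector_mult[OF vector_field_tangent[OF Y True]] form_smooth_at
        smooth_function_at[OF g] X True)
  moreover have "\<theta> [vf_add (vf_scale g (bracket X Y)) (\<lambda>p f. - 1 * (Y p g * X p f))] p =
      g p * \<theta> [bracket X Y] p - Y p g * \<theta> [X] p"
    by (subst form_add form_cmult form_scale
        | intro vector_field_scale[OF Yg] vector_field_scale[OF g] vector_field_cmult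
          vector_field_lie_bracket X Y g Yg | simp)+
  ultimately show ?thesis
    by (simp only: d1_def form_scale[OF X g] lie_bracket_scale[OF X Y g]) (simp add: algebra_simps)
qed (simp add: d1_off vector_field_scale g X Y)

lemma d1_cmult_left:
  assumes X: "X \<in> vector_fields B" and Y: "Y \<in> vector_fields B"
  shows "d1 \<theta> (\<lambda>p f. a * X p f) Y p = a * d1 \<theta> X Y p"
  using d1_scale_left[OF X Y const_fun_smooth, of a p] d1_off[OF X Y, of p] vf_scale_const[OF X, of a]
  by (auto simp: const_fun_def split: if_splits)

lemma d1_lincomb_left:
  assumes "X \<in> vector_fields B" "Y \<in> vector_fields B" "Z \<in> vector_fields B"
  shows "d1 \<theta> (\<lambda>p f. a * X p f + b * Y p f) Z p = a * d1 \<theta> X Z p + b * d1 \<theta> Y Z p"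
  using d1_add_left[OF vector_field_cmult vector_field_cmult, of X Y Z a b p] assms
  by (simp add: d1_cmult_left)

lemma d1_lincomb_right:
  assumes "X \<in> vector_fields B" "Y \<in> vector_fields B" "Z \<in> vector_fields B"
  shows "d1 \<theta> Z (\<lambda>p f. a * X p f + b * Y p f) p = a * d1 \<theta> Z X p + b * d1 \<theta> Z Y p"
proof -
  have V: "(\<lambda>p f. a * X p f + b * Y p f) \<in> vector_fields B"
    by (intro vector_field_add vector_field_cmult assms)
  show ?thesis
    using d1_lincomb_left[OF assms, of a b p] d1_swap[OF V assms(3), of p] d1_swap[OF assms(1,3), of p]
      d1_swap[OF assms(2,3), of p] by simp
qed

lemma d1_scale_right:
  assumes X: "X \<in> vector_fields B" and Y: "Y \<in> vector_fields B" and g: "g \<in> smooth_functions B"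
  shows "d1 \<theta> Y (vf_scale g X) p = g p * d1 \<theta> Y X p"
  using d1_scale_left[OF assms, of p] d1_swap[OF X Y, of p]
    d1_swap[OF vector_field_scale[OF g X] Y, of p] by simp

section \<open>Lie derivative and contraction of a one-form\<close>

lemma lie_form_single:
  "S \<in> vector_fields B \<Longrightarrow> X \<in> vector_fields B \<Longrightarrow>
    lie_form B S \<theta> [X] = (\<lambda>p. S p (\<theta> [X]) - \<theta> [bracket S X] p)"
  by (auto simp: lie_form_def on_fields_def)

lemma lie_form_degree: "S \<in> vector_fields B \<Longrightarrow> length Xs \<noteq> 1 \<Longrightarrow> lie_form B S \<theta> Xs = (\<lambda>p. 0)"
  by (auto simp: lie_form_def on_fields_def form_degree vector_field_zero_fun)

lemma lie_form_not_fields: "\<not> set Xs \<subseteq> vector_fields B \<Longrightarrow> lie_form B S \<theta> Xs = (\<lambda>p. 0)"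
  by (auto simp: lie_form_def on_fields_def)

text \<open>The Lie derivative commutes with the exterior derivative: the right-hand side is the Lie
  derivative of the two-form \<open>d1 \<theta>\<close>. Iterated derivatives match by the
  definition of the bracket, the bracket terms by the Jacobi identity.\<close>

lemma d1_lie_form:
  assumes S: "S \<in> vector_fields B" and X: "X \<in> vector_fields B" and Y: "Y \<in> vector_fields B"
  shows "d1 (lie_form B S \<theta>) X Y p =
    S p (d1 \<theta> X Y) - d1 \<theta> (bracket S X) Y p - d1 \<theta> X (bracket S Y) p"
proof (cases "p \<in> points B")
  case p: True
  note br = vector_field_lie_bracket
  have sm: "smooth_at B p (\<lambda>q. U q (\<theta> [V]))" if "U \<in> vector_fields B" "V \<in> vector_fields B" for U V
    using vector_field_smooth[OF that(1) form_smooth_at[OF that(2) p]] .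
  note tS = tangent_vector_diff[OF vector_field_tangent[OF S p]]
  have dL: "U p (lie_form B S \<theta> [V]) = U p (\<lambda>q. S q (\<theta> [V])) - U p (\<theta> [bracket S V])"
    if "U \<in> vector_fields B" "V \<in> vector_fields B" for U V
    unfolding lie_form_single[OF S that(2)]
    by (intro tangent_vector_diff[OF vector_field_tangent[OF that(1) p]] sm form_smooth_at br S that p)
  have Sd: "S p (d1 \<theta> X Y) = S p (\<lambda>q. X q (\<theta> [Y])) - S p (\<lambda>q. Y q (\<theta> [X])) - S p (\<theta> [bracket X Y])"
    unfolding d1_def
    by (simp add: tS smooth_at_diff sm form_smooth_at br X Y p)
  have jac: "\<theta> [bracket S (bracket X Y)] p = \<theta> [bracket (bracket S X) Y] p + \<theta> [bracket X (bracket S Y)] p"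
    by (simp add: lie_bracket_jacobi[OF X Y S] form_add br S X Y)
  have b: "bracket U V p (\<theta> [W]) = U p (\<lambda>q. V q (\<theta> [W])) - V p (\<lambda>q. U q (\<theta> [W]))"
    if "W \<in> vector_fields B" for U V W
    by (rule lie_bracket_smooth_eq[OF form_smooth_at[OF that p]])
  show ?thesis
    unfolding Sd
    by (simp only: d1_def dL X Y) (simp add: X Y b lie_form_single S br jac)
next
  case False
  then show ?thesis
    by (simp add: d1_off vector_field_lie_bracket S X Y)
       (simp add: d1_def vector_field_off form_off lie_form_single vector_field_lie_bracket S X Y)
qed

lemma int_prod_degree: "length Xs \<noteq> 0 \<Longrightarrow> int_prod B S \<theta> Xs = (\<lambda>p. 0)"
  by (auto simp: int_prod_def on_fields_def form_degree)

lemma int_prod_Nil: "int_prod B S \<theta> [] = \<theta> [S]"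
  by (auto simp: int_prod_def on_fields_def)

lemma int_prod_is_form: "S \<in> vector_fields B \<Longrightarrow> is_form B 0 (int_prod B S \<theta>)"
  by (auto simp: is_form_def int_prod_degree int_prod_Nil form_smooth)

lemma ext_d_int_prod:
  "ext_d B (int_prod B S \<theta>) Xs p =
    (if length Xs = 1 \<and> set Xs \<subseteq> vector_fields B then (Xs ! 0) p (\<theta> [S]) else 0)"
  unfolding int_prod_Nil[symmetric] by (rule ext_d_degree0) (rule int_prod_degree)

text \<open>Cartan's formula: the Lie derivative minus \<open>d\<close> of the contraction is the
  contraction of \<open>d1 \<theta>\<close> with \<open>S\<close>. On single fields it is a
  rearrangement of the definition of \<open>d1\<close>; on all other lists both forms have the
  default value 0.\<close>

lemma cartan_iff:
  assumes S: "S \<in> vector_fields B"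
  shows "lie_form B S \<theta> = ext_d B (int_prod B S \<theta>) \<longleftrightarrow> (\<forall>X\<in>vector_fields B. \<forall>p. d1 \<theta> S X p = 0)"
proof -
  have "lie_form B S \<theta> = ext_d B (int_prod B S \<theta>) \<longleftrightarrow>
      (\<forall>X\<in>vector_fields B. \<forall>p. lie_form B S \<theta> [X] p = X p (\<theta> [S]))"
  proof
    assume "lie_form B S \<theta> = ext_d B (int_prod B S \<theta>)"
    then show "\<forall>X\<in>vector_fields B. \<forall>p. lie_form B S \<theta> [X] p = X p (\<theta> [S])"
      by (simp add: ext_d_int_prod)
  next
    assume *: "\<forall>X\<in>vector_fields B. \<forall>p. lie_form B S \<theta> [X] p = X p (\<theta> [S])"
    have "lie_form B S \<theta> Xs p = ext_d B (int_prod B S \<theta>) Xs p" for Xs p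
    proof (cases "length Xs = 1 \<and> set Xs \<subseteq> vector_fields B")
      case True
      then obtain X where "Xs = [X]" by (cases Xs) auto
      then show ?thesis using True * by (simp add: ext_d_int_prod)
    next
      case False
      then have "lie_form B S \<theta> Xs = (\<lambda>p. 0)"
        using lie_form_degree[OF S, of Xs] lie_form_not_fields[of Xs S] by blast
      then show ?thesis using False by (auto simp: ext_d_int_prod)
    qed
    then show "lie_form B S \<theta> = ext_d B (int_prod B S \<theta>)" by (intro ext)
  qed
  then show ?thesis by (simp add: lie_form_single[OF S] d1_def algebra_simps)
qed

lemma closed_lie_form_iff:
  assumes S: "S \<in> vector_fields B"
  shows "closed_form B (lie_form B S \<theta>) \<longleftrightarrow>
    (\<forall>X\<in>vector_fields B. \<forall>Y\<in>vector_fields B. \<forall>p. d1 (lie_form B S \<theta>) X Y p = 0)"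
proof -
  have *: "ext_d B (lie_form B S \<theta>) Xs p = (if length Xs = 2 \<and> set Xs \<subseteq> vector_fields B
      then d1 (lie_form B S \<theta>) (Xs ! 0) (Xs ! 1) p else 0)" for Xs p
    by (rule ext_d_degree1) (rule lie_form_degree[OF S])
  show ?thesis
  proof
    assume "closed_form B (lie_form B S \<theta>)"
    then have "ext_d B (lie_form B S \<theta>) [X, Y] p = 0" for X Y p
      by (simp add: closed_form_def zero_form_def)
    moreover have "ext_d B (lie_form B S \<theta>) [X, Y] p = d1 (lie_form B S \<theta>) X Y p"
      if "X \<in> vector_fields B" "Y \<in> vector_fields B" for X Y p
      using that *[of "[X, Y]" p] by simp
    ultimately show "\<forall>X\<in>vector_fields B. \<forall>Y\<in>vector_fields B. \<forall>p. d1 (lie_form B S \<theta>) X Y p = 0"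
      by simp
  next
    assume "\<forall>X\<in>vector_fields B. \<forall>Y\<in>vector_fields B. \<forall>p. d1 (lie_form B S \<theta>) X Y p = 0"
    then show "closed_form B (lie_form B S \<theta>)"
      unfolding closed_form_def zero_form_def by (intro ext) (auto simp: * elim!: length_2E)
  qed
qed

end

text \<open>For the differential of a function, \<open>d1\<close> is the commutator of two
  derivatives minus the derivative along the bracket, which is 0 by the definition of the
  bracket.\<close>

lemma (in atlas) exact_imp_closed:
  assumes "exact_1form B \<omega>"
  shows "closed_form B \<omega>"
proof -
  obtain \<eta> where \<eta>: "is_form B 0 \<eta>" and \<omega>: "\<omega> = ext_d B \<eta>" using assms by (auto simp: exact_1form_def)
  have sm: "\<eta> [] \<in> smooth_functions B" and deg: "\<And>Xs. length Xs \<noteq> 0 \<Longrightarrow> \<eta> Xs = (\<lambda>p. 0)"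
    using \<eta> by (auto simp: is_form_def)
  have E: "\<omega> Xs p = (if length Xs = 1 \<and> set Xs \<subseteq> vector_fields B then (Xs ! 0) p (\<eta> []) else 0)" for Xs p
    unfolding \<omega> by (rule ext_d_degree0) (rule deg)
  have deg1: "\<And>Xs. length Xs \<noteq> 1 \<Longrightarrow> \<omega> Xs = (\<lambda>p. 0)" by (intro ext) (simp add: E)
  have single: "\<omega> [X] = (\<lambda>p. X p (\<eta> []))" if "X \<in> vector_fields B" for X
    using that by (intro ext) (simp add: E)
  have "d1 \<omega> X Y p = 0" if "X \<in> vector_fields B" "Y \<in> vector_fields B" for X Y p
  proof (cases "p \<in> points B")
    case True
    then show ?thesis using that
      by (simp add: d1_def single vector_field_lie_bracket lie_bracket_smooth_eq smooth_function_at[OF sm])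
  next
    case False
    then show ?thesis using that by (simp add: d1_def single vector_field_lie_bracket vector_field_off)
  qed
  then show ?thesis
    unfolding closed_form_def zero_form_def
    by (intro ext) (auto simp: ext_d_degree1[of \<omega>, OF deg1] elim!: length_2E)
qed

text \<open>The properties of the vertical endomorphism \<open>J\<close>, of \<open>\<tau> = dt\<close> and of the horizontal projector that
  the equivalences rest on; \<open>vert\<close> singles out the vertical vector fields.\<close>
locale semispray_setting = one_form +
  fixes S :: "'a vfield" and J h :: "'a vfield \<Rightarrow> 'a vfield" and \<tau> :: "'a vfield \<Rightarrow> 'a \<Rightarrow> real"
    and vert :: "'a vfield \<Rightarrow> bool"
  assumes S: "S \<in> vector_fields B"
    and J: "X \<in> vector_fields B \<Longrightarrow> J X \<in> vector_fields B"
    and J_vert: "X \<in> vector_fields B \<Longrightarrow> vert (J X)"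
    and J_S: "J S = (\<lambda>p f. 0)"
    and J_zero: "J (\<lambda>p f. 0) = (\<lambda>p f. 0)"
    and J_bracket: "V \<in> vector_fields B \<Longrightarrow> vert V \<Longrightarrow> J (bracket S V) = (\<lambda>p f. - V p f)"
    and \<tau>_smooth: "X \<in> vector_fields B \<Longrightarrow> \<tau> X \<in> smooth_functions B"
    and \<tau>_S: "p \<in> points B \<Longrightarrow> \<tau> S p = 1"
    and h_eq: "h X = (\<lambda>p f. (X p f - lie_tensor B S J X p f + \<tau> X p * S p f) / 2)"
    and h_vert: "X \<in> vector_fields B \<Longrightarrow> vert (\<lambda>p f. X p f - h X p f)"
    and semibasic: "V \<in> vector_fields B \<Longrightarrow> vert V \<Longrightarrow> \<theta> [V] = (\<lambda>p. 0)"
    and d_J_closed: "d_tensor B J \<theta> = zero_form"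
begin

abbreviation LJ :: "'a vfield \<Rightarrow> 'a vfield" where
  "LJ \<equiv> lie_tensor B S J"

lemma LJ_field: "X \<in> vector_fields B \<Longrightarrow> LJ X \<in> vector_fields B"
  unfolding lie_tensor_def by (intro vector_field_diff vector_field_lie_bracket S J)

text \<open>The coefficients, including the redundant 1, bring \<open>h X\<close> into nested
  instances of the pattern of \<open>d1_lincomb_left\<close> and
  \<open>d1_lincomb_right\<close>.\<close>

lemma h_lincomb: "h X = (\<lambda>p f. 1 / 2 * X p f + 1 * (- 1 / 2 * LJ X p f + 1 / 2 * (\<tau> X p * S p f)))"
  by (simp add: h_eq fun_eq_iff field_simps)

lemma h_field: "X \<in> vector_fields B \<Longrightarrow> h X \<in> vector_fields B"
  unfolding h_lincomb
  by (intro vector_field_add vector_field_cmult LJ_field vector_field_scale[OF \<tau>_smooth] S)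

lemma form_J: "X \<in> vector_fields B \<Longrightarrow> \<theta> [J X] = (\<lambda>p. 0)"
  by (intro semibasic J J_vert)

text \<open>A semi-basic form ignores the vertical part \<open>X - h X\<close>. Hence
  \<open>int_tensor B h \<theta>\<close> agrees with \<open>\<theta>\<close> on single
  fields.\<close>

lemma form_h:
  assumes X: "X \<in> vector_fields B"
  shows "\<theta> [h X] = \<theta> [X]"
proof -
  have V: "(\<lambda>p f. X p f - h X p f) \<in> vector_fields B" by (intro vector_field_diff h_field X)
  have "\<theta> [X] = \<theta> [vf_add (\<lambda>p f. X p f - h X p f) (h X)]" by simp
  also have "\<dots> = (\<lambda>p. \<theta> [\<lambda>p f. X p f - h X p f] p + \<theta> [h X] p)" by (intro form_add V h_field X)
  finally show ?thesis using semibasic[OF V h_vert[OF X]] by simp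
qed

text \<open>\<open>int_tensor B J \<theta>\<close> vanishes on single fields because
  \<open>J\<close> has vertical values, so only the term with the exterior derivative of
  \<open>\<theta>\<close> is left in \<open>d_tensor B J \<theta>\<close>.\<close>

lemma d1_J:
  assumes "X \<in> vector_fields B" "Y \<in> vector_fields B"
  shows "d1 \<theta> (J X) Y p + d1 \<theta> X (J Y) p = 0"
proof -
  have "int_tensor B J \<theta> [Z] = (\<lambda>p. 0)" if "Z \<in> vector_fields B" for Z
    using that by (simp add: int_tensor_degree1[of \<theta>, OF form_degree] form_J)
  then have "d1 (int_tensor B J \<theta>) X Y p = 0"
    using assms by (simp add: d1_def vector_field_zero_fun vector_field_lie_bracket)
  moreover have "d_tensor B J \<theta> [X, Y] p = 0" using d_J_closed by (simp add: zero_form_def)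
  ultimately show ?thesis
    using assms by (simp add: d_tensor_degree1[of \<theta>, OF form_degree J])
qed

lemma d1_zero_left: "Y \<in> vector_fields B \<Longrightarrow> d1 \<theta> (\<lambda>p f. 0) Y p = 0"
  using d1_cmult_left[OF S, of Y 0 p] by simp

lemma d1_S_vert:
  assumes V: "V \<in> vector_fields B" "vert V"
  shows "d1 \<theta> S V p = 0"
proof -
  have SV: "bracket S V \<in> vector_fields B" by (intro vector_field_lie_bracket S V)
  \<comment> \<open>The summand with coefficient 0 only produces the shape of
    \<open>d1_lincomb_right\<close>.\<close>
  have "d1 \<theta> S (\<lambda>p f. - 1 * V p f + 0 * V p f) p = - d1 \<theta> S V p"
    by (subst d1_lincomb_right) (simp_all add: V S)
  moreover have "d1 \<theta> S (\<lambda>p f. - V p f) p = 0"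
    using d1_J[OF S SV, of p] by (simp add: J_S J_bracket[OF V] d1_zero_left SV)
  ultimately show ?thesis by simp
qed

lemma d1_S_LJ:
  assumes X: "X \<in> vector_fields B"
  shows "d1 \<theta> S (LJ X) p = - d1 \<theta> S X p"
proof -
  let ?V = "\<lambda>p f. X p f - h X p f"
  have V: "?V \<in> vector_fields B" by (intro vector_field_diff h_field X)
  \<comment> \<open>This is \<open>h_eq\<close> solved for \<open>LJ X\<close>, with
    \<open>?V\<close> in place of \<open>X - h X\<close>. Of the three terms, the last two are
    killed by \<open>d1 \<theta> S\<close>.\<close>
  have "LJ X = (\<lambda>p f. - 1 * X p f + 1 * (2 * ?V p f + 1 * (\<tau> X p * S p f)))"
    by (simp add: h_eq fun_eq_iff field_simps)
  then have "d1 \<theta> S (LJ X) p =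
      d1 \<theta> S (\<lambda>p f. - 1 * X p f + 1 * (2 * ?V p f + 1 * (\<tau> X p * S p f))) p" by (simp only:)
  also have "\<dots> = - 1 * d1 \<theta> S X p + 1 * (2 * d1 \<theta> S ?V p + 1 * (\<tau> X p * d1 \<theta> S S p))"
    using vector_field_scale[OF \<tau>_smooth[OF X] S]
    by (simp only: d1_lincomb_right X V S vector_field_add vector_field_cmult d1_scale_right \<tau>_smooth)
  also have "\<dots> = - d1 \<theta> S X p" by (simp add: d1_S_vert[OF V h_vert[OF X]] d1_self[OF S])
  finally show ?thesis .
qed

lemma LJ_S: "LJ S = (\<lambda>p f. 0)"
proof -
  have "bracket S (\<lambda>p f. 0) = (\<lambda>p f. 0)"
    using vector_field_zero_fun[OF S] by (auto simp: lie_bracket_def fun_eq_iff)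
  then show ?thesis by (simp add: lie_tensor_def J_S J_zero lie_bracket_self)
qed

text \<open>Differentiating \<open>d1_J\<close> along \<open>S\<close> gives four terms with
  brackets. Replacing \<open>bracket S (J X)\<close> by \<open>LJ X\<close> plus
  \<open>J (bracket S X)\<close>, and likewise for \<open>Y\<close>, leaves the claim plus two
  instances of \<open>d1_J\<close>, at \<open>bracket S X\<close>, \<open>Y\<close> and at
  \<open>X\<close>, \<open>bracket S Y\<close>.\<close>

lemma closed_imp_LJ:
  assumes "closed_form B (lie_form B S \<theta>)" and X: "X \<in> vector_fields B" and Y: "Y \<in> vector_fields B"
  shows "d1 \<theta> (LJ X) Y p + d1 \<theta> X (LJ Y) p = 0"
proof -
  note br = vector_field_lie_bracket
  have Ld: "S p (d1 \<theta> U V) = d1 \<theta> (bracket S U) V p + d1 \<theta> U (bracket S V) p"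
    if "U \<in> vector_fields B" "V \<in> vector_fields B" for U V
    using assms(1) that d1_lie_form[OF S that, of p] by (simp add: closed_lie_form_iff[OF S])
  \<comment> \<open>An equality of functions is required, because \<open>S\<close> is going to
    differentiate it.\<close>
  have "(\<lambda>p. d1 \<theta> X (J Y) p) = (\<lambda>p. - 1 * d1 \<theta> (J X) Y p)"
    using d1_J[OF X Y] by (auto simp: fun_eq_iff add_eq_0_iff)
  then have e: "d1 \<theta> X (J Y) = (\<lambda>p. - 1 * d1 \<theta> (J X) Y p)" by simp
  have "S p (d1 \<theta> X (J Y)) = - 1 * S p (d1 \<theta> (J X) Y)"
  proof (cases "p \<in> points B")
    case True
    show ?thesis unfolding e
      by (intro tangent_vector_cmult[OF vector_field_tangent[OF S True]] d1_smooth_at J X Y True)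
  qed (simp add: vector_field_off[OF S])
  then have "d1 \<theta> (bracket S (J X)) Y p + d1 \<theta> (J X) (bracket S Y) p +
      (d1 \<theta> (bracket S X) (J Y) p + d1 \<theta> X (bracket S (J Y)) p) = 0"
    using Ld[OF J[OF X] Y] Ld[OF X J[OF Y]] by simp
  moreover have "d1 \<theta> (LJ X) Y p = d1 \<theta> (bracket S (J X)) Y p - d1 \<theta> (J (bracket S X)) Y p"
    using d1_lincomb_left[OF br[OF S J[OF X]] J[OF br[OF S X]] Y, of 1 "-1" p] by (simp add: lie_tensor_def)
  moreover have "d1 \<theta> X (LJ Y) p = d1 \<theta> X (bracket S (J Y)) p - d1 \<theta> X (J (bracket S Y)) p"
    using d1_lincomb_right[OF br[OF S J[OF Y]] J[OF br[OF S Y]] X, of 1 "-1" p] by (simp add: lie_tensor_def)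
  ultimately show ?thesis
    using d1_J[OF br[OF S X] Y, of p] d1_J[OF X br[OF S Y], of p] by simp
qed

lemma closed_imp_cartan:
  assumes "closed_form B (lie_form B S \<theta>)"
  shows "lie_form B S \<theta> = ext_d B (int_prod B S \<theta>)"
  unfolding cartan_iff[OF S]
proof (intro ballI allI)
  fix X p assume X: "X \<in> vector_fields B"
  show "d1 \<theta> S X p = 0"
    using closed_imp_LJ[OF assms S X, of p] d1_S_LJ[OF X, of p]
    by (simp add: LJ_S d1_zero_left X)
qed

lemma cartan_imp_exact:
  "lie_form B S \<theta> = ext_d B (int_prod B S \<theta>) \<Longrightarrow> exact_1form B (lie_form B S \<theta>)"
  using int_prod_is_form[OF S] by (auto simp: exact_1form_def)

text \<open>The two halves of \<open>d1 \<theta> X Y p\<close> coming from \<open>h X\<close> and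
  \<open>h Y\<close> add up to what is subtracted for \<open>int_tensor B h \<theta>\<close>, by
  \<open>form_h\<close>.\<close>

lemma d_h_eq:
  assumes X: "X \<in> vector_fields B" and Y: "Y \<in> vector_fields B"
  shows "2 * d_tensor B h \<theta> [X, Y] p =
    \<tau> X p * d1 \<theta> S Y p + \<tau> Y p * d1 \<theta> X S p - (d1 \<theta> (LJ X) Y p + d1 \<theta> X (LJ Y) p)"
proof -
  have "int_tensor B h \<theta> [Z] = \<theta> [Z]" if "Z \<in> vector_fields B" for Z
    using that by (simp add: int_tensor_degree1[of \<theta>, OF form_degree] form_h)
  then have "d1 (int_tensor B h \<theta>) X Y p = d1 \<theta> X Y p"
    using X Y by (simp add: d1_def vector_field_lie_bracket)
  then have "d_tensor B h \<theta> [X, Y] p = d1 \<theta> (h X) Y p + d1 \<theta> X (h Y) p - d1 \<theta> X Y p"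
    using X Y by (simp add: d_tensor_degree1[of \<theta>, OF form_degree h_field])
  moreover have "d1 \<theta> (h X) Y p = 1 / 2 * d1 \<theta> X Y p + 1 * (- 1 / 2 * d1 \<theta> (LJ X) Y p + 1 / 2 * (\<tau> X p * d1 \<theta> S Y p))"
    unfolding h_lincomb using vector_field_scale[OF \<tau>_smooth[OF X] S]
    by (simp only: d1_lincomb_left X Y S LJ_field vector_field_add vector_field_cmult d1_scale_left \<tau>_smooth)
  moreover have "d1 \<theta> X (h Y) p = 1 / 2 * d1 \<theta> X Y p + 1 * (- 1 / 2 * d1 \<theta> X (LJ Y) p + 1 / 2 * (\<tau> Y p * d1 \<theta> X S p))"
    unfolding h_lincomb using vector_field_scale[OF \<tau>_smooth[OF Y] S]
    by (simp only: d1_lincomb_right X Y S LJ_field vector_field_add vector_field_cmult d1_scale_right \<tau>_smooth)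
  ultimately show ?thesis by simp
qed

lemma d_h_closed_iff:
  "d_tensor B h \<theta> = zero_form \<longleftrightarrow>
    (\<forall>X\<in>vector_fields B. \<forall>Y\<in>vector_fields B. \<forall>p. d_tensor B h \<theta> [X, Y] p = 0)"
proof
  assume *: "\<forall>X\<in>vector_fields B. \<forall>Y\<in>vector_fields B. \<forall>p. d_tensor B h \<theta> [X, Y] p = 0"
  have "d_tensor B h \<theta> Xs p = 0" for Xs p
  proof (cases "length Xs = 2 \<and> set Xs \<subseteq> vector_fields B")
    case True
    then show ?thesis using * by (auto elim!: length_2E)
  next
    case False
    then show ?thesis by (auto simp: d_tensor_degree1[of \<theta>, OF form_degree h_field])
  qed
  then show "d_tensor B h \<theta> = zero_form" by (simp add: zero_form_def fun_eq_iff)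
qed (simp add: zero_form_def)

text \<open>From left to right both groups of terms in \<open>d_h_eq\<close> vanish: those with
  \<open>\<tau>\<close> by \<open>cartan_iff\<close>, the others by \<open>closed_imp_LJ\<close>,
  which applies because an exact form is closed.\<close>

lemma cartan_iff_d_h_closed:
  "lie_form B S \<theta> = ext_d B (int_prod B S \<theta>) \<longleftrightarrow> d_tensor B h \<theta> = zero_form"
proof
  assume *: "lie_form B S \<theta> = ext_d B (int_prod B S \<theta>)"
  then have d: "d1 \<theta> S X p = 0" if "X \<in> vector_fields B" for X p
    using that cartan_iff[OF S] by blast
  have cl: "closed_form B (lie_form B S \<theta>)" by (intro exact_imp_closed cartan_imp_exact *)
  have "d_tensor B h \<theta> [X, Y] p = 0" if X: "X \<in> vector_fields B" and Y: "Y \<in> vector_fields B" for X Y p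
    using d_h_eq[OF X Y, of p] closed_imp_LJ[OF cl X Y, of p] d[OF Y, of p] d[OF X, of p] d1_swap[OF S X, of p]
    by simp
  then show "d_tensor B h \<theta> = zero_form" by (simp add: d_h_closed_iff)
next
  assume *: "d_tensor B h \<theta> = zero_form"
  show "lie_form B S \<theta> = ext_d B (int_prod B S \<theta>)"
    unfolding cartan_iff[OF S]
  proof (intro ballI allI)
    fix X p assume X: "X \<in> vector_fields B"
    show "d1 \<theta> S X p = 0"
    proof (cases "p \<in> points B")
      case True
      \<comment> \<open>At the pair \<open>S\<close>, \<open>X\<close> the right-hand side of
        \<open>d_h_eq\<close> becomes \<open>d1 \<theta> S X p - d1 \<theta> S (LJ X) p\<close>,
        which by \<open>d1_S_LJ\<close> is twice \<open>d1 \<theta> S X p\<close>.\<close>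
      have "d_tensor B h \<theta> [S, X] p = 0" using * by (simp add: zero_form_def)
      then show ?thesis
        using d_h_eq[OF S X, of p] d1_S_LJ[OF X, of p]
        by (simp add: LJ_S d1_zero_left X \<tau>_S True d1_self[OF S])
    qed (simp add: d1_off S X)
  qed
qed

theorem equivalences:
  "(closed_form B (lie_form B S \<theta>) \<longleftrightarrow> exact_1form B (lie_form B S \<theta>)) \<and>
   (exact_1form B (lie_form B S \<theta>) \<longleftrightarrow> lie_form B S \<theta> = ext_d B (int_prod B S \<theta>)) \<and>
   (lie_form B S \<theta> = ext_d B (int_prod B S \<theta>) \<longleftrightarrow> d_tensor B h \<theta> = zero_form)"
  using closed_imp_cartan cartan_imp_exact exact_imp_closed cartan_iff_d_h_closed by blast

end

section \<open>Maximal atlases\<close>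

lemma coord_add: "coord i (x + y) = coord i x + coord i y"
  by (simp add: coord_def inner_add_left)

lemma coord_scaleR: "coord i (a *\<^sub>R x) = a * coord i x"
  by (simp add: coord_def)

lemma coord_sum: "coord i (\<Sum>k\<in>K. f k) = (\<Sum>k\<in>K. coord i (f k))"
  by (simp add: coord_def inner_sum_left)

lemma coord_minus: "coord i (- x) = - coord i x"
  by (simp add: coord_def)

lemma coord_diff: "coord i (x - y) = coord i x - coord i y"
  by (simp add: coord_def inner_diff_left)

lemma coord_zero: "coord i 0 = 0"
  by (simp add: coord_def)

lemmas coord_simps = coord_add coord_scaleR coord_sum coord_minus coord_diff coord_zero

lemma bij_basis_vec: "bij_betw (basis_vec :: nat \<Rightarrow> 'e::euclidean_space) {..<DIM('e)} Basis"
  unfolding basis_vec_def using bij_betw_from_nat_into_finite[OF finite_Basis] by simp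

lemma basis_vec_Basis: "i < DIM('e) \<Longrightarrow> (basis_vec i :: 'e::euclidean_space) \<in> Basis"
  using bij_betwE[OF bij_basis_vec] by auto

lemma coord_basis_vec:
  assumes "i < DIM('e)" "k < DIM('e)"
  shows "coord i (basis_vec k :: 'e::euclidean_space) = (if i = k then 1 else 0)"
proof -
  have "(basis_vec k :: 'e) = basis_vec i \<longleftrightarrow> k = i"
    using bij_basis_vec[where 'e = 'e] assms by (auto simp: bij_betw_def inj_on_eq_iff)
  then show ?thesis
    using assms basis_vec_Basis[where 'e = 'e] by (auto simp: coord_def inner_Basis)
qed

lemma coord_eqI:
  fixes x y :: "'e::euclidean_space"
  assumes "\<And>i. i < DIM('e) \<Longrightarrow> coord i x = coord i y"
  shows "x = y"
proof (rule euclidean_eqI)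
  fix b :: 'e assume "b \<in> Basis"
  then obtain i where "i < DIM('e)" "b = basis_vec i"
    using bij_basis_vec[where 'e = 'e] by (auto simp: bij_betw_def)
  then show "x \<bullet> b = y \<bullet> b" using assms by (simp add: coord_def)
qed

lemma bounded_linear_coord: "bounded_linear (coord i)"
  unfolding coord_def by (rule bounded_linear_inner_left)

lemma smooth_near_coord: "smooth_near f x \<Longrightarrow> smooth_near (\<lambda>x. coord i (f x)) x"
  unfolding coord_def by (intro smooth_near_inner smooth_near_const)

lemma open_if_eventually:
  assumes "\<And>x. x \<in> S \<Longrightarrow> eventually (\<lambda>y. y \<in> S) (nhds x)"
  shows "open S"
proof (subst open_subopen, intro ballI)
  fix x assume "x \<in> S"
  then show "\<exists>T. open T \<and> x \<in> T \<and> T \<subseteq> S"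
    using assms[of x] by (auto simp: eventually_nhds subset_iff)
qed

lemma Dd_coord: "smooth_near f x \<Longrightarrow> Dd (\<lambda>x. coord i (f x)) x v = coord i (Dd f x v)"
  by (rule fun_cong[OF Dd_unique])
     (rule bounded_linear.has_derivative[OF bounded_linear_coord smooth_near_has_derivative])

lemma Dd_bounded_linear: "bounded_linear f \<Longrightarrow> Dd f x = f"
  by (rule Dd_unique) (rule bounded_linear_imp_has_derivative)

context atlas begin

text \<open>Adding a single chart to \<open>B\<close> gives an atlas again, and the facts are those
  of that larger atlas. The two notions of \<open>nhds_pt\<close> agree because both can be computed
  in a chart of \<open>B\<close>.\<close>

lemma maximal_atlas_chart:
  assumes c: "c \<in> maximal_atlas B" and p: "p \<in> fst c"
  shows "inj_on (snd c) (fst c)" "p \<in> points B"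
    "nhds_pt p = filtermap (chart_inv c) (nhds (snd c p))"
    "eventually (\<lambda>q. q \<in> fst c) (nhds_pt p)"
    "eventually (\<lambda>x. snd c (chart_inv c x) = x) (nhds (snd c p))"
    "d \<in> B \<Longrightarrow> p \<in> fst d \<Longrightarrow> smooth_near (\<lambda>x. snd d (chart_inv c x)) (snd c p)"
    "d \<in> B \<Longrightarrow> p \<in> fst d \<Longrightarrow> smooth_near (\<lambda>x. snd c (chart_inv d x)) (snd d p)"
proof -
  have "smooth_atlas (insert c B)" and sub: "fst c \<subseteq> points B"
    using c by (auto simp: maximal_atlas_def split_beta)
  then interpret I: atlas "insert c B" by (simp add: atlas_def)
  show "inj_on (snd c) (fst c)" by (rule I.inj_on_chart) simp
  show pts: "p \<in> points B" using sub p by auto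
  then obtain d where d: "d \<in> B" "p \<in> fst d" by (rule pointsE)
  have eq: "I.nhds_pt p = nhds_pt p" using I.nhds_pt_eq[of d p] d by (simp add: nhds_pt_eq)
  show "nhds_pt p = filtermap (chart_inv c) (nhds (snd c p))"
    using I.nhds_pt_eq[of c p] p by (simp flip: eq)
  show "eventually (\<lambda>q. q \<in> fst c) (nhds_pt p)"
    using I.eventually_in_chart[of c p] p by (simp flip: eq)
  show "eventually (\<lambda>x. snd c (chart_inv c x) = x) (nhds (snd c p))"
    using I.eventually_chart[of c c p] p by (auto elim: eventually_mono)
  show "d \<in> B \<Longrightarrow> p \<in> fst d \<Longrightarrow> smooth_near (\<lambda>x. snd d (chart_inv c x)) (snd c p)" for d
    using I.smooth_transition[of c d p] p by simp
  show "d \<in> B \<Longrightarrow> p \<in> fst d \<Longrightarrow> smooth_near (\<lambda>x. snd c (chart_inv d x)) (snd d p)" for d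
    using I.smooth_transition[of d c p] p by simp
qed

text \<open>Membership in the maximal atlas says that each chart is compatible with
  \<open>B\<close>, not that two such charts are compatible with each other. Locally the transition
  map factors through a chart \<open>d\<close> of \<open>B\<close>.\<close>

lemma maximal_atlas_smooth: "smooth_atlas (maximal_atlas B)"
proof -
  have op: "open (snd c ` (fst c \<inter> fst c'))"
    if c: "c \<in> maximal_atlas B" and c': "c' \<in> maximal_atlas B" for c c'
  proof (rule open_if_eventually)
    fix x assume "x \<in> snd c ` (fst c \<inter> fst c')"
    then obtain p where p: "p \<in> fst c" "p \<in> fst c'" "x = snd c p" by auto
    have "eventually (\<lambda>x. chart_inv c x \<in> fst c \<and> chart_inv c x \<in> fst c') (nhds x)"
      using eventually_conj[OF maximal_atlas_chart(4)[OF c p(1)] maximal_atlas_chart(4)[OF c' p(2)]] p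
      by (simp add: maximal_atlas_chart(3)[OF c p(1)] eventually_filtermap)
    with maximal_atlas_chart(5)[OF c p(1)]
    show "eventually (\<lambda>y. y \<in> snd c ` (fst c \<inter> fst c')) (nhds x)"
      unfolding p(3) by eventually_elim (metis IntI imageI)
  qed
  have sm: "smooth_on (snd c ` (fst c \<inter> fst c')) (snd c' \<circ> chart_inv c)"
    if c: "c \<in> maximal_atlas B" and c': "c' \<in> maximal_atlas B" for c c'
  proof (rule smooth_on_local)
    fix x assume "x \<in> snd c ` (fst c \<inter> fst c')"
    then obtain p where p: "p \<in> fst c" "p \<in> fst c'" "x = snd c p" by auto
    obtain d where d: "d \<in> B" "p \<in> fst d" using maximal_atlas_chart(2)[OF c p(1)] by (rule pointsE)
    note inv = inv_into_f_f[OF maximal_atlas_chart(1)[OF c p(1)] p(1)]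
    have "smooth_near (\<lambda>x. snd c' (chart_inv d (snd d (chart_inv c x)))) (snd c p)"
      by (rule smooth_near_compose[where g = "\<lambda>x. snd c' (chart_inv d x)"])
         (use maximal_atlas_chart(6)[OF c p(1) d] maximal_atlas_chart(7)[OF c' p(2) d] in \<open>simp_all add: inv\<close>)
    moreover have "eventually (\<lambda>x. chart_inv c x \<in> fst d) (nhds (snd c p))"
      using eventually_in_chart[OF d]
      by (simp add: maximal_atlas_chart(3)[OF c p(1)] eventually_filtermap)
    then have "eventually (\<lambda>x. snd c' (chart_inv d (snd d (chart_inv c x))) = (snd c' \<circ> chart_inv c) x) (nhds (snd c p))"
      by eventually_elim (simp add: chart_inv_chart[OF d(1)])
    ultimately show "smooth_near (snd c' \<circ> chart_inv c) x"
      unfolding p(3) by (rule smooth_near_cong[rotated])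
  qed
  have inj: "inj_on (snd c) (fst c)" if c: "c \<in> maximal_atlas B" for c
    using maximal_atlas_chart(1)[OF c] by (cases "fst c = {}") auto
  show ?thesis
    unfolding smooth_atlas_def split_beta
    using op[of c c for c] op sm inj by auto
qed

lemma subset_maximal_atlas: "B \<subseteq> maximal_atlas B"
proof
  fix c assume "c \<in> B"
  then have "insert c B = B" by auto
  then show "c \<in> maximal_atlas B"
    using \<open>c \<in> B\<close> smooth_atlas by (auto simp: maximal_atlas_def points_def split_beta)
qed

text \<open>A fibred chart need only lie in the maximal atlas, whereas verticality is tested with
  functions smooth for the given one; this lets the two be combined.\<close>

lemma smooth_at_maximal_atlas: "smooth_at (maximal_atlas B) p f = smooth_at B p f"
proof -
  interpret M: atlas "maximal_atlas B" by (simp add: atlas_def maximal_atlas_smooth)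
  show ?thesis
  proof (cases "p \<in> points B")
    case True
    then obtain c where "c \<in> B" "p \<in> fst c" by (rule pointsE)
    then show ?thesis using M.smooth_at_iff[of c p f] smooth_at_iff[of c p f] subset_maximal_atlas by blast
  next
    case False
    then show ?thesis
      using smooth_at_in_points M.smooth_at_in_points[of p f] maximal_atlas_chart(2)
      by (metis M.pointsE)
  qed
qed

end

section \<open>The jet atlas\<close>

lemma vector_derivative_Dd: "f differentiable at t \<Longrightarrow> vector_derivative f (at t) = Dd f t 1"
  by (simp add: frechet_derivative_eq_vector_derivative)

definition base_part :: "nat \<Rightarrow> 'j::euclidean_space \<Rightarrow> 'e::euclidean_space" where
  "base_part n u = (\<Sum>i=0..n. coord i u *\<^sub>R basis_vec i)"

definition fibre_part :: "nat \<Rightarrow> 'j::euclidean_space \<Rightarrow> 'e::euclidean_space" where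
  "fibre_part n u = (\<Sum>i=1..n. coord (n + i) u *\<^sub>R basis_vec i)"

definition base_lift :: "nat \<Rightarrow> 'e::euclidean_space \<Rightarrow> 'j::euclidean_space" where
  "base_lift n x = (\<Sum>i=0..n. coord i x *\<^sub>R basis_vec i)"

definition vert_lift :: "nat \<Rightarrow> 'e::euclidean_space \<Rightarrow> 'j::euclidean_space" where
  "vert_lift n x = (\<Sum>i=1..n. coord i x *\<^sub>R basis_vec (n + i))"

lemma bounded_linear_parts:
  "bounded_linear (base_part n)" "bounded_linear (fibre_part n)"
  "bounded_linear (base_lift n)" "bounded_linear (vert_lift n)"
  unfolding base_part_def[abs_def] fibre_part_def[abs_def] base_lift_def[abs_def] vert_lift_def[abs_def]
  by (intro bounded_linear_sum bounded_linear_scaleR_const bounded_linear_coord)+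

lemmas linear_parts = bounded_linear_parts[THEN bounded_linear.linear]

lemma jet_coords_eq:
  "jet_coords n \<phi> z = base_lift n (\<phi> (pi10 z)) +
    vert_lift n (vector_derivative (\<phi> \<circ> jet_rep z) (at (fst z)))"
  by (simp add: jet_coords_def base_lift_def vert_lift_def)

locale jet_bundle = M: atlas A
  for A :: "('m, 'e::euclidean_space) atlas" +
  fixes \<pi> :: "'m \<Rightarrow> real" and n :: nat and N :: "('m jet, 'j::euclidean_space) atlas"
  assumes dim_e: "DIM('e) = n + 1" and dim_j: "DIM('j) = 2 * n + 1" and N_eq: "N = jet_atlas n A \<pi>"
begin

sublocale MM: atlas "maximal_atlas A"
  by (simp add: atlas_def M.maximal_atlas_smooth)

text \<open>In jet coordinates \<open>u = (t, x, y)\<close> we have \<open>P u = (t, x)\<close>, \<open>L u = (0, y)\<close> and \<open>Q u = (1, y)\<close>, the velocity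
  of the jet. In the other direction, \<open>BL (t, x) = (t, x, 0)\<close> and \<open>K (s, y) = (0, 0, y)\<close>.\<close>
abbreviation P :: "'j \<Rightarrow> 'e" where "P \<equiv> base_part n"
abbreviation L :: "'j \<Rightarrow> 'e" where "L \<equiv> fibre_part n"
abbreviation Q :: "'j \<Rightarrow> 'e" where "Q \<equiv> (\<lambda>u. basis_vec 0 + L u)"
abbreviation BL :: "'e \<Rightarrow> 'j" where "BL \<equiv> base_lift n"
abbreviation K :: "'e \<Rightarrow> 'j" where "K \<equiv> vert_lift n"

lemma coord_P: "i \<le> n \<Longrightarrow> coord i (P u) = coord i u"
  by (simp add: base_part_def coord_simps coord_basis_vec dim_e if_distrib[of "(*) _"] cong: if_cong)

lemma coord_L: "1 \<le> i \<Longrightarrow> i \<le> n \<Longrightarrow> coord i (L u) = coord (n + i) u"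
  by (simp add: fibre_part_def coord_simps coord_basis_vec dim_e if_distrib[of "(*) _"] cong: if_cong)

lemma coord_L0: "coord 0 (L u) = 0"
  by (simp add: fibre_part_def coord_simps coord_basis_vec dim_e)

lemma coord_e0: "i \<le> n \<Longrightarrow> coord i (basis_vec 0 :: 'e) = (if i = 0 then 1 else 0)"
  by (simp add: coord_basis_vec dim_e)

lemma coord_Q0: "coord 0 (Q u) = 1"
  by (simp add: coord_simps coord_L0 coord_e0)

lemma coord_BL: "i \<le> n \<Longrightarrow> coord i (BL x) = coord i x"
  by (simp add: base_lift_def coord_simps coord_basis_vec dim_j if_distrib[of "(*) _"] cong: if_cong)

lemma coord_BL': "1 \<le> i \<Longrightarrow> i \<le> n \<Longrightarrow> coord (n + i) (BL x) = 0"
  by (auto simp: base_lift_def coord_simps coord_basis_vec dim_j intro!: sum.neutral)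

lemma coord_K: "i \<le> n \<Longrightarrow> coord i (K x) = 0"
  by (auto simp: vert_lift_def coord_simps coord_basis_vec dim_j intro!: sum.neutral)

lemma coord_K': "1 \<le> i \<Longrightarrow> i \<le> n \<Longrightarrow> coord (n + i) (K x) = coord i x"
  by (simp add: vert_lift_def coord_simps coord_basis_vec dim_j if_distrib[of "(*) _"] cong: if_cong)

lemma eq_e_iff: "x = y \<longleftrightarrow> (\<forall>i\<le>n. coord i x = coord i y)" for x y :: 'e
  using coord_eqI[of x y] dim_e by auto

lemma eq_jI:
  fixes u v :: 'j
  assumes "\<And>i. i \<le> n \<Longrightarrow> coord i u = coord i v" "\<And>i. 1 \<le> i \<Longrightarrow> i \<le> n \<Longrightarrow> coord (n + i) u = coord (n + i) v"
  shows "u = v"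
proof (rule coord_eqI)
  fix i assume i: "i < DIM('j)"
  show "coord i u = coord i v"
  proof (cases "i \<le> n")
    case False
    then show ?thesis using assms(2)[of "i - n"] i dim_j by simp
  qed (rule assms(1))
qed

lemma P_BL: "P (BL x) = x"
  by (simp add: eq_e_iff coord_P coord_BL)

lemma P_K: "P (K x) = 0"
  by (simp add: eq_e_iff coord_P coord_K coord_zero)

lemma L_BL: "L (BL x) = 0"
proof -
  have "coord i (L (BL x)) = 0" if "i \<le> n" for i
    using that by (cases "i = 0") (simp_all add: coord_L coord_L0 coord_BL')
  then show ?thesis by (simp add: eq_e_iff coord_zero)
qed

lemma L_K:
  assumes "coord 0 x = 0"
  shows "L (K x) = x"
proof -
  have "coord i (L (K x)) = coord i x" if "i \<le> n" for i
    using that assms by (cases "i = 0") (simp_all add: coord_L coord_L0 coord_K')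
  then show ?thesis by (simp add: eq_e_iff)
qed

lemma K_e0: "K (basis_vec 0) = 0"
  by (rule eq_jI) (simp_all add: coord_K coord_K' coord_e0 coord_zero)

lemma BL_P_K_L: "BL (P u) + K (L u) = u"
  by (rule eq_jI) (simp_all add: coord_add coord_BL coord_K coord_P coord_BL' coord_K' coord_L)

lemma K_Q: "K (Q u) = K (L u)"
  by (simp add: linear_add[OF linear_parts(4)] K_e0)

lemma P_jet: "P (BL x + K w) = x"
  by (simp add: linear_add[OF linear_parts(1)] P_BL P_K)

text \<open>\<open>K\<close> forgets the t-component of a velocity, and \<open>Q\<close> restores it
  as 1, so nothing is lost for velocities of sections.\<close>

lemma Q_jet:
  assumes "coord 0 w = 1"
  shows "Q (BL x + K w) = w"
proof -
  have "K w = K (w - basis_vec 0)" by (simp add: linear_diff[OF linear_parts(4)] K_e0)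
  moreover have "coord 0 (w - basis_vec 0) = 0" using assms by (simp add: coord_diff coord_e0)
  ultimately show ?thesis by (simp add: linear_add[OF linear_parts(2)] L_BL L_K)
qed

section \<open>Local sections, their velocities, and jets\<close>

lemma fibred_chart_maximal: "c \<in> fibred_charts A \<pi> \<Longrightarrow> c \<in> maximal_atlas A"
  by (auto simp: fibred_charts_def)

lemma fibred_chart_coord0: "c \<in> fibred_charts A \<pi> \<Longrightarrow> p \<in> fst c \<Longrightarrow> coord 0 (snd c p) = \<pi> p"
  by (auto simp: fibred_charts_def)

lemma points_in_chart: "c \<in> maximal_atlas A \<Longrightarrow> p \<in> fst c \<Longrightarrow> p \<in> points A"
  by (rule M.maximal_atlas_chart(2))

text \<open>A local section comes with some chart of \<open>A\<close> that contains the curve near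
  \<open>t\<close>; the transition map carries smoothness over to any chart around
  \<open>\<sigma> t\<close>.\<close>

lemma local_section_chart:
  assumes \<sigma>: "local_section A \<pi> t \<sigma>" and c: "c \<in> maximal_atlas A" "\<sigma> t \<in> fst c"
  shows "smooth_near (\<lambda>s. snd c (\<sigma> s)) t"
    "eventually (\<lambda>s. \<sigma> s \<in> fst c \<and> \<pi> (\<sigma> s) = s) (nhds t)"
proof -
  obtain U \<phi> I where U: "(U, \<phi>) \<in> A" and I: "open I" "t \<in> I" "\<sigma> ` I \<subseteq> U" "smooth_on I (\<phi> \<circ> \<sigma>)" "\<forall>s\<in>I. \<pi> (\<sigma> s) = s"
    using \<sigma> unfolding local_section_def by auto
  define d where "d = (U, \<phi>)"
  have sub: "\<sigma> s \<in> fst d" if "s \<in> I" for s using I that by (auto simp: d_def)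
  have d: "d \<in> maximal_atlas A" using U M.subset_maximal_atlas by (auto simp: d_def)
  have sm: "smooth_near (\<lambda>s. snd d (\<sigma> s)) t"
    using smooth_on_imp_near[OF I(4,1,2)] by (simp add: d_def o_def)
  have inv: "chart_inv d (snd d (\<sigma> s)) = \<sigma> s" if "s \<in> I" for s
    using MM.chart_inv_chart[OF d] sub that by blast
  have ev: "eventually (\<lambda>s. s \<in> I) (nhds t)" using I by (simp add: eventually_nhds_in_open)
  have "smooth_near (\<lambda>s. snd c (chart_inv d (snd d (\<sigma> s)))) t"
    using smooth_near_compose[OF sm MM.smooth_transition[OF d c(1) sub[OF I(2)] c(2)]] .
  then show "smooth_near (\<lambda>s. snd c (\<sigma> s)) t"
    by (rule smooth_near_cong[rotated]) (use ev in eventually_elim, simp add: inv)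
  have "eventually (\<lambda>y. chart_inv d y \<in> fst c) (nhds (snd d (\<sigma> t)))"
    using MM.eventually_chart[OF d c(1) sub[OF I(2)] c(2)] by eventually_elim simp
  from eventually_compose_filterlim[OF this smooth_near_filterlim[OF sm]] ev
  show "eventually (\<lambda>s. \<sigma> s \<in> fst c \<and> \<pi> (\<sigma> s) = s) (nhds t)"
    by eventually_elim (use I(5) inv in auto)
qed

text \<open>Sections are built in fibred charts, which belong to the maximal atlas, but the
  definition asks for a chart of \<open>A\<close> itself.\<close>

lemma local_sectionI:
  assumes c: "c \<in> maximal_atlas A" "\<sigma> t \<in> fst c" and sm: "smooth_near (\<lambda>s. snd c (\<sigma> s)) t"
    and ev: "eventually (\<lambda>s. \<sigma> s \<in> fst c \<and> \<pi> (\<sigma> s) = s) (nhds t)"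
  shows "local_section A \<pi> t \<sigma>"
proof -
  obtain d where d: "d \<in> A" "\<sigma> t \<in> fst d" using points_in_chart[OF c] by (rule M.pointsE)
  then have d': "d \<in> maximal_atlas A" using M.subset_maximal_atlas by blast
  have "smooth_near (\<lambda>s. snd d (chart_inv c (snd c (\<sigma> s)))) t"
    using smooth_near_compose[OF sm MM.smooth_transition[OF c(1) d' c(2) d(2)]] .
  then have smd: "smooth_near (\<lambda>s. snd d (\<sigma> s)) t"
    by (rule smooth_near_cong[rotated]) (use ev in eventually_elim, simp add: MM.chart_inv_chart[OF c(1)])
  have "eventually (\<lambda>y. chart_inv c y \<in> fst d) (nhds (snd c (\<sigma> t)))"
    using MM.eventually_chart[OF c(1) d' c(2) d(2)] by eventually_elim simp
  from eventually_compose_filterlim[OF this smooth_near_filterlim[OF sm]] ev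
  have "eventually (\<lambda>s. \<sigma> s \<in> fst d \<and> \<pi> (\<sigma> s) = s) (nhds t)"
    by eventually_elim (auto simp: MM.chart_inv_chart[OF c(1)])
  then obtain I where I: "open I" "t \<in> I" "\<And>s. s \<in> I \<Longrightarrow> \<sigma> s \<in> fst d \<and> \<pi> (\<sigma> s) = s"
    by (auto simp: eventually_nhds)
  obtain W where W: "open W" "t \<in> W" "smooth_on W (\<lambda>s. snd d (\<sigma> s))"
    using smd by (auto simp: smooth_near_def)
  have "smooth_on (I \<inter> W) (snd d \<circ> \<sigma>)" unfolding o_def by (rule smooth_on_subset[OF W(3)]) auto
  then show ?thesis
    unfolding local_section_def using d I W
    by (intro bexI[OF _ d(1)]) (auto simp: split_beta intro!: exI[of _ "I \<inter> W"])
qed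

definition velocity :: "('m, 'e) chart \<Rightarrow> (real \<Rightarrow> 'm) \<Rightarrow> real \<Rightarrow> 'e" where
  "velocity c \<sigma> t = vector_derivative (snd c \<circ> \<sigma>) (at t)"

lemma velocity_eq:
  "local_section A \<pi> t \<sigma> \<Longrightarrow> c \<in> maximal_atlas A \<Longrightarrow> \<sigma> t \<in> fst c \<Longrightarrow>
    velocity c \<sigma> t = Dd (\<lambda>s. snd c (\<sigma> s)) t 1"
  using smooth_near_differentiable[OF local_section_chart(1)]
  by (simp add: velocity_def o_def vector_derivative_Dd)

lemma velocity_transition:
  assumes \<sigma>: "local_section A \<pi> t \<sigma>"
    and c: "c \<in> maximal_atlas A" "\<sigma> t \<in> fst c" and c': "c' \<in> maximal_atlas A" "\<sigma> t \<in> fst c'"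
  shows "velocity c' \<sigma> t = Dd (\<lambda>x. snd c' (chart_inv c x)) (snd c (\<sigma> t)) (velocity c \<sigma> t)"
proof -
  have "Dd (\<lambda>s. snd c' (\<sigma> s)) t = Dd (\<lambda>s. snd c' (chart_inv c (snd c (\<sigma> s)))) t"
    by (rule Dd_cong) (use local_section_chart(2)[OF \<sigma> c] in eventually_elim,
        simp add: MM.chart_inv_chart[OF c(1)])
  then show ?thesis
    using Dd_compose[OF local_section_chart(1)[OF \<sigma> c] MM.smooth_transition[OF c(1) c'(1) c(2) c'(2)]]
    by (simp add: velocity_eq[OF \<sigma> c] velocity_eq[OF \<sigma> c'])
qed

text \<open>In a fibred chart coordinate 0 is \<open>\<pi>\<close>, so along a section it is the
  identity near \<open>t\<close>.\<close>

lemma velocity_coord0: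
  assumes \<sigma>: "local_section A \<pi> t \<sigma>" and c: "c \<in> fibred_charts A \<pi>" "\<sigma> t \<in> fst c"
  shows "coord 0 (velocity c \<sigma> t) = 1"
proof -
  note cm = fibred_chart_maximal[OF c(1)]
  have "coord 0 (velocity c \<sigma> t) = Dd (\<lambda>s. coord 0 (snd c (\<sigma> s))) t 1"
    by (simp add: velocity_eq[OF \<sigma> cm c(2)] Dd_coord[OF local_section_chart(1)[OF \<sigma> cm c(2)]])
  also have "Dd (\<lambda>s. coord 0 (snd c (\<sigma> s))) t = Dd (\<lambda>s. s) t"
    by (rule Dd_cong) (use local_section_chart(2)[OF \<sigma> cm c(2)] in eventually_elim,
        simp add: fibred_chart_coord0[OF c(1)])
  finally show ?thesis by simp
qed

text \<open>Velocities in two charts are related by the derivative of the transition map, which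
  depends only on the common base point. Equality therefore passes between charts, and one chart
  decides.\<close>

lemma same_jet_iff:
  assumes \<sigma>: "local_section A \<pi> t \<sigma>" and \<tau>: "local_section A \<pi> t \<tau>"
    and c: "c \<in> maximal_atlas A" "\<sigma> t \<in> fst c"
  shows "same_jet A t \<sigma> \<tau> \<longleftrightarrow> \<sigma> t = \<tau> t \<and> velocity c \<sigma> t = velocity c \<tau> t"
proof (cases "\<sigma> t = \<tau> t")
  case eq: True
  then have c\<tau>: "\<tau> t \<in> fst c" using c by simp
  have same: "same_jet A t \<sigma> \<tau> \<longleftrightarrow> (\<forall>d\<in>A. \<sigma> t \<in> fst d \<longrightarrow> velocity d \<sigma> t = velocity d \<tau> t)"
    using eq by (auto simp: same_jet_def velocity_def split_beta)
  have tr: "velocity d' \<sigma> t = velocity d' \<tau> t"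
    if "velocity d \<sigma> t = velocity d \<tau> t" "d \<in> maximal_atlas A" "\<sigma> t \<in> fst d" "d' \<in> maximal_atlas A" "\<sigma> t \<in> fst d'" for d d'
    using velocity_transition[OF \<sigma> that(2-5)] velocity_transition[OF \<tau> that(2) _ that(4)] that eq by simp
  obtain d where d: "d \<in> A" "\<sigma> t \<in> fst d" using points_in_chart[OF c] by (rule M.pointsE)
  show ?thesis
    unfolding same using tr[OF _ c] tr[of d c] d c eq M.subset_maximal_atlas by (metis subsetD)
qed (simp add: same_jet_def)

lemma same_jet_refl: "same_jet A t \<sigma> \<sigma>"
  by (simp add: same_jet_def)

lemma same_jet_eq: "same_jet A t \<sigma> \<tau> \<Longrightarrow> same_jet A t \<sigma> = same_jet A t \<tau>"
  unfolding same_jet_def fun_eq_iff split_beta by metis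

lemma jet_rep_jet1:
  assumes "local_section A \<pi> t \<sigma>"
  shows "local_section A \<pi> t (jet_rep (jet1 A \<pi> t \<sigma>))" "same_jet A t \<sigma> (jet_rep (jet1 A \<pi> t \<sigma>))"
proof -
  have "jet_rep (jet1 A \<pi> t \<sigma>) \<in> snd (jet1 A \<pi> t \<sigma>)"
    unfolding jet_rep_def by (rule someI[of _ \<sigma>]) (simp add: jet1_def assms same_jet_refl)
  then show "local_section A \<pi> t (jet_rep (jet1 A \<pi> t \<sigma>))" "same_jet A t \<sigma> (jet_rep (jet1 A \<pi> t \<sigma>))"
    by (auto simp: jet1_def)
qed

lemma jet_rep:
  assumes "z \<in> jets A \<pi>"
  shows "local_section A \<pi> (fst z) (jet_rep z)" "z = jet1 A \<pi> (fst z) (jet_rep z)"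
proof -
  obtain t \<sigma> where z: "z = jet1 A \<pi> t \<sigma>" and \<sigma>: "local_section A \<pi> t \<sigma>"
    using assms by (auto simp: jets_def)
  show "local_section A \<pi> (fst z) (jet_rep z)" using jet_rep_jet1(1)[OF \<sigma>] by (simp add: z jet1_def)
  have "jet1 A \<pi> t \<sigma> = jet1 A \<pi> t (jet_rep z)"
    using same_jet_eq[OF jet_rep_jet1(2)[OF \<sigma>]] by (simp add: jet1_def z)
  then show "z = jet1 A \<pi> (fst z) (jet_rep z)" by (simp add: z jet1_def)
qed

lemma jet1_in_jets: "local_section A \<pi> t \<sigma> \<Longrightarrow> jet1 A \<pi> t \<sigma> \<in> jets A \<pi>"
  by (auto simp: jets_def)

lemma fst_jet1: "fst (jet1 A \<pi> t \<sigma>) = t"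
  by (simp add: jet1_def)

lemma pi10_jet1: "local_section A \<pi> t \<sigma> \<Longrightarrow> pi10 (jet1 A \<pi> t \<sigma>) = \<sigma> t"
  using jet_rep_jet1(2)[of t \<sigma>] by (simp add: pi10_def fst_jet1 same_jet_def)

lemma jet_eqI:
  assumes z: "z \<in> jets A \<pi>" and z': "z' \<in> jets A \<pi>" and c: "c \<in> maximal_atlas A" "pi10 z \<in> fst c"
    and eq: "fst z = fst z'" "pi10 z = pi10 z'" "velocity c (jet_rep z) (fst z) = velocity c (jet_rep z') (fst z)"
  shows "z = z'"
proof -
  have "same_jet A (fst z) (jet_rep z) (jet_rep z')"
    using same_jet_iff[OF jet_rep(1)[OF z] _ c(1), of "jet_rep z'"] jet_rep(1)[OF z'] c(2) eq
    by (simp add: pi10_def)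
  then have "jet1 A \<pi> (fst z) (jet_rep z) = jet1 A \<pi> (fst z') (jet_rep z')"
    using same_jet_eq eq by (simp add: jet1_def)
  then show ?thesis using jet_rep(2)[OF z] jet_rep(2)[OF z'] by simp
qed

section \<open>Induced charts on the set of jets\<close>

definition jet_chart :: "('m, 'e) chart \<Rightarrow> ('m jet, 'j) chart" where
  "jet_chart c = ({z \<in> jets A \<pi>. pi10 z \<in> fst c}, jet_coords n (snd c))"

lemma fst_jet_chart: "fst (jet_chart c) = {z \<in> jets A \<pi>. pi10 z \<in> fst c}"
  by (simp add: jet_chart_def)

lemma N_charts: "N = jet_chart ` fibred_charts A \<pi>"
  unfolding N_eq jet_atlas_def jet_chart_def by force

lemma jet_chart_coords:
  "snd (jet_chart c) z = BL (snd c (pi10 z)) + K (velocity c (jet_rep z) (fst z))"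
  by (simp add: jet_chart_def jet_coords_eq velocity_def)

lemma jet_chart_parts:
  assumes c: "c \<in> fibred_charts A \<pi>" and z: "z \<in> fst (jet_chart c)"
  shows "P (snd (jet_chart c) z) = snd c (pi10 z)"
    "Q (snd (jet_chart c) z) = velocity c (jet_rep z) (fst z)"
    "coord 0 (snd (jet_chart c) z) = fst z"
proof -
  have z: "z \<in> jets A \<pi>" "pi10 z \<in> fst c" using z by (auto simp: fst_jet_chart)
  show P: "P (snd (jet_chart c) z) = snd c (pi10 z)" by (simp add: jet_chart_coords P_jet)
  show "Q (snd (jet_chart c) z) = velocity c (jet_rep z) (fst z)"
    unfolding jet_chart_coords
    by (rule Q_jet) (use velocity_coord0[OF jet_rep(1)[OF z(1)] c] z in \<open>simp add: pi10_def\<close>)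
  have "\<pi> (pi10 z) = fst z"
    using eventually_nhds_x_imp_x[OF local_section_chart(2)[OF jet_rep(1)[OF z(1)] fibred_chart_maximal[OF c]]] z(2)
    by (simp add: pi10_def)
  then show "coord 0 (snd (jet_chart c) z) = fst z"
    using coord_P[of 0 "snd (jet_chart c) z"] fibred_chart_coord0[OF c z(2)] by (simp add: P)
qed

lemma jet_chart_surj:
  assumes c: "c \<in> fibred_charts A \<pi>" and u: "P u \<in> snd c ` fst c"
  obtains z where "z \<in> fst (jet_chart c)" "snd (jet_chart c) z = u" "pi10 z = chart_inv c (P u)"
proof -
  note cm = fibred_chart_maximal[OF c]
  define t where "t = coord 0 u"
  \<comment> \<open>The straight line through \<open>P u\<close> at time \<open>t\<close> with
    velocity \<open>Q u\<close>. As \<open>Q u\<close> has t-component 1, coordinate 0 of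
    \<open>l s\<close> is \<open>s\<close>, so the line gives a section.\<close>
  define l where "l s = P u + (s - t) *\<^sub>R Q u" for s
  define \<sigma> where "\<sigma> s = chart_inv c (l s)" for s
  obtain p where p: "p \<in> fst c" "P u = snd c p" using u by auto
  have lt: "l t = P u" by (simp add: l_def)
  have \<sigma>t: "\<sigma> t = p" by (simp add: \<sigma>_def lt p MM.chart_inv_chart[OF cm])
  have hd: "(l has_derivative (\<lambda>s. s *\<^sub>R Q u)) (at s)" for s
    unfolding l_def[abs_def] by (auto intro!: derivative_eq_intros)
  have sml: "smooth_near l t"
    unfolding l_def[abs_def]
    by (intro smooth_near_add smooth_near_scaleR smooth_near_const smooth_near_add[where f = "\<lambda>s. s" and g = "\<lambda>s. - t", simplified]
        smooth_near_linear bounded_linear_ident)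
  have ev: "eventually (\<lambda>s. chart_inv c (l s) \<in> fst c \<and> snd c (chart_inv c (l s)) = l s) (nhds t)"
    by (rule eventually_compose_filterlim[OF _ smooth_near_filterlim[OF sml]])
       (use MM.eventually_chart[OF cm cm p(1) p(1)] in \<open>auto simp: lt p(2) elim: eventually_mono\<close>)
  have sm: "smooth_near (\<lambda>s. snd c (\<sigma> s)) t"
    by (rule smooth_near_cong[OF _ sml]) (use ev in eventually_elim, simp add: \<sigma>_def)
  have \<sigma>: "local_section A \<pi> t \<sigma>"
  proof (rule local_sectionI[OF cm _ sm])
    show "\<sigma> t \<in> fst c" by (simp add: \<sigma>t p)
    show "eventually (\<lambda>s. \<sigma> s \<in> fst c \<and> \<pi> (\<sigma> s) = s) (nhds t)"
      using ev
    proof eventually_elim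
      case (elim s)
      have "\<pi> (\<sigma> s) = coord 0 (l s)"
        using fibred_chart_coord0[OF c, of "\<sigma> s"] elim by (simp add: \<sigma>_def)
      also have "\<dots> = s" by (simp add: l_def coord_add[of _ "P u"] coord_scaleR coord_Q0 coord_P t_def del: scaleR_add_right)
      finally show ?case using elim by (simp add: \<sigma>_def)
    qed
  qed
  define z where "z = jet1 A \<pi> t \<sigma>"
  have z: "z \<in> jets A \<pi>" "pi10 z = p" "fst z = t"
    using \<sigma> by (simp_all add: z_def jet1_in_jets pi10_jet1 fst_jet1 \<sigma>t)
  \<comment> \<open>The representative \<open>jet_rep z\<close> is some section in the class of
    \<open>\<sigma>\<close>, not \<open>\<sigma>\<close> itself; only value and velocity at
    \<open>t\<close> agree.\<close>
  have "velocity c (jet_rep z) t = velocity c \<sigma> t"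
    using same_jet_iff[OF \<sigma> jet_rep_jet1(1)[OF \<sigma>] cm] jet_rep_jet1(2)[OF \<sigma>] by (simp add: \<sigma>t p z_def)
  also have "\<dots> = Dd (\<lambda>s. snd c (\<sigma> s)) t 1" by (rule velocity_eq[OF \<sigma> cm]) (simp add: \<sigma>t p)
  also have "Dd (\<lambda>s. snd c (\<sigma> s)) t = Dd l t"
    by (rule Dd_cong) (use ev in eventually_elim, simp add: \<sigma>_def)
  also have "Dd l t 1 = Q u" by (simp add: Dd_unique[OF hd])
  finally have "snd (jet_chart c) z = BL (P u) + K (Q u)"
    by (simp add: jet_chart_coords z p)
  also have "\<dots> = u" by (simp add: K_Q BL_P_K_L)
  finally have "snd (jet_chart c) z = u" .
  moreover have "z \<in> fst (jet_chart c)" using z p by (simp add: fst_jet_chart)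
  moreover have "pi10 z = chart_inv c (P u)" by (simp add: z p MM.chart_inv_chart[OF cm])
  ultimately show ?thesis using that by blast
qed

lemma inj_on_jet_chart:
  assumes c: "c \<in> fibred_charts A \<pi>"
  shows "inj_on (snd (jet_chart c)) (fst (jet_chart c))"
proof (rule inj_onI)
  fix z z' assume z: "z \<in> fst (jet_chart c)" "z' \<in> fst (jet_chart c)"
    and eq: "snd (jet_chart c) z = snd (jet_chart c) z'"
  note cm = fibred_chart_maximal[OF c]
  have "snd c (pi10 z) = snd c (pi10 z')"
    using jet_chart_parts(1)[OF c z(1)] jet_chart_parts(1)[OF c z(2)] eq by simp
  then have p: "pi10 z = pi10 z'"
    using MM.inj_on_chart[OF cm] z by (auto simp: fst_jet_chart inj_on_def)
  have t: "fst z = fst z'" using jet_chart_parts(3)[OF c z(1)] jet_chart_parts(3)[OF c z(2)] eq by simp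
  show "z = z'"
    using z jet_chart_parts(2)[OF c z(1)] jet_chart_parts(2)[OF c z(2)] eq t p
    by (intro jet_eqI[OF _ _ cm]) (auto simp: fst_jet_chart)
qed

text \<open>Every velocity with t-component 1 occurs, so the image contains whole fibres of
  \<open>P\<close> and is a preimage from the base. Openness is thus inherited from
  \<open>M\<close>, and \<open>c' = c\<close> gives the full chart image.\<close>

lemma jet_chart_image:
  assumes c: "c \<in> fibred_charts A \<pi>"
  shows "snd (jet_chart c) ` (fst (jet_chart c) \<inter> fst (jet_chart c')) = P -` (snd c ` (fst c \<inter> fst c'))"
proof (intro equalityI subsetI)
  fix u assume "u \<in> snd (jet_chart c) ` (fst (jet_chart c) \<inter> fst (jet_chart c'))"
  then show "u \<in> P -` (snd c ` (fst c \<inter> fst c'))"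
    using jet_chart_parts(1)[OF c] by (auto simp: fst_jet_chart)
next
  fix u assume u: "u \<in> P -` (snd c ` (fst c \<inter> fst c'))"
  then obtain z where z: "z \<in> fst (jet_chart c)" "snd (jet_chart c) z = u" "pi10 z = chart_inv c (P u)"
    using jet_chart_surj[OF c, of u] by blast
  have "pi10 z \<in> fst c'"
    using u MM.chart_inv_chart[OF fibred_chart_maximal[OF c]] by (auto simp: z(3))
  then show "u \<in> snd (jet_chart c) ` (fst (jet_chart c) \<inter> fst (jet_chart c'))"
    using z by (force simp: fst_jet_chart)
qed

text \<open>The change of jet coordinates \<open>(x, v) \<mapsto> (F x, F' x v)\<close> induced by a change \<open>F\<close> of fibred coordinates,
  with a velocity \<open>v\<close> whose \<open>t\<close>-component is 1.\<close>
definition jet_transition :: "('m, 'e) chart \<Rightarrow> ('m, 'e) chart \<Rightarrow> 'j \<Rightarrow> 'j" where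
  "jet_transition c c' u = (let F = (\<lambda>x. snd c' (chart_inv c x)) in BL (F (P u)) + K (Dd F (P u) (Q u)))"

lemma jet_transition:
  assumes c: "c \<in> fibred_charts A \<pi>" and c': "c' \<in> fibred_charts A \<pi>"
    and z: "z \<in> fst (jet_chart c)" "z \<in> fst (jet_chart c')"
  shows "snd (jet_chart c') z = jet_transition c c' (snd (jet_chart c) z)"
proof -
  note cm = fibred_chart_maximal[OF c] note cm' = fibred_chart_maximal[OF c']
  have z': "z \<in> jets A \<pi>" "pi10 z \<in> fst c" "pi10 z \<in> fst c'" using z by (auto simp: fst_jet_chart)
  have "velocity c' (jet_rep z) (fst z) =
      Dd (\<lambda>x. snd c' (chart_inv c x)) (snd c (pi10 z)) (velocity c (jet_rep z) (fst z))"
    using velocity_transition[OF jet_rep(1)[OF z'(1)] cm _ cm'] z'(2,3) by (simp add: pi10_def)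
  then show ?thesis
    by (simp add: jet_transition_def Let_def jet_chart_parts(1,2)[OF c z(1)] jet_chart_coords[of c']
        MM.chart_inv_chart[OF cm z'(2)])
qed

lemma jet_transition_smooth:
  assumes c: "c \<in> fibred_charts A \<pi>" and c': "c' \<in> fibred_charts A \<pi>"
    and u: "P u \<in> snd c ` (fst c \<inter> fst c')"
  shows "smooth_near (jet_transition c c') u"
proof -
  let ?F = "\<lambda>x. snd c' (chart_inv c x)"
  have F: "smooth_near ?F (P u)"
    using u MM.smooth_transition[OF fibred_chart_maximal[OF c] fibred_chart_maximal[OF c']] by auto
  note lin = bounded_linear_parts[THEN smooth_near_linear]
  have "smooth_near (\<lambda>u. ?F (P u)) u" by (rule smooth_near_compose[OF lin(1) F])
  moreover have "smooth_near (\<lambda>u. Dd ?F (P u) (Q u)) u"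
    by (rule smooth_near_Dd_compose[OF lin(1) F smooth_near_add[OF smooth_near_const lin(2)]])
  ultimately show ?thesis
    unfolding jet_transition_def[abs_def] Let_def
    by (intro smooth_near_add) (auto intro: smooth_near_compose lin)
qed

lemma smooth_atlas_N: "smooth_atlas N"
proof -
  have op: "open (P -` (snd c ` (fst c \<inter> fst c')))"
    if "c \<in> fibred_charts A \<pi>" "c' \<in> fibred_charts A \<pi>" for c c'
    using MM.open_chart_Int[of c c'] that fibred_chart_maximal bounded_linear_parts(1)
    by (intro continuous_open_vimage) (auto intro: linear_continuous_at)
  have sm: "smooth_on (P -` (snd c ` (fst c \<inter> fst c'))) (snd (jet_chart c') \<circ> chart_inv (jet_chart c))"
    if c: "c \<in> fibred_charts A \<pi>" and c': "c' \<in> fibred_charts A \<pi>" for c c'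
  proof (rule smooth_on_local)
    fix u assume u: "u \<in> P -` (snd c ` (fst c \<inter> fst c'))"
    have "eventually (\<lambda>u. u \<in> P -` (snd c ` (fst c \<inter> fst c'))) (nhds u)"
      using op[OF c c'] u by (rule eventually_nhds_in_open)
    then have "eventually (\<lambda>u. jet_transition c c' u = (snd (jet_chart c') \<circ> chart_inv (jet_chart c)) u) (nhds u)"
    proof eventually_elim
      case (elim u)
      then obtain z where z: "z \<in> fst (jet_chart c)" "z \<in> fst (jet_chart c')" "u = snd (jet_chart c) z"
        unfolding jet_chart_image[OF c, symmetric] by auto
      then show ?case using jet_transition[OF c c' z(1,2)] inv_into_f_f[OF inj_on_jet_chart[OF c] z(1)] by simp
    qed
    then show "smooth_near (snd (jet_chart c') \<circ> chart_inv (jet_chart c)) u"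
      by (rule smooth_near_cong) (rule jet_transition_smooth[OF c c'], use u in simp)
  qed
  have 1: "inj_on (snd d) (fst d) \<and> open (snd d ` fst d)" if dN: "d \<in> N" for d
  proof -
    obtain c where c: "c \<in> fibred_charts A \<pi>" "d = jet_chart c" using dN unfolding N_charts by blast
    then show ?thesis using inj_on_jet_chart[OF c(1)] op[OF c(1) c(1)] jet_chart_image[OF c(1), of c] by simp
  qed
  have 2: "open (snd d ` (fst d \<inter> fst d')) \<and> smooth_on (snd d ` (fst d \<inter> fst d')) (snd d' \<circ> chart_inv d)"
    if dN: "d \<in> N" "d' \<in> N" for d d'
  proof -
    obtain c c' where c: "c \<in> fibred_charts A \<pi>" "d = jet_chart c" "c' \<in> fibred_charts A \<pi>" "d' = jet_chart c'"
      using dN unfolding N_charts by blast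
    then show ?thesis using op[OF c(1,3)] sm[OF c(1,3)] jet_chart_image[OF c(1), of c'] by simp
  qed
  show ?thesis unfolding smooth_atlas_def split_beta using 1 2 by blast
qed

end

section \<open>The vertical endomorphism and the semispray\<close>

context jet_bundle begin

sublocale JN: atlas N
  by (simp add: atlas_def smooth_atlas_N)

lemma jet_chart_N: "c \<in> fibred_charts A \<pi> \<Longrightarrow> jet_chart c \<in> N"
  by (simp add: N_charts)

lemma N_pointE:
  assumes "z \<in> points N"
  obtains c where "c \<in> fibred_charts A \<pi>" "z \<in> fst (jet_chart c)"
proof -
  obtain d where d: "d \<in> N" "z \<in> fst d" using assms by (rule JN.pointsE)
  from d(1) obtain c where "c \<in> fibred_charts A \<pi>" "d = jet_chart c" unfolding N_charts by blast
  with d(2) that show ?thesis by simp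
qed

lemma in_chart_base: "z \<in> fst (jet_chart c) \<Longrightarrow> pi10 z \<in> fst c"
  by (simp add: fst_jet_chart)

lemma pi10_eq:
  "c \<in> fibred_charts A \<pi> \<Longrightarrow> z \<in> fst (jet_chart c) \<Longrightarrow> pi10 z = chart_inv c (P (snd (jet_chart c) z))"
  by (simp add: jet_chart_parts(1) MM.chart_inv_chart[OF fibred_chart_maximal] in_chart_base)

section \<open>The derivative of a change of jet coordinates\<close>

context
  fixes c c' :: "('m, 'e) chart" and z :: "'m jet"
  assumes c: "c \<in> fibred_charts A \<pi>" and c': "c' \<in> fibred_charts A \<pi>"
    and z: "z \<in> fst (jet_chart c)" and z': "z \<in> fst (jet_chart c')"
begin

private abbreviation F :: "'e \<Rightarrow> 'e" where "F \<equiv> \<lambda>x. snd c' (chart_inv c x)"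
private abbreviation u :: 'j where "u \<equiv> snd (jet_chart c) z"
private abbreviation G :: "'j \<Rightarrow> 'j" where "G \<equiv> \<lambda>x. snd (jet_chart c') (chart_inv (jet_chart c) x)"

lemma chart_change_smooth: "smooth_near F (P u)"
  using MM.smooth_transition[OF fibred_chart_maximal[OF c] fibred_chart_maximal[OF c']
      in_chart_base[OF z] in_chart_base[OF z']]
  by (simp add: jet_chart_parts(1)[OF c z])

lemma Dd_transition: "Dd G u = Dd (jet_transition c c') u"
proof (rule Dd_cong)
  show "eventually (\<lambda>x. G x = jet_transition c c' x) (nhds u)"
    using JN.eventually_chart[OF jet_chart_N[OF c] jet_chart_N[OF c'] z z']
    by eventually_elim (use jet_transition[OF c c'] in metis)
qed

lemma jet_transition_smooth': "smooth_near (jet_transition c c') u"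
  by (rule jet_transition_smooth[OF c c'])
     (use jet_chart_parts(1)[OF c z] in_chart_base[OF z] in_chart_base[OF z'] in auto)

text \<open>Coordinate 0 is \<open>\<pi>\<close> in both charts, so the change of coordinates
  preserves it on a whole neighbourhood.\<close>

lemma coord0_chart_change: "coord 0 (Dd F (P u) x) = coord 0 x"
proof -
  have "coord 0 (Dd F (P u) x) = Dd (\<lambda>y. coord 0 (F y)) (P u) x" by (simp add: Dd_coord[OF chart_change_smooth])
  also have "Dd (\<lambda>y. coord 0 (F y)) (P u) = Dd (coord 0) (P u)"
  proof (rule Dd_cong)
    show "eventually (\<lambda>y. coord 0 (F y) = coord 0 y) (nhds (P u))"
      unfolding jet_chart_parts(1)[OF c z]
      using MM.eventually_chart[OF fibred_chart_maximal[OF c] fibred_chart_maximal[OF c']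
          in_chart_base[OF z] in_chart_base[OF z']]
      by eventually_elim (metis fibred_chart_coord0[OF c] fibred_chart_coord0[OF c'])
  qed
  finally show ?thesis by (simp add: Dd_bounded_linear[OF bounded_linear_coord])
qed

text \<open>Along a fibre \<open>jet_transition\<close> is affine with linear part
  \<open>Dd F (P u)\<close>: vertical components transform as base vectors with t-component 0
  do.\<close>

lemma Dd_transition_vert_lift:
  assumes x: "coord 0 x = 0"
  shows "Dd G u (K x) = K (Dd F (P u) x)"
  unfolding Dd_transition
proof (rule Dd_affine_line[OF smooth_near_differentiable[OF jet_transition_smooth']])
  have "jet_transition c c' (u + s *\<^sub>R K x) = jet_transition c c' u + s *\<^sub>R K (Dd F (P u) x)" for s
  proof -
    have "P (u + s *\<^sub>R K x) = P u"
      by (simp add: linear_add[OF linear_parts(1)] linear_scale[OF linear_parts(1)] P_K)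
    moreover have "Q (u + s *\<^sub>R K x) = Q u + s *\<^sub>R x"
      by (simp add: linear_add[OF linear_parts(2)] linear_scale[OF linear_parts(2)] L_K[OF x])
    moreover have "Dd F (P u) (Q u + s *\<^sub>R x) = Dd F (P u) (Q u) + s *\<^sub>R Dd F (P u) x"
      by (simp only: linear_add[OF Dd_linear[OF chart_change_smooth], of "Q u"] linear_scale[OF Dd_linear[OF chart_change_smooth]])
    ultimately show ?thesis
      by (simp only: jet_transition_def Let_def linear_add[OF linear_parts(4)] linear_scale[OF linear_parts(4)] add.assoc)
  qed
  then show "eventually (\<lambda>s. jet_transition c c' (u + s *\<^sub>R K x) = jet_transition c c' u + s *\<^sub>R K (Dd F (P u) x)) (nhds 0)"
    by simp
qed

lemma base_part_Dd_transition: "P (Dd G u w) = Dd F (P u) (P w)"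
proof -
  note lin = smooth_near_linear[OF bounded_linear_parts(1)]
  have "P (Dd G u w) = Dd (\<lambda>x. P (jet_transition c c' x)) u w"
    unfolding Dd_transition
    by (simp add: Dd_compose[OF jet_transition_smooth' lin] Dd_bounded_linear[OF bounded_linear_parts(1)])
  also have "(\<lambda>x. P (jet_transition c c' x)) = (\<lambda>x. F (P x))"
    by (simp add: jet_transition_def Let_def P_jet)
  also have "Dd (\<lambda>x. F (P x)) u w = Dd F (P u) (P w)"
    using Dd_compose[OF lin chart_change_smooth, where v = w] by (simp add: Dd_bounded_linear[OF bounded_linear_parts(1)])
  finally show ?thesis .
qed

lemma Q_transition: "Q (snd (jet_chart c') z) = Dd F (P u) (Q u)"
  unfolding jet_transition[OF c c' z z'] jet_transition_def Let_def
  by (rule Q_jet) (simp only: coord0_chart_change coord_Q0)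

end

text \<open>The components \<open>(0, \<delta>x)\<close> of the contact forms on a tangent vector with components \<open>w\<close>.\<close>
definition contact_vec :: "'j \<Rightarrow> 'j \<Rightarrow> 'e" where
  "contact_vec u w = P w - coord 0 w *\<^sub>R Q u"

lemma coord0_contact_vec: "coord 0 (contact_vec u w) = 0"
  unfolding contact_vec_def by (simp only: coord_diff coord_scaleR coord_Q0 coord_P[OF le0])

lemma coord_contact_vec:
  "1 \<le> i \<Longrightarrow> i \<le> n \<Longrightarrow> coord i (contact_vec u w) = coord i w - coord 0 w * coord (n + i) u"
  by (simp add: contact_vec_def coord_diff coord_scaleR coord_add coord_P coord_L coord_e0)

lemma coord_components: "i < DIM('j) \<Longrightarrow> coord i (components d v) = v (\<lambda>q. coord i (snd d q))"
  for d :: "('m jet, 'j) chart"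
  unfolding coord_def by (simp add: components_inner basis_vec_Basis)

lemma contact_form_eq:
  fixes d :: "('m jet, 'j) chart"
  assumes "1 \<le> i" "i \<le> n"
  shows "contact_form n d i z v = coord i (contact_vec (snd d z) (components d v))"
  using assms dim_j by (simp add: contact_form_def coord_contact_vec coord_components)

lemma contact_sum_eq:
  assumes d: "d \<in> N" "z \<in> fst d"
  shows "(\<Sum>i=1..n. contact_form n d i z v * dir_deriv N d z (basis_vec (n + i)) f) =
    dir_deriv N d z (K (contact_vec (snd d z) (components d v))) f"
proof -
  have "(\<Sum>i=1..n. contact_form n d i z v * dir_deriv N d z (basis_vec (n + i)) f) =
      (\<Sum>i=1..n. coord i (contact_vec (snd d z) (components d v)) * dir_deriv N d z (basis_vec (n + i)) f)"
    by (rule sum.cong) (simp_all add: contact_form_eq)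
  then show ?thesis
    by (simp add: vert_lift_def linear_sum[OF JN.dir_deriv_linear[OF d]] linear_scale[OF JN.dir_deriv_linear[OF d]])
qed

lemma components_transition:
  assumes "v \<in> tangent_space N z" "d \<in> N" "z \<in> fst d" "d' \<in> N" "z \<in> fst d'"
  shows "components d' v = Dd (\<lambda>x. snd d' (chart_inv d x)) (snd d z) (components d v)"
  using JN.dir_deriv_components[OF assms(1-3)] JN.dir_deriv_transition[OF assms(2,4,3,5)]
    JN.components_dir_deriv[OF assms(4,5)] by metis

text \<open>\<open>P w\<close> and \<open>Q u\<close> both transform by the derivative of the base
  change, and the t-component of \<open>w\<close> is preserved. So the contact components transform
  in that way as well, and \<open>Dd_transition_vert_lift\<close> turns this into the transformation
  of a tangent vector.\<close>

lemma vert_endo_invariant: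
  assumes v: "v \<in> tangent_space N z" and d: "d \<in> N" "z \<in> fst d" and d': "d' \<in> N" "z \<in> fst d'"
  shows "dir_deriv N d z (K (contact_vec (snd d z) (components d v))) =
    dir_deriv N d' z (K (contact_vec (snd d' z) (components d' v)))"
proof -
  obtain c c' where c: "c \<in> fibred_charts A \<pi>" "d = jet_chart c" "c' \<in> fibred_charts A \<pi>" "d' = jet_chart c'"
    using d d' unfolding N_charts by blast
  let ?F = "\<lambda>x. snd c' (chart_inv c x)"
  let ?u = "snd d z"
  let ?DF = "Dd ?F (P ?u)"
  let ?DG = "Dd (\<lambda>x. snd d' (chart_inv d x)) ?u"
  let ?w = "components d v"
  note facts = c(1) c(3) d(2)[unfolded c(2)] d'(2)[unfolded c(4)]
  have lin: "linear ?DF" unfolding c(2) by (rule Dd_linear[OF chart_change_smooth[OF facts]])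
  have PDG: "P (?DG ?w) = ?DF (P ?w)" unfolding c(2,4) by (rule base_part_Dd_transition[OF facts])
  have "coord 0 (?DG ?w) = coord 0 (P (?DG ?w))" by (simp add: coord_P)
  also have "\<dots> = coord 0 (?DF (P ?w))" by (simp only: PDG)
  also have "\<dots> = coord 0 (P ?w)" unfolding c(2) by (rule coord0_chart_change[OF facts])
  finally have c0: "coord 0 (?DG ?w) = coord 0 ?w" by (simp add: coord_P)
  have Qt: "Q (snd d' z) = ?DF (Q ?u)" unfolding c(2,4) by (rule Q_transition[OF facts])
  have "contact_vec (snd d' z) (components d' v) = ?DF (P ?w) - coord 0 ?w *\<^sub>R ?DF (Q ?u)"
    unfolding contact_vec_def components_transition[OF v d d'] PDG c0 Qt ..
  also have "\<dots> = ?DF (contact_vec ?u ?w)"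
    unfolding contact_vec_def by (simp only: linear_diff[OF lin] linear_scale[OF lin])
  finally have "K (contact_vec (snd d' z) (components d' v)) = ?DG (K (contact_vec ?u ?w))"
    using Dd_transition_vert_lift[OF facts coord0_contact_vec, of ?u ?w] by (simp add: c(2,4))
  then show ?thesis using JN.dir_deriv_transition[OF d(1) d'(1) d(2) d'(2)] by metis
qed

abbreviation J :: "'m jet vfield \<Rightarrow> 'm jet vfield" where
  "J \<equiv> vert_endo n N"

text \<open>It resolves the \<open>THE\<close> in \<open>vert_endo\<close>: by invariance the
  expression in any one chart satisfies the condition for all charts.\<close>

lemma vert_endo_sum:
  assumes X: "X z \<in> tangent_space N z" and d: "d \<in> N" "z \<in> fst d"
  shows "J X z = (\<lambda>f. \<Sum>i=1..n. contact_form n d i z (X z) * dir_deriv N d z (basis_vec (n + i)) f)" (is "_ = ?R d")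
proof -
  have R: "?R d' = dir_deriv N d' z (K (contact_vec (snd d' z) (components d' (X z))))"
    if "d' \<in> N" "z \<in> fst d'" for d'
    by (rule ext) (rule contact_sum_eq[OF that])
  have "(THE u. \<forall>c\<in>N. z \<in> fst c \<longrightarrow> u = ?R c) = ?R d"
  proof (rule the_equality)
    show "\<forall>c\<in>N. z \<in> fst c \<longrightarrow> ?R d = ?R c"
    proof (intro ballI impI)
      show "?R d = ?R d'" if "d' \<in> N" "z \<in> fst d'" for d'
        unfolding R[OF d] R[OF that] by (rule vert_endo_invariant[OF X d that])
    qed
    show "u = ?R d" if "\<forall>c\<in>N. z \<in> fst c \<longrightarrow> u = ?R c" for u
      using that d by blast
  qed
  then show ?thesis using JN.pointsI[OF d] by (simp add: vert_endo_def)
qed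

lemma vert_endo_eq:
  assumes X: "X z \<in> tangent_space N z" and d: "d \<in> N" "z \<in> fst d"
  shows "J X z = dir_deriv N d z (K (contact_vec (snd d z) (components d (X z))))"
  unfolding vert_endo_sum[of X z, OF X d] by (rule ext) (rule contact_sum_eq[OF d])

lemma vert_endo_off: "z \<notin> points N \<Longrightarrow> J X z = (\<lambda>f. 0)"
  by (simp add: vert_endo_def)

lemma smooth_at_coord: "d \<in> N \<Longrightarrow> z \<in> fst d \<Longrightarrow> smooth_at N z (\<lambda>q. coord i (snd d q))"
  unfolding coord_def by (rule JN.smooth_at_coordinate)

lemma vert_endo_field:
  assumes X: "X \<in> vector_fields N"
  shows "J X \<in> vector_fields N"
  unfolding vector_fields_def mem_Collect_eq
proof (intro conjI ballI allI impI)
  note tX = JN.vector_field_tangent[OF X]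
  show "J X z \<in> tangent_space N z" if z: "z \<in> points N" for z
  proof -
    obtain d where d: "d \<in> N" "z \<in> fst d" using z by (rule JN.pointsE)
    show ?thesis unfolding vert_endo_eq[of X z, OF tX[OF z] d] JN.tangent_space_eq[OF d] by simp
  qed
  show "J X z = (\<lambda>f. 0)" if "z \<notin> points N" for z using that by (rule vert_endo_off)
  show "smooth_at N z (\<lambda>q. J X q f)" if f: "smooth_at N z f" for z f
  proof -
    have z: "z \<in> points N" using f by (rule JN.smooth_at_in_points)
    then obtain d where d: "d \<in> N" "z \<in> fst d" by (rule JN.pointsE)
    let ?D = "\<lambda>i q. Dd (\<lambda>x. f (chart_inv d x)) (snd d q) (basis_vec (n + i))"
    have "eventually (\<lambda>q. (\<Sum>i=1..n. contact_form n d i q (X q) * ?D i q) = J X q f) (JN.nhds_pt z)"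
      using JN.eventually_in_chart[OF d] JN.smooth_at_eventually[OF f]
    proof eventually_elim
      case (elim q)
      then show ?case
        using vert_endo_sum[of X q, OF tX d(1)] JN.smooth_at_in_points by (simp add: JN.dir_deriv_smooth)
    qed
    moreover have "smooth_at N z (\<lambda>q. \<Sum>i=1..n. contact_form n d i q (X q) * ?D i q)"
      unfolding contact_form_def
    proof (intro JN.smooth_at_sum[OF z] JN.smooth_at_mult JN.smooth_at_diff)
      have "smooth_near (\<lambda>y. Dd (\<lambda>x. f (chart_inv d x)) y b) (snd d z)" for b
        using f JN.smooth_at_iff[OF d] by (intro smooth_near_Dd) simp
      then show "smooth_at N z (?D i)" for i by (rule JN.smooth_at_chart[OF d])
    qed (intro JN.vector_field_smooth[OF X] smooth_at_coord[OF d])+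
    ultimately show ?thesis by (rule JN.smooth_at_cong)
  qed
qed

lemma components_vert_endo:
  assumes "X \<in> vector_fields N" "d \<in> N" "z \<in> fst d"
  shows "components d (J X z) = K (contact_vec (snd d z) (components d (X z)))"
  using vert_endo_eq[of X z, OF JN.vector_field_tangent[OF assms(1) JN.pointsI[OF assms(2,3)]] assms(2,3)]
  by (simp add: JN.components_dir_deriv[OF assms(2,3)])

section \<open>Functions pulled back along \<open>pi10\<close>, vertical vectors, and
  \<open>dt\<close>\<close>

lemma eventually_pi10:
  assumes z: "z \<in> points N" and R: "eventually R (M.nhds_pt (pi10 z))"
  shows "eventually (\<lambda>q. R (pi10 q)) (JN.nhds_pt z)"
proof -
  obtain c where c: "c \<in> fibred_charts A \<pi>" "z \<in> fst (jet_chart c)" using z by (rule N_pointE)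
  note d = jet_chart_N[OF c(1)]
  have "eventually (\<lambda>y. R (chart_inv c y)) (nhds (P (snd (jet_chart c) z)))"
    using R unfolding M.maximal_atlas_chart(3)[OF fibred_chart_maximal[OF c(1)] in_chart_base[OF c(2)]]
      eventually_filtermap jet_chart_parts(1)[OF c] .
  from eventually_compose_filterlim[OF this smooth_near_filterlim[OF smooth_near_linear[OF bounded_linear_parts(1)]]]
    JN.eventually_chart[OF d d c(2) c(2)]
  have "eventually (\<lambda>x. R (pi10 (chart_inv (jet_chart c) x))) (nhds (snd (jet_chart c) z))"
    by eventually_elim (simp add: pi10_eq[OF c(1)])
  then show ?thesis by (simp add: JN.eventually_nhds_pt[OF d c(2)])
qed

context
  fixes c :: "('m, 'e) chart" and z :: "'m jet" and g :: "'m \<Rightarrow> real"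
  assumes c: "c \<in> fibred_charts A \<pi>" and z: "z \<in> fst (jet_chart c)" and g: "smooth_at A (pi10 z) g"
begin

lemma basic_rep_smooth: "smooth_near (\<lambda>y. g (chart_inv c y)) (P (snd (jet_chart c) z))"
  using g MM.smooth_at_iff[OF fibred_chart_maximal[OF c] in_chart_base[OF z]]
  by (simp add: M.smooth_at_maximal_atlas jet_chart_parts(1)[OF c z])

lemma basic_rep_compose: "smooth_near (\<lambda>x. g (chart_inv c (P x))) (snd (jet_chart c) z)"
  by (rule smooth_near_compose[OF smooth_near_linear[OF bounded_linear_parts(1)] basic_rep_smooth])

lemma basic_eventually:
  "eventually (\<lambda>q. g (chart_inv c (P (snd (jet_chart c) q))) = (g \<circ> pi10) q) (JN.nhds_pt z)"
  using JN.eventually_in_chart[OF jet_chart_N[OF c] z] by eventually_elim (simp add: pi10_eq[OF c])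

lemma basic_smooth: "smooth_at N z (g \<circ> pi10)"
  by (rule JN.smooth_at_cong[OF basic_eventually])
     (rule JN.smooth_at_chart[OF jet_chart_N[OF c] z basic_rep_compose])

lemma basic_deriv:
  assumes v: "v \<in> tangent_space N z"
  shows "v (g \<circ> pi10) = Dd (\<lambda>y. g (chart_inv c y)) (P (snd (jet_chart c) z)) (P (components (jet_chart c) v))"
proof -
  have "v (g \<circ> pi10) = v (\<lambda>q. g (chart_inv c (P (snd (jet_chart c) q))))"
    by (rule JN.tangent_vector_cong[OF v basic_eventually, symmetric])
  also have "\<dots> = Dd (\<lambda>x. g (chart_inv c (P x))) (snd (jet_chart c) z) (components (jet_chart c) v)"
    by (rule JN.tangent_vector_chart[OF v jet_chart_N[OF c] z basic_rep_compose])
  also have "\<dots> = Dd (\<lambda>y. g (chart_inv c y)) (P (snd (jet_chart c) z)) (P (components (jet_chart c) v))"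
    by (subst Dd_compose[OF smooth_near_linear[OF bounded_linear_parts(1)] basic_rep_smooth])
       (simp add: Dd_bounded_linear[OF bounded_linear_parts(1)])
  finally show ?thesis .
qed

end

text \<open>In coordinates \<open>P\<close> is the differential of \<open>pi10\<close>, so a vector
  killed by \<open>P\<close> kills every pulled-back function. Conversely, the base coordinates are
  themselves pulled back.\<close>

lemma vertical_iff:
  assumes c: "c \<in> fibred_charts A \<pi>" and z: "z \<in> fst (jet_chart c)" and v: "v \<in> tangent_space N z"
  shows "vertical A z v \<longleftrightarrow> P (components (jet_chart c) v) = 0"
proof
  assume *: "P (components (jet_chart c) v) = 0"
  have "v (g \<circ> pi10) = 0" if g: "smooth_at A (pi10 z) g" for g
    using basic_deriv[OF c z g v] linear_0[OF Dd_linear[OF basic_rep_smooth[OF c z g]]] by (simp add: *)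
  then show "vertical A z v" by (simp add: vertical_def)
next
  assume *: "vertical A z v"
  note cm = fibred_chart_maximal[OF c]
  have "coord i (P (components (jet_chart c) v)) = 0" if i: "i \<le> n" for i
  proof -
    \<comment> \<open>A coordinate function is smooth only on its chart, which is enough because
      \<open>vertical\<close> quantifies over functions smooth near the base point.\<close>
    let ?g = "\<lambda>p. coord i (snd c p)"
    have g: "smooth_at A (pi10 z) ?g"
      using MM.smooth_at_coordinate[OF cm in_chart_base[OF z], of "basis_vec i"]
      by (simp add: M.smooth_at_maximal_atlas coord_def)
    have "eventually (\<lambda>q. (?g \<circ> pi10) q = coord i (snd (jet_chart c) q)) (JN.nhds_pt z)"
      using JN.eventually_in_chart[OF jet_chart_N[OF c] z]
      by eventually_elim (metis comp_apply coord_P[OF i] jet_chart_parts(1)[OF c])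
    then have "v (\<lambda>q. coord i (snd (jet_chart c) q)) = v (?g \<circ> pi10)"
      using JN.tangent_vector_cong[OF v] by metis
    also have "\<dots> = 0" using * g by (simp add: vertical_def)
    finally show ?thesis using i dim_j by (simp add: coord_P coord_components)
  qed
  then show "P (components (jet_chart c) v) = 0" by (simp add: eq_e_iff coord_zero)
qed

definition vert_field :: "'m jet vfield \<Rightarrow> bool" where
  "vert_field X \<longleftrightarrow> (\<forall>z\<in>points N. vertical A z (X z))"

lemma vert_field_vert_endo:
  assumes X: "X \<in> vector_fields N"
  shows "vert_field (J X)"
  unfolding vert_field_def
proof
  fix z assume z: "z \<in> points N"
  then obtain c where c: "c \<in> fibred_charts A \<pi>" "z \<in> fst (jet_chart c)" by (rule N_pointE)
  show "vertical A z (J X z)"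
    using vertical_iff[OF c JN.vector_field_tangent[OF vert_endo_field[OF X] z]]
    by (simp add: components_vert_endo[OF X jet_chart_N[OF c(1)] c(2)] P_K)
qed

lemma vert_endo_zero: "J (\<lambda>z f. 0) = (\<lambda>z f. 0)"
proof
  fix z
  show "J (\<lambda>z f. 0) z = (\<lambda>f. 0)"
  proof (cases "z \<in> points N")
    case True
    then obtain d where d: "d \<in> N" "z \<in> fst d" by (rule JN.pointsE)
    note lin0 = linear_0[OF JN.dir_deriv_linear[OF d]]
    have t: "(\<lambda>f. 0) \<in> tangent_space N z"
      unfolding JN.tangent_space_eq[OF d] by (rule image_eqI[of _ _ 0]) (simp_all add: lin0 fun_eq_iff)
    have "contact_vec u 0 = 0" for u
      by (simp add: contact_vec_def linear_0[OF linear_parts(1)] coord_zero)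
    then show ?thesis
      using vert_endo_eq[of "\<lambda>z f. 0", OF t d]
      by (simp add: components_def linear_0[OF linear_parts(4)] lin0 fun_eq_iff)
  qed (rule vert_endo_off)
qed

text \<open>\<open>dt\<close> is defined through the source \<open>fst\<close> of a jet, while
  charts know only coordinate 0; as germs the two are equal.\<close>

lemma fst_eventually:
  assumes c: "c \<in> fibred_charts A \<pi>" "z \<in> fst (jet_chart c)"
  shows "eventually (\<lambda>q. coord 0 (snd (jet_chart c) q) = fst q) (JN.nhds_pt z)"
  using JN.eventually_in_chart[OF jet_chart_N[OF c(1)] c(2)]
  by eventually_elim (rule jet_chart_parts(3)[OF c(1)])

lemma fst_smooth: "z \<in> points N \<Longrightarrow> smooth_at N z fst"
  by (erule N_pointE, rule JN.smooth_at_cong[OF fst_eventually]) (auto intro: smooth_at_coord jet_chart_N)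

lemma dt_eq:
  assumes X: "X \<in> vector_fields N" and c: "c \<in> fibred_charts A \<pi>" "z \<in> fst (jet_chart c)"
  shows "dt X z = coord 0 (components (jet_chart c) (X z))"
proof -
  have "z \<in> points N" using JN.pointsI[OF jet_chart_N[OF c(1)] c(2)] .
  then have "X z (\<lambda>q. coord 0 (snd (jet_chart c) q)) = X z fst"
    by (rule JN.vector_field_cong[OF X _ fst_eventually[OF c]])
  then show ?thesis by (simp add: dt_def coord_components)
qed

lemma dt_smooth:
  assumes "X \<in> vector_fields N"
  shows "dt X \<in> smooth_functions N"
proof -
  have "smooth_at N z (dt X)" if "z \<in> points N" for z
    unfolding dt_def[abs_def] by (rule JN.vector_field_smooth[OF assms fst_smooth[OF that]])
  then show ?thesis
    using JN.vector_field_off[OF assms] by (simp add: smooth_functions_def dt_def)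
qed

end

section \<open>Semisprays in coordinates\<close>

locale semispray_bundle = jet_bundle A \<pi> n N
  for A :: "('m, 'e::euclidean_space) atlas" and \<pi> n and N :: "('m jet, 'j::euclidean_space) atlas" +
  fixes S :: "'m jet vfield"
  assumes semispray: "semispray n N S"
begin

lemma S_field: "S \<in> vector_fields N"
  and J_S: "J S = (\<lambda>z f. 0)"
  and dt_S: "z \<in> points N \<Longrightarrow> dt S z = 1"
  using semispray by (auto simp: semispray_def)

text \<open>\<open>J S = 0\<close> makes the contact components of \<open>S\<close> vanish, and
  \<open>dt S = 1\<close> fixes the remaining one: \<open>S\<close> is d/dt + y d/dx plus a vertical
  term.\<close>

lemma P_components_S:
  assumes c: "c \<in> fibred_charts A \<pi>" "z \<in> fst (jet_chart c)"
  shows "P (components (jet_chart c) (S z)) = Q (snd (jet_chart c) z)"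
proof -
  note d = jet_chart_N[OF c(1)]
  let ?x = "contact_vec (snd (jet_chart c) z) (components (jet_chart c) (S z))"
  have "K ?x = components (jet_chart c) (J S z)" by (simp add: components_vert_endo[OF S_field d c(2)])
  also have "\<dots> = 0" by (simp add: J_S components_def)
  \<comment> \<open>\<open>K\<close> drops coordinate 0 and is not injective; \<open>L\<close>
    recovers the contact vector because its coordinate 0 is 0.\<close>
  finally have "L (K ?x) = L 0" by simp
  then have "?x = 0" by (simp add: L_K coord0_contact_vec linear_0[OF linear_parts(2)])
  moreover have "coord 0 (components (jet_chart c) (S z)) = 1"
    using dt_eq[OF S_field c] dt_S JN.pointsI[OF d c(2)] by simp
  ultimately show ?thesis by (simp add: contact_vec_def)
qed

text \<open>On a base coordinate x, \<open>V x = 0\<close> and \<open>S x\<close> is the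
  corresponding component of \<open>Q\<close>, so the bracket gives minus the derivative of y along
  \<open>V\<close>. Thus its base components are minus the fibre components of \<open>V\<close>, and
  \<open>J\<close> moves them back into the fibre.\<close>

lemma vert_endo_bracket:
  assumes V: "V \<in> vector_fields N" and vV: "vert_field V"
  shows "J (JN.bracket S V) = (\<lambda>z f. - V z f)"
proof
  fix z
  note br = JN.vector_field_lie_bracket[OF S_field V]
  show "J (JN.bracket S V) z = (\<lambda>f. - V z f)"
  proof (cases "z \<in> points N")
    case z: True
    then obtain c where c: "c \<in> fibred_charts A \<pi>" "z \<in> fst (jet_chart c)" by (rule N_pointE)
    define d where "d = jet_chart c"
    have d: "d \<in> N" "z \<in> fst d" using jet_chart_N[OF c(1)] c(2) by (simp_all add: d_def)
    let ?w = "components d (V z)"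
    let ?\<omega> = "components d (JN.bracket S V z)"
    note tV = JN.vector_field_tangent[OF V z]
    have PV: "P (components d (V q)) = 0" if "q \<in> fst d" for q
      using vertical_iff[OF c(1), of q "V q"] that JN.vector_field_tangent[OF V] JN.pointsI[OF d(1) that] vV
      by (simp add: vert_field_def d_def)
    have "coord i (P ?\<omega>) = coord i (- L ?w)" if i: "i \<le> n" for i
    proof -
      let ?x = "\<lambda>q. coord i (snd d q)"
      have lt: "i < DIM('j)" using i dim_j by simp
      have comp: "coord i (P (components d v)) = v ?x" for v
        using i lt by (simp add: coord_P coord_components)
      \<comment> \<open>That \<open>V\<close> is vertical near \<open>z\<close>, not just at
        \<open>z\<close>, makes the derivative along \<open>S\<close> vanish.\<close>
      have "eventually (\<lambda>q. V q ?x = 0) (JN.nhds_pt z)"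
        using JN.eventually_in_chart[OF d] by eventually_elim (simp add: PV coord_zero flip: comp)
      then have "S z (\<lambda>q. V q ?x) = 0"
        using JN.vector_field_cong[OF S_field z, of "\<lambda>q. V q ?x" "\<lambda>q. 0"] JN.vector_field_zero_fun[OF S_field] by simp
      moreover have "eventually (\<lambda>q. S q ?x = coord i (Q (snd d q))) (JN.nhds_pt z)"
        using JN.eventually_in_chart[OF d]
        by eventually_elim (metis comp P_components_S[OF c(1)] d_def)
      then have "V z (\<lambda>q. S q ?x) = V z (\<lambda>q. coord i (Q (snd d q)))"
        by (rule JN.vector_field_cong[OF V z])
      moreover have "V z (\<lambda>q. coord i (Q (snd d q))) = coord i (L ?w)"
      proof -
        have hd: "((\<lambda>u. coord i (Q u)) has_derivative (\<lambda>w. coord i (0 + L w))) (at (snd d z))"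
          by (intro bounded_linear.has_derivative[OF bounded_linear_coord] has_derivative_add
              has_derivative_const bounded_linear_imp_has_derivative bounded_linear_parts)
        have sm: "smooth_near (\<lambda>u. coord i (Q u)) (snd d z)"
          by (rule smooth_near_coord[OF smooth_near_add[OF smooth_near_const smooth_near_linear[OF bounded_linear_parts(2)]]])
        show ?thesis using JN.tangent_vector_chart[OF tV d sm] Dd_unique[OF hd] by simp
      qed
      ultimately have "JN.bracket S V z ?x = - coord i (L ?w)"
        using smooth_at_coord[OF d, of i] by (simp add: JN.lie_bracket_smooth_eq)
      then show ?thesis using comp[of "JN.bracket S V z"] by (simp add: coord_minus)
    qed
    then have P\<omega>: "P ?\<omega> = - L ?w" by (simp add: eq_e_iff)
    have "coord 0 ?\<omega> = coord 0 (P ?\<omega>)" by (simp add: coord_P)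
    then have "coord 0 ?\<omega> = 0" by (simp add: P\<omega> coord_minus coord_L0)
    \<comment> \<open>The summand \<open>BL (P ?w)\<close> is 0 and is inserted only to match
      \<open>BL_P_K_L\<close>.\<close>
    then have "K (contact_vec (snd d z) ?\<omega>) = - (BL (P ?w) + K (L ?w))"
      by (simp add: contact_vec_def P\<omega> PV[OF d(2)] linear_0[OF linear_parts(3)] linear_neg[OF linear_parts(4)])
    also have "\<dots> = - ?w" by (simp only: BL_P_K_L)
    finally have "J (JN.bracket S V) z = dir_deriv N d z (- ?w)"
      using vert_endo_eq[of "JN.bracket S V" z, OF JN.vector_field_tangent[OF br z] d] by simp
    also have "\<dots> = (\<lambda>f. - V z f)"
      using linear_neg[OF JN.dir_deriv_linear[OF d]] JN.dir_deriv_components[OF tV d] by (simp add: fun_eq_iff)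
    finally show ?thesis .
  next
    case False
    then show ?thesis using JN.vector_field_off[OF V] by (simp add: vert_endo_off)
  qed
qed

text \<open>In coordinates: \<open>S g = g\<^sub>t + y g\<^sub>x\<close>, whose \<open>y\<close>-derivatives are those of \<open>g\<close> in the direction \<open>x\<close>.\<close>
lemma vert_endo_S_basic:
  assumes X: "X \<in> vector_fields N" and z: "z \<in> points N" and g: "smooth_at A (pi10 z) g"
  shows "J X z (\<lambda>q. S q (g \<circ> pi10)) = X z (g \<circ> pi10) - dt X z * S z (g \<circ> pi10)"
proof -
  obtain c where c: "c \<in> fibred_charts A \<pi>" "z \<in> fst (jet_chart c)" using z by (rule N_pointE)
  define d where "d = jet_chart c"
  have d: "d \<in> N" "z \<in> fst d" using jet_chart_N[OF c(1)] c(2) by (simp_all add: d_def)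
  let ?g = "\<lambda>y. g (chart_inv c y)"
  let ?u = "snd d z"
  let ?w = "components d (X z)"
  let ?x = "contact_vec ?u ?w"
  let ?H = "\<lambda>u. Dd ?g (P u) (Q u)"
  have smg: "smooth_near ?g (P ?u)" unfolding d_def by (rule basic_rep_smooth[OF c g])
  note ling = Dd_linear[OF smg]
  have smH: "smooth_near ?H ?u"
    by (rule smooth_near_Dd_compose[OF smooth_near_linear[OF bounded_linear_parts(1)] smg
          smooth_near_add[OF smooth_near_const smooth_near_linear[OF bounded_linear_parts(2)]]])
  have SG: "S q (g \<circ> pi10) = ?H (snd d q)" if "q \<in> fst d" "smooth_at A (pi10 q) g" for q
    unfolding d_def using that[unfolded d_def] JN.vector_field_tangent[OF S_field JN.pointsI[OF d(1) that(1)]]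
    by (subst basic_deriv[OF c(1)]) (simp_all add: P_components_S[OF c(1)])
  have "eventually (\<lambda>q. S q (g \<circ> pi10) = ?H (snd d q)) (JN.nhds_pt z)"
    using JN.eventually_in_chart[OF d] eventually_pi10[OF z M.smooth_at_eventually[OF g]]
    by eventually_elim (rule SG)
  then have "J X z (\<lambda>q. S q (g \<circ> pi10)) = J X z (\<lambda>q. ?H (snd d q))"
    by (rule JN.vector_field_cong[OF vert_endo_field[OF X] z])
  also have "\<dots> = Dd ?H ?u (K ?x)"
    using JN.tangent_vector_chart[OF JN.vector_field_tangent[OF vert_endo_field[OF X] z] d smH]
    by (simp add: components_vert_endo[OF X d])
  also have "\<dots> = Dd ?g (P ?u) ?x"
  proof (rule Dd_affine_line[OF smooth_near_differentiable[OF smH]])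
    have "?H (?u + s *\<^sub>R K ?x) = ?H ?u + s *\<^sub>R Dd ?g (P ?u) ?x" for s
    proof -
      have "P (?u + s *\<^sub>R K ?x) = P ?u"
        by (simp add: linear_add[OF linear_parts(1)] linear_scale[OF linear_parts(1)] P_K)
      moreover have "Q (?u + s *\<^sub>R K ?x) = Q ?u + s *\<^sub>R ?x"
        by (simp add: linear_add[OF linear_parts(2)] linear_scale[OF linear_parts(2)] L_K[OF coord0_contact_vec])
      ultimately show ?thesis by (simp only: linear_add[OF ling, of "Q ?u"] linear_scale[OF ling])
    qed
    then show "eventually (\<lambda>s. ?H (?u + s *\<^sub>R K ?x) = ?H ?u + s *\<^sub>R Dd ?g (P ?u) ?x) (nhds 0)" by simp
  qed
  also have "\<dots> = Dd ?g (P ?u) (P ?w) - coord 0 ?w * ?H ?u"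
    unfolding contact_vec_def by (simp only: linear_diff[OF ling] linear_scale[OF ling] real_scaleR_def)
  also have "Dd ?g (P ?u) (P ?w) = X z (g \<circ> pi10)"
    unfolding d_def by (rule basic_deriv[OF c g JN.vector_field_tangent[OF X z], symmetric])
  also have "coord 0 ?w = dt X z" unfolding d_def by (rule dt_eq[OF X c, symmetric])
  also have "?H ?u = S z (g \<circ> pi10)" by (rule SG[OF d(2) g, symmetric])
  finally show ?thesis .
qed

text \<open>On a pulled-back function two of the three terms of the Lie derivative of
  \<open>J\<close> vanish, because \<open>J\<close> has vertical values. The third is given by
  \<open>vert_endo_S_basic\<close>, and the definition of the projector then makes it act on such
  functions as the identity.\<close>

lemma horiz_proj_vertical:
  assumes X: "X \<in> vector_fields N"
  shows "vert_field (\<lambda>z f. X z f - horiz_proj n N S X z f)"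
  unfolding vert_field_def vertical_def
proof (intro ballI allI impI)
  fix z g assume z: "z \<in> points N" and g: "smooth_at A (pi10 z) g"
  obtain c where c: "c \<in> fibred_charts A \<pi>" "z \<in> fst (jet_chart c)" using z by (rule N_pointE)
  let ?G = "g \<circ> pi10"
  note sG = basic_smooth[OF c g]
  have vJ: "J Y q ?G = 0" if "Y \<in> vector_fields N" "q \<in> points N" "smooth_at A (pi10 q) g" for Y q
    using vert_field_vert_endo[OF that(1)] that by (simp add: vert_field_def vertical_def)
  have "eventually (\<lambda>q. J X q ?G = 0) (JN.nhds_pt z)"
    using JN.eventually_points[OF z] eventually_pi10[OF z M.smooth_at_eventually[OF g]]
    by eventually_elim (rule vJ[OF X])
  then have "S z (\<lambda>q. J X q ?G) = 0"
    using JN.vector_field_cong[OF S_field z, of "\<lambda>q. J X q ?G" "\<lambda>q. 0"] JN.vector_field_zero_fun[OF S_field] by simp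
  then have "lie_tensor N S J X z ?G = - (X z ?G - dt X z * S z ?G)"
    using vert_endo_S_basic[OF X z g] vJ[OF JN.vector_field_lie_bracket[OF S_field X] z g]
    by (simp add: lie_tensor_def JN.lie_bracket_smooth_eq[OF sG])
  then show "X z ?G - horiz_proj n N S X z ?G = 0" by (simp add: horiz_proj_def)
qed

end

theorem theorem5p1:
  fixes A :: "('m, 'e::euclidean_space) atlas"
    and \<pi> :: "'m \<Rightarrow> real"
    and n :: nat
    and N :: "('m jet, 'j::euclidean_space) atlas"
    and S :: "'m jet vfield"
    and \<theta> :: "'m jet form"
  assumes "DIM('e) = n + 1" and "DIM('j) = 2 * n + 1"
    and "fibred_manifold A \<pi>"
    and "N = jet_atlas n A \<pi>"
    and "semispray n N S"
    and "is_form N 1 \<theta>" and "semibasic A N \<theta>"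
    and "d_tensor N (vert_endo n N) \<theta> = zero_form"
  shows "(closed_form N (lie_form N S \<theta>) \<longleftrightarrow> exact_1form N (lie_form N S \<theta>)) \<and>
         (exact_1form N (lie_form N S \<theta>) \<longleftrightarrow> lie_form N S \<theta> = ext_d N (int_prod N S \<theta>)) \<and>
         (lie_form N S \<theta> = ext_d N (int_prod N S \<theta>) \<longleftrightarrow>
            d_tensor N (horiz_proj n N S) \<theta> = zero_form)"
proof -
  interpret semispray_bundle A \<pi> n N S
    using assms by unfold_locales (auto simp: fibred_manifold_def smooth_manifold_def)
  interpret F: one_form N \<theta> using assms by unfold_locales
  interpret semispray_setting N \<theta> S "vert_endo n N" "horiz_proj n N S" dt vert_field
  proof unfold_locales
    show "horiz_proj n N S X = (\<lambda>p f. (X p f - lie_tensor N S J X p f + dt X p * S p f) / 2)" for X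
      by (simp add: horiz_proj_def)
    \<comment> \<open>Semi-basicness speaks only of points of the jet manifold; elsewhere the value
      is 0 by the normalisation of forms.\<close>
    show "\<theta> [V] = (\<lambda>p. 0)" if V: "V \<in> vector_fields N" "vert_field V" for V
    proof
      show "\<theta> [V] z = 0" for z
        using V assms(7) F.form_off[OF V(1)] by (cases "z \<in> points N") (auto simp: semibasic_def vert_field_def)
    qed
  qed (fact S_field vert_endo_field vert_field_vert_endo J_S vert_endo_zero vert_endo_bracket dt_smooth dt_S
      horiz_proj_vertical assms)+
  show ?thesis by (rule equivalences)
qed

end
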